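(* Let $n\ge2$, $R>0$, and let $\{E_h\}_h$ be an equibounded sequence of sets belonging to $\mathcal U_R$ (i.e. all $E_h$ are contained in a common ball). Then there exist $E\in\mathcal U_R$ and a subsequence $\{E_{h_j}\}_j$ such that: (a) $E_{h_j}\to E$ in the sense of Kuratowski and $E_{h_j}\to E$ in $L^1$; (b) $\partial E_{h_j}\to\partial E$ in the sense of Kuratowski and $\lim_{j\to\infty}\mathcal H^{n-1}(\partial E_{h_j})=\mathcal H^{n-1}(\partial E)$; (c) there exists a constant $\eta\in\,]0,1[$ (depending only on $R$) such that for every $p\in\partial E$, if $C^\eta$ denotes the cylinder $\{x\in\mathbb R^{n-1}:|x|\le\eta R\}\times[-\eta R,\eta R]$ expressed with respect to any coordinate system belonging to $\mathcal S_p^{E}$, and $S^\eta$ denotes the section $C^\eta\cap\{z=0\}$, then $\partial E\cap C^\eta$ is the graph of a function $f\in W^{2,\infty}(S^\eta)$, and for all $j$ sufficiently large $\partial E_{h_j}\cap C^\eta$ is the graph of a function $f_j\in W^{2,\infty}(S^\eta)$. Moreover, $f_j\rightharpoonup f$ in the weak$^*$ topology of $W^{2,\infty}(S^\eta)$.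
   Context: The dimension $n$ is fixed. $B(q,R)$ is the open ball in $\mathbb R^n$ centred at $q$ with radius $R$. $\mathcal U_R$ is the class of all closed and bounded sets $E\subset\mathbb R^n$ such that for every $p\in\partial E$ there exist points $p',p''$ with $p\in\partial B(p',R)\cap\partial B(p'',R)$, $B(p',R)\subset E$ and $B(p'',R)\cap E=\emptyset$. For $E\in\mathcal U_R$ and $p\in\partial E$, $p'$ and $p''$ denote the centres of these interior and exterior balls, and $\mathcal S_p^{E}$ is the class of all (orthonormal) coordinate systems centred at $p$ such that the vector $\frac1{2R}(p''-p')$ coincides with the $n$-th vector of the coordinate basis. Points are written $(x,z)$ with $x\in\mathbb R^{n-1}$, $z\in\mathbb R$. Convergence in $L^1$: $E_h\to E$ in $L^1$ means that the characteristic functions satisfy $\chi_{E_h}\to\chi_E$ in $L^1(\mathbb R^n)$. Kuratowski convergence: closed sets $E_h$ converge to a closed set $E$ in the sense of Kuratowski if (i) whenever $p_h\in E_h$ and a subsequence $p_{h_k}\to p$, then $p\in E$; (ii) for every $p\in E$ there exist $p_h\in E_h$ with $p_h\to p$. $\mathcal H^{n-1}$ is the $(n-1)$-dimensional Hausdorff measure. *)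

theory Defs
  imports "HOL-Analysis.Analysis"
begin

section \<open>Sets with interior and exterior balls of radius R\<close>

definition touching_balls :: "real \<Rightarrow> 'a::euclidean_space set \<Rightarrow> 'a \<Rightarrow> 'a \<Rightarrow> 'a \<Rightarrow> bool" where
  "touching_balls R E p p' p'' \<longleftrightarrow>
     p \<in> frontier (ball p' R) \<inter> frontier (ball p'' R) \<and>
     ball p' R \<subseteq> E \<and> ball p'' R \<inter> E = {}"

definition ball_class :: "real \<Rightarrow> 'a::euclidean_space set set" where
  "ball_class R =
     {E. closed E \<and> bounded E \<and> (\<forall>p\<in>frontier E. \<exists>p' p''. touching_balls R E p p' p'')}"

text \<open>
  A coordinate system centred at \<open>p\<close> is represented by the map \<open>T\<close> that sends a coordinate
  pair \<open>(x, z)\<close> to the point it names; the images under \<open>L\<close> of the standard basis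
  vectors are the vectors of the coordinate basis, and \<open>L (0, 1)\<close> is the last one. The centres
  \<open>p'\<close> and \<open>p''\<close> are uniquely determined by \<open>E\<close> and \<open>p\<close>: the two balls are
  disjoint, so \<open>p\<close> is the midpoint of every interior and every exterior centre.
\<close>

definition coordinate_systems ::
    "real \<Rightarrow> 'a::euclidean_space set \<Rightarrow> 'a \<Rightarrow> ('b::euclidean_space \<times> real \<Rightarrow> 'a) set" where
  "coordinate_systems R E p =
     {T. \<exists>L p' p''. linear L \<and> (\<forall>u v. L u \<bullet> L v = u \<bullet> v) \<and> surj L \<and>
           T = (\<lambda>y. p + L y) \<and>
           touching_balls R E p p' p'' \<and>
           L (0, 1) = (1 / (2 * R)) *\<^sub>R (p'' - p')}"

definition cylinder :: "real \<Rightarrow> ('b::euclidean_space \<times> real) set" where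
  "cylinder r = cball 0 r \<times> {- r..r}"

definition graph_over :: "'b set \<Rightarrow> ('b \<Rightarrow> real) \<Rightarrow> ('b \<times> real) set" where
  "graph_over S f = (\<lambda>x. (x, f x)) ` S"


section \<open>Convergence of sets\<close>

text \<open>
  In the first condition the points are only required along the subsequence, so that it is
  not void when some of the sets are empty.
\<close>

definition kuratowski_convergent :: "(nat \<Rightarrow> 'a::metric_space set) \<Rightarrow> 'a set \<Rightarrow> bool" where
  "kuratowski_convergent A B \<longleftrightarrow>
     (\<forall>r q p. strict_mono (r :: nat \<Rightarrow> nat) \<and> (\<forall>k. q k \<in> A (r k)) \<and> q \<longlonglongrightarrow> p \<longrightarrow> p \<in> B) \<and>
     (\<forall>p\<in>B. \<exists>q. (\<forall>h. q h \<in> A h) \<and> q \<longlonglongrightarrow> p)"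

definition L1_convergent :: "(nat \<Rightarrow> 'a::euclidean_space \<Rightarrow> real) \<Rightarrow> ('a \<Rightarrow> real) \<Rightarrow> bool" where
  "L1_convergent u v \<longleftrightarrow>
     (\<forall>h. integrable lebesgue (u h)) \<and> integrable lebesgue v \<and>
     (\<lambda>h. \<integral>x. \<bar>u h x - v x\<bar> \<partial>lebesgue) \<longlonglongrightarrow> 0"

definition L1_set_convergent :: "(nat \<Rightarrow> 'a::euclidean_space set) \<Rightarrow> 'a set \<Rightarrow> bool" where
  "L1_set_convergent A B \<longleftrightarrow> L1_convergent (\<lambda>h. indicator (A h)) (indicator B)"


section \<open>Hausdorff measure\<close>

text \<open>
  The normalisation by the volume of the unit ball makes the \<open>k\<close>-dimensional measure agree
  with the usual surface area. Boundedness is explicit because \<open>diameter\<close> is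
  meaningless on unbounded sets; the empty set must be treated separately because
  \<open>0 ^ 0 = 1\<close>.
\<close>

definition hausdorff_premeasure :: "nat \<Rightarrow> real \<Rightarrow> 'a::metric_space set \<Rightarrow> ennreal" where
  "hausdorff_premeasure k \<delta> A =
     (INF U \<in> {U :: nat \<Rightarrow> 'a set.
                A \<subseteq> (\<Union>i. U i) \<and> (\<forall>i. bounded (U i) \<and> diameter (U i) \<le> \<delta>)}.
        \<Sum>i. if U i = {} then 0
            else ennreal (unit_ball_vol (real k) * (diameter (U i) / 2) ^ k))"

definition hausdorff_measure :: "nat \<Rightarrow> 'a::metric_space set \<Rightarrow> ennreal" where
  "hausdorff_measure k A = (SUP \<delta>\<in>{0<..}. hausdorff_premeasure k \<delta> A)"


section \<open>Weak derivatives and the Sobolev spaces with exponent infinity\<close>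

text \<open>
  A multi-index is represented by a list of standard basis vectors, the directions of
  successive partial differentiations.
\<close>

primrec iterated_partial ::
    "'a::euclidean_space list \<Rightarrow> ('a \<Rightarrow> real) \<Rightarrow> 'a \<Rightarrow> real" where
  "iterated_partial [] f = f"
| "iterated_partial (v # vs) f =
     (\<lambda>x. frechet_derivative (iterated_partial vs f) (at x) v)"

definition smooth :: "('a::euclidean_space \<Rightarrow> real) \<Rightarrow> bool" where
  "smooth f \<longleftrightarrow> (\<forall>vs x. set vs \<subseteq> Basis \<longrightarrow> iterated_partial vs f differentiable (at x))"

definition test_function :: "'a::euclidean_space set \<Rightarrow> ('a \<Rightarrow> real) \<Rightarrow> bool" where
  "test_function \<Omega> \<phi> \<longleftrightarrow>
     smooth \<phi> \<and> compact (closure {x. \<phi> x \<noteq> 0}) \<and> closure {x. \<phi> x \<noteq> 0} \<subseteq> \<Omega>"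

definition locally_integrable :: "'a::euclidean_space set \<Rightarrow> ('a \<Rightarrow> real) \<Rightarrow> bool" where
  "locally_integrable \<Omega> f \<longleftrightarrow> (\<forall>K. compact K \<and> K \<subseteq> \<Omega> \<longrightarrow> integrable (lebesgue_on K) f)"

definition has_weak_derivative ::
    "'a::euclidean_space set \<Rightarrow> 'a list \<Rightarrow> ('a \<Rightarrow> real) \<Rightarrow> ('a \<Rightarrow> real) \<Rightarrow> bool" where
  "has_weak_derivative \<Omega> vs f g \<longleftrightarrow>
     locally_integrable \<Omega> f \<and> locally_integrable \<Omega> g \<and>
     (\<forall>\<phi>. test_function \<Omega> \<phi> \<longrightarrow>
        (\<integral>x. f x * iterated_partial vs \<phi> x \<partial>lebesgue_on \<Omega>) =
        (-1) ^ length vs * (\<integral>x. g x * \<phi> x \<partial>lebesgue_on \<Omega>))"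

text \<open>A representative; weak derivatives are unique up to null sets.\<close>

definition weak_derivative ::
    "'a::euclidean_space set \<Rightarrow> 'a list \<Rightarrow> ('a \<Rightarrow> real) \<Rightarrow> 'a \<Rightarrow> real" where
  "weak_derivative \<Omega> vs f = (SOME g. has_weak_derivative \<Omega> vs f g)"

definition L_infinity :: "'a::euclidean_space set \<Rightarrow> ('a \<Rightarrow> real) set" where
  "L_infinity \<Omega> =
     {f. f \<in> borel_measurable (lebesgue_on \<Omega>) \<and> (\<exists>C. AE x in lebesgue_on \<Omega>. \<bar>f x\<bar> \<le> C)}"

definition sobolev_infinity :: "nat \<Rightarrow> 'a::euclidean_space set \<Rightarrow> ('a \<Rightarrow> real) set" where
  "sobolev_infinity k \<Omega> =
     {f \<in> L_infinity \<Omega>. \<forall>vs. set vs \<subseteq> Basis \<and> length vs \<le> k \<longrightarrow>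
        (\<exists>g\<in>L_infinity \<Omega>. has_weak_derivative \<Omega> vs f g)}"

text \<open>
  Weak* convergence in the Sobolev space: every derivative of order at most \<open>k\<close> converges
  weak* in the dual of \<open>L\<^sup>1\<close>. Finitely many members of the sequence may lie
  outside the space.
\<close>

definition L_infinity_weak_star_convergent ::
    "'a::euclidean_space set \<Rightarrow> (nat \<Rightarrow> 'a \<Rightarrow> real) \<Rightarrow> ('a \<Rightarrow> real) \<Rightarrow> bool" where
  "L_infinity_weak_star_convergent \<Omega> u v \<longleftrightarrow>
     v \<in> L_infinity \<Omega> \<and> (\<forall>\<^sub>F j in sequentially. u j \<in> L_infinity \<Omega>) \<and>
     (\<forall>\<psi>. integrable (lebesgue_on \<Omega>) \<psi> \<longrightarrow>
        (\<lambda>j. \<integral>x. u j x * \<psi> x \<partial>lebesgue_on \<Omega>) \<longlonglongrightarrow>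
        (\<integral>x. v x * \<psi> x \<partial>lebesgue_on \<Omega>))"

definition sobolev_weak_star_convergent ::
    "nat \<Rightarrow> 'a::euclidean_space set \<Rightarrow> (nat \<Rightarrow> 'a \<Rightarrow> real) \<Rightarrow> ('a \<Rightarrow> real) \<Rightarrow> bool" where
  "sobolev_weak_star_convergent k \<Omega> u v \<longleftrightarrow>
     v \<in> sobolev_infinity k \<Omega> \<and> (\<forall>\<^sub>F j in sequentially. u j \<in> sobolev_infinity k \<Omega>) \<and>
     (\<forall>vs. set vs \<subseteq> Basis \<and> length vs \<le> k \<longrightarrow>
        L_infinity_weak_star_convergent \<Omega>
          (\<lambda>j. weak_derivative \<Omega> vs (u j)) (weak_derivative \<Omega> vs v))"

end

theory Submission
  imports Defs "HOL-Complex_Analysis.Great_Picard"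
begin

text \<open>
  All constants in this theory depend on the radius \<open>R\<close> only, and this is why the class is compact.
  At a boundary point of a set with interior and exterior balls of radius \<open>R\<close> there is a unit normal,
  and since interior balls are disjoint from exterior balls, two elementary estimates hold:
  the boundary deviates at most quadratically from its tangent planes (\<open>unit_normal_quadratic\<close>),
  and the normal is Lipschitz continuous with constant \<open>1 / R\<close> (\<open>unit_normal_lipschitz\<close>).

  The limit set is obtained from the signed distance functions. They are equi-Lipschitz, so a
  subsequence converges pointwise to some \<open>\<sigma>\<close>, and the limit set is \<open>{\<sigma> \<le> 0}\<close>. Boundary points and
  their normals subconverge, and the touching balls pass to the limit. Hence the limit set
  belongs to the class and its boundary is exactly \<open>{\<sigma> = 0}\<close> (\<open>zero_imp_unit_normal\<close>, \<open>frontier_iff\<close>).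
  Kuratowski convergence is then immediate, and \<open>L\<^sup>1\<close> convergence follows by dominated
  convergence, because the boundary is negligible.

  The Hausdorff measures are compared directly. If two sets of the class are \<open>d\<close>-close, then every
  normal segment of half-length \<open>d\<close> of one boundary meets the other boundary, and choosing such
  meeting points contracts distances at most by the factor \<open>(R - d) / R\<close>
  (\<open>normal_displacement_expanding\<close>). Using this in both directions squeezes the measures.

  In the cylinder of size \<open>R / 4\<close> the normals are nearly vertical, for the limit set and, once the two
  tangent balls at \<open>p\<close> are almost respected, for the approximating sets too. So the boundary
  is a graph whose slope is bounded and whose first derivatives, being determined by the normals,
  are Lipschitz continuous (\<open>zero_set_graph\<close>). Lipschitz functions have bounded weak derivatives,
  because their difference quotients are bounded, and Mazur's trick extracts from a uniformly bounded
  sequence a strong limit that keeps its weak limits (\<open>bounded_sequence_weak_limit\<close>). The graph functions converge pointwise, since the sign of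
  \<open>\<sigma>\<close> tells on which side of the limit graph a point lies; as they stay in a fixed ball of the
  Sobolev space, and as test functions determine weak limits of bounded sequences, all derivatives
  converge weak* (\<open>sobolev_ball_weak_star_convergent\<close>).
\<close>

section \<open>Normals of sets with interior and exterior balls\<close>

text \<open>
  A normal \<open>v\<close> at \<open>a\<close> encodes both touching balls at once: their centres are \<open>a \<plusminus> R v\<close>, because
  \<open>a\<close> is the midpoint of the two centres of any pair of touching balls.
\<close>

definition unit_normal :: "real \<Rightarrow> 'a::euclidean_space set \<Rightarrow> 'a \<Rightarrow> 'a \<Rightarrow> bool" where
  "unit_normal R E a v \<longleftrightarrow>
     norm v = 1 \<and> ball (a - R *\<^sub>R v) R \<subseteq> E \<and> ball (a + R *\<^sub>R v) R \<inter> E = {}"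

lemma disjoint_balls_dist:
  fixes x y :: "'a::euclidean_space"
  assumes "ball x r \<inter> ball y s = {}" "r > 0" "s > 0"
  shows "norm (x - y) \<ge> r + s"
proof (rule ccontr)
  assume "\<not> norm (x - y) \<ge> r + s"
  then have less: "dist x y < r + s"
    by (simp add: dist_norm)
  define t where "t = r / (r + s)"
  define z where "z = x + t *\<^sub>R (y - x)"
  have t: "0 < t" "t < 1" "1 - t = s / (r + s)"
    using assms by (auto simp: t_def field_simps)
  have "dist x z = t * dist x y"
    using t by (simp add: z_def dist_norm norm_minus_commute)
  also have "\<dots> < t * (r + s)"
    using less t by simp
  also have "\<dots> = r"
    using assms by (simp add: t_def)
  finally have "z \<in> ball x r" by simp
  have "y - z = (1 - t) *\<^sub>R (y - x)"
    by (simp add: z_def algebra_simps)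
  then have "dist y z = (1 - t) * dist x y"
    using t(2) by (simp only: dist_norm norm_minus_commute[of x y] norm_scaleR)
  also have "\<dots> < (1 - t) * (r + s)"
    using less t(2) by (intro mult_strict_left_mono) auto
  also have "\<dots> = s"
    using assms t by simp
  finally have "z \<in> ball y s" by simp
  with \<open>z \<in> ball x r\<close> assms show False by auto
qed

lemma touching_balls_unit_normal:
  assumes "touching_balls R E p p' p''" "R > 0"
  shows "unit_normal R E p ((1 / (2 * R)) *\<^sub>R (p'' - p'))"
    and "p' = p - R *\<^sub>R ((1 / (2 * R)) *\<^sub>R (p'' - p'))"
    and "p'' = p + R *\<^sub>R ((1 / (2 * R)) *\<^sub>R (p'' - p'))"
proof -
  have n: "norm (p - p') = R" "norm (p - p'') = R"
    and sub: "ball p' R \<subseteq> E" "ball p'' R \<inter> E = {}"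
    using assms by (auto simp: touching_balls_def frontier_ball dist_norm norm_minus_commute)
  have "norm (p' - p'') \<ge> R + R"
    using sub assms by (intro disjoint_balls_dist) auto
  then have "(2 * R)\<^sup>2 \<le> (norm (p' - p''))\<^sup>2"
    using assms by (intro power_mono) auto
  moreover have "(norm ((p - p') + (p - p'')))\<^sup>2 + (norm ((p - p') - (p - p'')))\<^sup>2
      = 2 * (norm (p - p'))\<^sup>2 + 2 * (norm (p - p''))\<^sup>2"
    by (simp add: power2_norm_eq_inner inner_simps algebra_simps)
  moreover have "norm ((p - p') - (p - p'')) = norm (p' - p'')"
    by (simp add: norm_minus_commute)
  ultimately have "(norm ((p - p') + (p - p'')))\<^sup>2 \<le> 0"
    by (simp add: n power2_eq_square)
  then have "(p - p') + (p - p'') = 0" by simp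
  then have 2: "p'' = p + (p - p')"
    by (simp add: algebra_simps)
  then have "p'' - p' = 2 *\<^sub>R (p - p')"
    by (simp add: algebra_simps scaleR_2)
  then have eq: "(1 / (2 * R)) *\<^sub>R (p'' - p') = (1 / R) *\<^sub>R (p - p')"
    by simp
  show c1: "p' = p - R *\<^sub>R ((1 / (2 * R)) *\<^sub>R (p'' - p'))"
    unfolding eq using assms by simp
  show c2: "p'' = p + R *\<^sub>R ((1 / (2 * R)) *\<^sub>R (p'' - p'))"
    unfolding eq using assms 2 by simp
  have "norm ((1 / (2 * R)) *\<^sub>R (p'' - p')) = 1"
    unfolding eq using n assms by simp
  then show "unit_normal R E p ((1 / (2 * R)) *\<^sub>R (p'' - p'))"
    unfolding unit_normal_def using sub c1 c2 by metis
qed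

lemma unit_normal_touching_balls:
  assumes "unit_normal R E p v" "R > 0"
  shows "touching_balls R E p (p - R *\<^sub>R v) (p + R *\<^sub>R v)"
  using assms by (simp add: touching_balls_def unit_normal_def frontier_ball dist_norm)

lemma ball_class_iff:
  assumes "R > 0"
  shows "E \<in> ball_class R \<longleftrightarrow>
    closed E \<and> bounded E \<and> (\<forall>p\<in>frontier E. \<exists>v. unit_normal R E p v)"
  unfolding ball_class_def
  using touching_balls_unit_normal(1)[OF _ assms] unit_normal_touching_balls[OF _ assms]
  by blast

text \<open>
  Both balls at \<open>a\<close> avoid every other boundary point \<open>b\<close>; expanding \<open>|b - a \<plusminus> R v| \<ge> R\<close>
  shows that the boundary deviates only quadratically from its tangent plane at \<open>a\<close>.
\<close>

lemma unit_normal_quadratic: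
  assumes "unit_normal R E a v" "b \<in> frontier E" "R > 0"
  shows "\<bar>v \<bullet> (b - a)\<bar> \<le> (norm (b - a))\<^sup>2 / (2 * R)"
proof -
  have v: "norm v = 1" and i: "ball (a - R *\<^sub>R v) R \<subseteq> E" and o: "ball (a + R *\<^sub>R v) R \<inter> E = {}"
    using assms by (auto simp: unit_normal_def)
  have "ball (a - R *\<^sub>R v) R \<subseteq> interior E"
    using i by (simp add: interior_maximal)
  then have 1: "norm (b - (a - R *\<^sub>R v)) \<ge> R"
    using assms(2) by (force simp: frontier_def dist_norm norm_minus_commute)
  have "ball (a + R *\<^sub>R v) R \<inter> closure E = {}"
    using o by (simp add: open_Int_closure_eq_empty)
  then have 2: "norm (b - (a + R *\<^sub>R v)) \<ge> R"
    using assms(2) by (force simp: frontier_def dist_norm norm_minus_commute)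
  have e1: "(norm (b - (a - R *\<^sub>R v)))\<^sup>2 = (norm (b - a))\<^sup>2 + 2 * R * (v \<bullet> (b - a)) + R\<^sup>2 * (norm v)\<^sup>2"
    by (simp only: power2_norm_eq_inner) (simp add: inner_simps algebra_simps power2_eq_square inner_commute)
  have e2: "(norm (b - (a + R *\<^sub>R v)))\<^sup>2 = (norm (b - a))\<^sup>2 - 2 * R * (v \<bullet> (b - a)) + R\<^sup>2 * (norm v)\<^sup>2"
    by (simp only: power2_norm_eq_inner) (simp add: inner_simps algebra_simps power2_eq_square inner_commute)
  have "R\<^sup>2 \<le> (norm (b - (a - R *\<^sub>R v)))\<^sup>2" "R\<^sup>2 \<le> (norm (b - (a + R *\<^sub>R v)))\<^sup>2"
    using 1 2 assms(3) by (auto intro!: power_mono)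
  then have "2 * R * (v \<bullet> (b - a)) \<le> (norm (b - a))\<^sup>2" "- (2 * R * (v \<bullet> (b - a))) \<le> (norm (b - a))\<^sup>2"
    using e1 e2 v by auto
  then show ?thesis
    using assms(3) by (auto simp: abs_le_iff field_simps)
qed

text \<open>
  The interior ball at one point is disjoint from the exterior ball at the other one, so their
  centres are at least \<open>r + s\<close> apart, and this holds in both directions. Adding the squares of the
  two inequalities and using the parallelogram law eliminates the mixed term.
\<close>

lemma interior_exterior_sum:
  fixes a b v w :: "'a::euclidean_space"
  assumes "ball (a - R *\<^sub>R v) r \<subseteq> E" "ball (a + R *\<^sub>R v) r \<inter> E = {}"
    and "ball (b - R *\<^sub>R w) s \<subseteq> E" "ball (b + R *\<^sub>R w) s \<inter> E = {}"
    and "r > 0" "s > 0"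
  shows "(r + s)\<^sup>2 \<le> (norm (a - b))\<^sup>2 + R\<^sup>2 * (norm (v + w))\<^sup>2"
proof -
  have "r + s \<le> norm ((a - R *\<^sub>R v) - (b + R *\<^sub>R w))"
    by (rule disjoint_balls_dist) (use assms in blast)+
  then have 1: "(r + s)\<^sup>2 \<le> (norm ((a - R *\<^sub>R v) - (b + R *\<^sub>R w)))\<^sup>2"
    using assms by (intro power_mono) auto
  have "r + s \<le> norm ((a + R *\<^sub>R v) - (b - R *\<^sub>R w))"
    by (subst norm_minus_commute, subst add.commute, rule disjoint_balls_dist) (use assms in blast)+
  then have 2: "(r + s)\<^sup>2 \<le> (norm ((a + R *\<^sub>R v) - (b - R *\<^sub>R w)))\<^sup>2"
    using assms by (intro power_mono) auto
  have "(norm ((a - R *\<^sub>R v) - (b + R *\<^sub>R w)))\<^sup>2 + (norm ((a + R *\<^sub>R v) - (b - R *\<^sub>R w)))\<^sup>2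
      = 2 * ((norm (a - b))\<^sup>2 + R\<^sup>2 * (norm (v + w))\<^sup>2)"
    by (simp only: power2_norm_eq_inner)
      (simp add: inner_simps algebra_simps power2_eq_square inner_commute)
  with 1 2 show ?thesis by (simp add: field_simps)
qed

lemma norm_add_unit_vectors:
  fixes v w :: "'a::real_inner"
  assumes "norm v = 1" "norm w = 1"
  shows "(norm (v + w))\<^sup>2 = 4 - (norm (v - w))\<^sup>2" "(norm (v + w))\<^sup>2 = 2 + 2 * (v \<bullet> w)"
proof -
  have "v \<bullet> v = 1" "w \<bullet> w = 1"
    using assms by (auto simp: norm_eq_1)
  then show "(norm (v + w))\<^sup>2 = 4 - (norm (v - w))\<^sup>2" "(norm (v + w))\<^sup>2 = 2 + 2 * (v \<bullet> w)"
    by (simp_all add: power2_norm_eq_inner inner_simps inner_commute)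
qed

text \<open>
  For two pairs of balls of radius \<open>R\<close> the previous inequality reads
  \<open>4 R\<^sup>2 \<le> |a - b|\<^sup>2 + R\<^sup>2 |v + w|\<^sup>2\<close>, and for unit vectors \<open>|v + w|\<^sup>2 = 4 - |v - w|\<^sup>2\<close>.
\<close>

lemma unit_normal_lipschitz:
  assumes "unit_normal R E a v" "unit_normal R E b w" "R > 0"
  shows "norm (v - w) \<le> norm (a - b) / R"
proof -
  have "(R + R)\<^sup>2 \<le> (norm (a - b))\<^sup>2 + R\<^sup>2 * (norm (v + w))\<^sup>2"
    using assms unfolding unit_normal_def by (intro interior_exterior_sum[of a R v R E b w R]) simp_all
  also have "(norm (v + w))\<^sup>2 = 4 - (norm (v - w))\<^sup>2"
    using assms by (intro norm_add_unit_vectors) (auto simp: unit_normal_def)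
  finally have "(R * norm (v - w))\<^sup>2 \<le> (norm (a - b))\<^sup>2"
    by (simp add: power2_eq_square algebra_simps)
  then have "R * norm (v - w) \<le> norm (a - b)"
    by (rule power2_le_imp_le) simp
  then show ?thesis
    using assms by (simp add: field_simps)
qed

text \<open>Lipschitz continuity with coinciding base points is uniqueness.\<close>

lemma unit_normal_unique:
  assumes "unit_normal R E a v" "unit_normal R E a w" "R > 0"
  shows "v = w"
  using unit_normal_lipschitz[OF assms] by simp


section \<open>The signed distance function\<close>

text \<open>
  Negative inside \<open>E\<close>. For the empty set and the whole space one of the two distances is
  the default value \<open>0\<close>, and the sign loses its meaning.
\<close>

definition signed_dist :: "'a::euclidean_space set \<Rightarrow> 'a \<Rightarrow> real" where
  "signed_dist E x = infdist x E - infdist x (- E)"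

lemma signed_dist_lipschitz: "\<bar>signed_dist E x - signed_dist E y\<bar> \<le> 2 * dist x y"
  using infdist_triangle_abs[of x E y] infdist_triangle_abs[of x "- E" y]
  by (auto simp: signed_dist_def)

lemma continuous_on_signed_dist: "continuous_on A (signed_dist E)"
  unfolding signed_dist_def by (intro continuous_intros)

lemma signed_dist_inside: "x \<in> E \<Longrightarrow> signed_dist E x = - infdist x (- E)"
  by (simp add: signed_dist_def)

lemma signed_dist_outside: "x \<notin> E \<Longrightarrow> signed_dist E x = infdist x E"
  by (simp add: signed_dist_def)

lemma bounded_Compl_nonempty: "bounded (E :: 'a::euclidean_space set) \<Longrightarrow> - E \<noteq> {}"
  using not_bounded_UNIV by (metis Compl_empty_eq double_compl)

lemma signed_dist_le_0_iff:
  assumes "closed E" "E \<noteq> {}"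
  shows "signed_dist E x \<le> 0 \<longleftrightarrow> x \<in> E"
proof (cases "x \<in> E")
  case True
  then show ?thesis by (simp add: signed_dist_inside infdist_nonneg)
next
  case False
  then have "infdist x E > 0"
    using assms in_closed_iff_infdist_zero[of E x] infdist_nonneg[of x E] by linarith
  with False show ?thesis by (simp add: signed_dist_outside)
qed

lemma signed_dist_eq_0_iff:
  assumes "closed E" "E \<noteq> {}" "bounded E"
  shows "signed_dist E x = 0 \<longleftrightarrow> x \<in> frontier E"
proof -
  have "x \<in> frontier E \<longleftrightarrow> x \<in> E \<and> infdist x (- E) = 0"
    using assms bounded_Compl_nonempty[OF assms(3)]
    by (simp add: frontier_closures in_closure_iff_infdist_zero closure_closed)
  then show ?thesis
    using signed_dist_le_0_iff[OF assms(1,2), of x] signed_dist_inside[of x E] by auto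
qed

lemma signed_dist_exterior_ball:
  assumes "ball c r \<inter> E = {}" "E \<noteq> {}" "dist c x < r"
  shows "signed_dist E x \<ge> r - dist c x"
proof -
  have "infdist x E \<ge> r - dist c x"
    unfolding infdist_notempty[OF assms(2)]
  proof (rule cINF_greatest[OF assms(2)])
    fix y assume "y \<in> E"
    then have "dist c y \<ge> r" using assms(1) by force
    then show "r - dist c x \<le> dist x y"
      using dist_triangle[of c y x] by linarith
  qed
  moreover have "x \<notin> E" using assms by auto
  ultimately show ?thesis by (simp add: signed_dist_outside)
qed

lemma signed_dist_interior_ball:
  assumes "ball c r \<subseteq> E" "bounded E" "dist c x < r"
  shows "signed_dist E x \<le> - (r - dist c x)"
proof -
  have "signed_dist (- E) x \<ge> r - dist c x"
    using assms bounded_Compl_nonempty[OF assms(2)] by (intro signed_dist_exterior_ball) auto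
  then show ?thesis by (simp add: signed_dist_def)
qed

lemma ball_outside_signed_dist:
  assumes "closed E" "E \<noteq> {}" "signed_dist E c \<ge> r"
  shows "ball c r \<inter> E = {}"
proof (cases "r > 0")
  case True
  then have "c \<notin> E"
    using assms signed_dist_le_0_iff[of E c] by auto
  then have "infdist c E \<ge> r"
    using assms by (simp add: signed_dist_outside)
  then show ?thesis
    using infdist_le[of _ E c] by (force simp: dist_commute)
qed (simp add: ball_empty)

lemma ball_inside_signed_dist:
  assumes "closed E" "E \<noteq> {}" "signed_dist E c \<le> - r" "r > 0"
  shows "ball c r \<subseteq> E"
proof -
  have "c \<in> E"
    using assms signed_dist_le_0_iff[of E c] by auto
  then have "infdist c (- E) \<ge> r"
    using assms by (simp add: signed_dist_inside)
  then show ?thesis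
    using infdist_le[of _ "- E" c] by (force simp: dist_commute)
qed

text \<open>The segment from \<open>x\<close> to a nearest point on the other side of the boundary crosses the boundary.\<close>

lemma frontier_near_signed_dist:
  fixes E :: "'a::euclidean_space set"
  assumes "closed E" "E \<noteq> {}" "bounded E"
  shows "\<exists>y\<in>frontier E. dist x y \<le> \<bar>signed_dist E x\<bar>"
proof -
  have crossing: "\<exists>y\<in>frontier E. dist x y \<le> dist x z" if "x \<in> E \<longleftrightarrow> z \<notin> E" for z
  proof -
    have "closed_segment x z \<inter> frontier E \<noteq> {}"
      using that by (intro connected_Int_frontier) auto
    then obtain y where "y \<in> closed_segment x z" "y \<in> frontier E" by auto
    then show ?thesis
      using dist_in_closed_segment[of y x z] by (auto simp: dist_commute)
  qed
  show ?thesis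
  proof (cases "x \<in> E")
    case True
    have "closure (- E) \<noteq> {}"
      using bounded_Compl_nonempty[OF assms(3)] by auto
    then obtain z where z: "z \<in> closure (- E)" "infdist x (closure (- E)) = dist x z"
      by (metis infdist_attains_inf closed_closure)
    then have d: "dist x z = \<bar>signed_dist E x\<bar>"
      using True by (simp add: signed_dist_inside infdist_eq_setdist setdist_pos_le)
    show ?thesis
    proof (cases "z \<in> E")
      case z_in: True
      then have "z \<in> frontier E"
        using z assms by (simp add: frontier_closures)
      then show ?thesis using d by (intro bexI[of _ z]) auto
    next
      case False
      with True crossing[of z] d show ?thesis by simp
    qed
  next
    case False
    obtain z where z: "z \<in> E" "infdist x E = dist x z"
      by (metis infdist_attains_inf assms(1,2))
    with False crossing[of z] show ?thesis
      by (simp add: signed_dist_outside infdist_nonneg)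
  qed
qed

section \<open>Hausdorff measure of boundaries\<close>

abbreviation cover_content :: "nat \<Rightarrow> (nat \<Rightarrow> 'a::metric_space set) \<Rightarrow> ennreal" where
  "cover_content k U \<equiv>
     \<Sum>i. if U i = {} then 0 else ennreal (unit_ball_vol (real k) * (diameter (U i) / 2) ^ k)"

text \<open>A cover of \<open>B\<close> is pulled back along \<open>X\<close>; expansion of distances bounds the new diameters.\<close>

lemma hausdorff_premeasure_expanding:
  fixes A :: "'a::euclidean_space set" and B :: "'b::euclidean_space set"
  assumes X: "\<And>a. a \<in> A \<Longrightarrow> X a \<in> B"
    and exp: "\<And>a b. a \<in> A \<Longrightarrow> b \<in> A \<Longrightarrow> dist a b \<le> L * dist (X a) (X b)"
    and L: "L > 0"
  shows "hausdorff_premeasure k \<delta> A \<le> ennreal (L ^ k) * hausdorff_premeasure k (\<delta> / L) B"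
proof -

  let ?CB = "{U :: nat \<Rightarrow> 'b set. B \<subseteq> (\<Union>i. U i) \<and> (\<forall>i. bounded (U i) \<and> diameter (U i) \<le> \<delta> / L)}"
  let ?CA = "{U :: nat \<Rightarrow> 'a set. A \<subseteq> (\<Union>i. U i) \<and> (\<forall>i. bounded (U i) \<and> diameter (U i) \<le> \<delta>)}"
  let ?c = "ennreal (L ^ k)"
  have c: "?c \<noteq> 0" "?c \<noteq> top" using L by auto
  have main: "hausdorff_premeasure k \<delta> A \<le> ?c * cover_content k U" if U: "U \<in> ?CB" for U
  proof -
    define V where "V i = {a \<in> A. X a \<in> U i}" for i
    have V_dist: "dist a b \<le> L * diameter (U i)" if "a \<in> V i" "b \<in> V i" for a b i
    proof -
      have "dist (X a) (X b) \<le> diameter (U i)"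
        using that U by (intro diameter_bounded_bound) (auto simp: V_def)
      then have "L * dist (X a) (X b) \<le> L * diameter (U i)" using L by (intro mult_left_mono) auto
      then show ?thesis using exp[of a b] that by (auto simp: V_def)
    qed
    have V_bdd: "bounded (V i)" for i
      unfolding bounded_two_points using V_dist by blast
    have U_diam: "0 \<le> diameter (U i)" for i
      using U by (intro diameter_ge_0) auto
    have V_diam: "diameter (V i) \<le> L * diameter (U i)" for i
      using V_dist U_diam[of i] L by (intro diameter_le) (auto simp: dist_norm)
    have V_diam0: "0 \<le> diameter (V i)" for i
      using V_bdd by (rule diameter_ge_0)
    have "L * diameter (U i) \<le> \<delta>" for i
      using U L by (auto simp: field_simps)
    then have "diameter (V i) \<le> \<delta>" for i
      using order_trans[OF V_diam] by blast
    moreover have "A \<subseteq> (\<Union>i. V i)"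
    proof
      fix a assume "a \<in> A"
      with X U have "X a \<in> (\<Union>i. U i)" by blast
      with \<open>a \<in> A\<close> show "a \<in> (\<Union>i. V i)" by (auto simp: V_def)
    qed
    ultimately have "V \<in> ?CA"
      using V_bdd by simp
    then have "hausdorff_premeasure k \<delta> A \<le> cover_content k V"
      unfolding hausdorff_premeasure_def by (rule INF_lower)
    also have "\<dots> \<le> (\<Sum>i. ?c * (if U i = {} then 0
            else ennreal (unit_ball_vol (real k) * (diameter (U i) / 2) ^ k)))"
    proof (intro suminf_le summableI)
      fix i
      have "unit_ball_vol (real k) * (diameter (V i) / 2) ^ k
          \<le> unit_ball_vol (real k) * (L * diameter (U i) / 2) ^ k"
        using V_diam[of i] V_diam0[of i] by (intro mult_left_mono power_mono) auto
      also have "\<dots> = L ^ k * (unit_ball_vol (real k) * (diameter (U i) / 2) ^ k)"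
        by (simp add: power_mult_distrib power_divide)
      finally have "ennreal (unit_ball_vol (real k) * (diameter (V i) / 2) ^ k)
          \<le> ?c * ennreal (unit_ball_vol (real k) * (diameter (U i) / 2) ^ k)"
        using L U_diam[of i] by (subst ennreal_mult[symmetric]) (auto intro: ennreal_leI)
      moreover have "V i = {}" if "U i = {}" using that by (auto simp: V_def)
      ultimately show "(if V i = {} then 0 else ennreal (unit_ball_vol (real k) * (diameter (V i) / 2) ^ k))
          \<le> ?c * (if U i = {} then 0 else ennreal (unit_ball_vol (real k) * (diameter (U i) / 2) ^ k))"
        by auto
    qed
    also have "\<dots> = ?c * cover_content k U"
      by (rule ennreal_suminf_cmult)
    finally show ?thesis .
  qed
  have "hausdorff_premeasure k \<delta> A / ?c \<le> hausdorff_premeasure k (\<delta> / L) B"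
    unfolding hausdorff_premeasure_def[of k "\<delta> / L" B]
  proof (rule INF_greatest)
    fix U assume "U \<in> ?CB"
    then show "hausdorff_premeasure k \<delta> A / ?c \<le> cover_content k U"
      using main[of U] c by (simp add: divide_le_posI_ennreal L mult.commute zero_less_iff_neq_zero)
  qed
  then have "?c * (hausdorff_premeasure k \<delta> A / ?c) \<le> ?c * hausdorff_premeasure k (\<delta> / L) B"
    by (intro mult_left_mono) auto
  moreover have "?c * (hausdorff_premeasure k \<delta> A / ?c) = hausdorff_premeasure k \<delta> A"
    using c by (simp add: ennreal_times_divide ennreal_mult_divide_eq mult.commute)
  ultimately show ?thesis by simp
qed

lemma hausdorff_measure_expanding:
  fixes A :: "'a::euclidean_space set" and B :: "'b::euclidean_space set"
  assumes "\<And>a. a \<in> A \<Longrightarrow> X a \<in> B"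
    and "\<And>a b. a \<in> A \<Longrightarrow> b \<in> A \<Longrightarrow> dist a b \<le> L * dist (X a) (X b)"
    and L: "L > 0"
  shows "hausdorff_measure k A \<le> ennreal (L ^ k) * hausdorff_measure k B"
  unfolding hausdorff_measure_def[of k A]
proof (rule SUP_least)
  fix \<delta> :: real assume \<delta>: "\<delta> \<in> {0<..}"
  have "hausdorff_premeasure k \<delta> A \<le> ennreal (L ^ k) * hausdorff_premeasure k (\<delta> / L) B"
    by (rule hausdorff_premeasure_expanding[OF assms])
  also have "\<dots> \<le> ennreal (L ^ k) * hausdorff_measure k B"
    unfolding hausdorff_measure_def using \<delta> L by (intro mult_left_mono SUP_upper) auto
  finally show "hausdorff_premeasure k \<delta> A \<le> ennreal (L ^ k) * hausdorff_measure k B" .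
qed

text \<open>
  Federer's estimate for sets of positive reach: moving along the normals by at most \<open>d\<close> contracts
  distances at most by the factor \<open>(R - d) / R\<close>.
\<close>

lemma normal_displacement_expanding:
  assumes R: "R > 0" and d: "d < R"
    and v: "unit_normal R E a v" "a \<in> frontier E" and w: "unit_normal R E b w" "b \<in> frontier E"
    and st: "\<bar>s\<bar> \<le> d" "\<bar>t\<bar> \<le> d"
  shows "dist a b \<le> R / (R - d) * dist (a + s *\<^sub>R v) (b + t *\<^sub>R w)"
proof (cases "a = b")
  case True
  then show ?thesis using R d by simp
next
  case False
  define N where "N = norm (b - a)"
  have N: "N > 0" using False by (simp add: N_def)
  have d0: "0 \<le> d" using st by linarith
  have 1: "\<bar>v \<bullet> (b - a)\<bar> \<le> N\<^sup>2 / (2 * R)"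
    using unit_normal_quadratic[OF v(1) w(2) R] by (simp add: N_def)
  have 2: "\<bar>w \<bullet> (b - a)\<bar> \<le> N\<^sup>2 / (2 * R)"
  proof -
    have "\<bar>w \<bullet> (a - b)\<bar> \<le> (norm (a - b))\<^sup>2 / (2 * R)"
      by (rule unit_normal_quadratic[OF w(1) v(2) R])
    moreover have "w \<bullet> (a - b) = - (w \<bullet> (b - a))" by (simp add: inner_diff_right)
    ultimately show ?thesis by (simp add: N_def norm_minus_commute)
  qed
  have "\<bar>s\<bar> * \<bar>v \<bullet> (b - a)\<bar> \<le> d * (N\<^sup>2 / (2 * R))" "\<bar>t\<bar> * \<bar>w \<bullet> (b - a)\<bar> \<le> d * (N\<^sup>2 / (2 * R))"
    by (rule mult_mono[OF st(1) 1 d0 abs_ge_zero], rule mult_mono[OF st(2) 2 d0 abs_ge_zero])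
  then have 3: "s * (v \<bullet> (b - a)) \<le> d * (N\<^sup>2 / (2 * R))" "- (t * (w \<bullet> (b - a))) \<le> d * (N\<^sup>2 / (2 * R))"
    by (auto simp: abs_mult[symmetric] abs_le_iff)
  have "(b + t *\<^sub>R w - (a + s *\<^sub>R v)) \<bullet> (b - a)
      = (b - a) \<bullet> (b - a) + t * (w \<bullet> (b - a)) - s * (v \<bullet> (b - a))"
    by (simp add: inner_simps algebra_simps)
  also have "(b - a) \<bullet> (b - a) = N\<^sup>2" by (simp add: N_def power2_norm_eq_inner)
  finally have "(b + t *\<^sub>R w - (a + s *\<^sub>R v)) \<bullet> (b - a) \<ge> N\<^sup>2 - 2 * (d * (N\<^sup>2 / (2 * R)))"
    using 3 by linarith
  also have "2 * (d * (N\<^sup>2 / (2 * R))) = N\<^sup>2 * (d / R)" using R by simp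
  also have "(b + t *\<^sub>R w - (a + s *\<^sub>R v)) \<bullet> (b - a) \<le> norm (b + t *\<^sub>R w - (a + s *\<^sub>R v)) * N"
    unfolding N_def by (rule norm_cauchy_schwarz)
  finally have "N * (N * (1 - d / R)) \<le> N * norm (b + t *\<^sub>R w - (a + s *\<^sub>R v))"
    by (simp add: power2_eq_square algebra_simps)
  then have "N * (1 - d / R) \<le> norm (b + t *\<^sub>R w - (a + s *\<^sub>R v))"
    using N by simp
  moreover have "1 - d / R = (R - d) / R" using R by (simp add: field_simps)
  ultimately show ?thesis
    using R d by (simp add: N_def dist_norm norm_minus_commute field_simps)
qed

text \<open>
  If \<open>\<tau>\<close> changes sign along every normal segment of half-length \<open>d\<close> of the boundary of \<open>G\<close>, then
  a zero of \<open>\<tau>\<close> can be chosen on each of these segments, and this choice hardly contracts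
  distances.
\<close>

lemma hausdorff_measure_frontier_le:
  fixes G :: "'a::euclidean_space set" and \<tau> :: "'a \<Rightarrow> real"
  assumes R: "R > 0" and d: "0 < d" "d < R"
    and G: "G \<in> ball_class R"
    and \<tau>: "continuous_on UNIV \<tau>" "\<And>x. \<tau> x = 0 \<Longrightarrow> x \<in> Z"
    and sign: "\<And>b v. b \<in> frontier G \<Longrightarrow> unit_normal R G b v \<Longrightarrow>
        \<tau> (b - d *\<^sub>R v) < 0 \<and> \<tau> (b + d *\<^sub>R v) > 0"
  shows "hausdorff_measure k (frontier G) \<le> ennreal ((R / (R - d)) ^ k) * hausdorff_measure k Z"
proof -
  have "\<forall>b\<in>frontier G. \<exists>v. unit_normal R G b v"
    using G ball_class_iff[OF R] by blast
  then obtain v where v: "\<And>b. b \<in> frontier G \<Longrightarrow> unit_normal R G b (v b)"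
    by metis
  have "\<exists>s. \<bar>s\<bar> \<le> d \<and> \<tau> (b + s *\<^sub>R v b) = 0" if b: "b \<in> frontier G" for b
  proof -
    have "continuous_on {- d..d} (\<lambda>s. \<tau> (b + s *\<^sub>R v b))"
      by (rule continuous_on_compose2[OF \<tau>(1)]) (auto intro!: continuous_intros)
    moreover have "\<tau> (b + (- d) *\<^sub>R v b) \<le> 0" "0 \<le> \<tau> (b + d *\<^sub>R v b)"
      using sign[OF b v[OF b]] by auto
    ultimately obtain s where "- d \<le> s" "s \<le> d" "\<tau> (b + s *\<^sub>R v b) = 0"
      using IVT'[of "\<lambda>s. \<tau> (b + s *\<^sub>R v b)" "- d" 0 d] d by auto
    then show ?thesis by (intro exI[of _ s]) auto
  qed
  then obtain s where s: "\<And>b. b \<in> frontier G \<Longrightarrow> \<bar>s b\<bar> \<le> d"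
      "\<And>b. b \<in> frontier G \<Longrightarrow> \<tau> (b + s b *\<^sub>R v b) = 0"
    by metis
  show ?thesis
  proof (rule hausdorff_measure_expanding[where X = "\<lambda>b. b + s b *\<^sub>R v b"])
    fix a assume "a \<in> frontier G"
    then show "a + s a *\<^sub>R v a \<in> Z" using s(2) \<tau>(2) by blast
  next
    fix a b assume ab: "a \<in> frontier G" "b \<in> frontier G"
    show "dist a b \<le> R / (R - d) * dist (a + s a *\<^sub>R v a) (b + s b *\<^sub>R v b)"
      by (rule normal_displacement_expanding[OF R d(2) v[OF ab(1)] ab(1) v[OF ab(2)] ab(2)
            s(1)[OF ab(1)] s(1)[OF ab(2)]])
  qed (use R d in simp)
qed

section \<open>Boundaries are negligible\<close>

text \<open>
  Near a boundary point the normals are almost constant, so that the orthogonal projection to the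
  tangent plane is injective there with Lipschitz continuous inverse.
\<close>

lemma negligible_frontier_ball_class:
  fixes E :: "'a::euclidean_space set"
  assumes R: "R > 0" and E: "E \<in> ball_class R"
  shows "negligible (frontier E)"
proof (rule locally_negligible_alt[THEN iffD2, rule_format])
  fix p assume p: "p \<in> frontier E"
  have ex: "\<forall>b\<in>frontier E. \<exists>v. unit_normal R E b v"
    using E ball_class_iff[OF R] by blast
  then obtain e where e: "unit_normal R E p e" using p by blast
  then have e1: "norm e = 1" by (simp add: unit_normal_def)
  define A where "A = frontier E \<inter> ball p (R / 4)"
  define P where "P x = x - (x \<bullet> e) *\<^sub>R e" for x
  have key: "norm (b - a) \<le> 2 * norm (P b - P a)" if ab: "a \<in> A" "b \<in> A" for a b
  proof -
    obtain v where v: "unit_normal R E a v" using ex ab by (auto simp: A_def)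
    have d: "norm (a - p) < R / 4" "norm (b - p) < R / 4"
      using ab by (auto simp: A_def dist_norm norm_minus_commute)
    have "norm (b - a) \<le> norm (b - p) + norm (a - p)"
      using norm_triangle_ineq4[of "b - p" "a - p"] by simp
    then have n: "norm (b - a) \<le> R / 2" using d by simp
    have "\<bar>v \<bullet> (b - a)\<bar> \<le> (norm (b - a))\<^sup>2 / (2 * R)"
      using unit_normal_quadratic[OF v _ R] ab by (auto simp: A_def)
    also have "\<dots> \<le> norm (b - a) * (R / 2) / (2 * R)"
      unfolding power2_eq_square using n R by (intro divide_right_mono mult_left_mono) auto
    also have "\<dots> = norm (b - a) / 4" using R by simp
    finally have 1: "\<bar>v \<bullet> (b - a)\<bar> \<le> norm (b - a) / 4" .
    have "norm (e - v) \<le> norm (p - a) / R"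
      by (rule unit_normal_lipschitz[OF e v R])
    also have "\<dots> \<le> 1 / 4" using d R by (simp add: norm_minus_commute field_simps)
    finally have 2: "norm (e - v) \<le> 1 / 4" .
    have "\<bar>(e - v) \<bullet> (b - a)\<bar> \<le> norm (e - v) * norm (b - a)" by (rule Cauchy_Schwarz_ineq2)
    also have "\<dots> \<le> 1 / 4 * norm (b - a)" using 2 by (intro mult_right_mono) auto
    finally have 3: "\<bar>(e - v) \<bullet> (b - a)\<bar> \<le> norm (b - a) / 4" by simp
    have "(b - a) \<bullet> e = v \<bullet> (b - a) + (e - v) \<bullet> (b - a)"
      by (simp add: inner_simps inner_commute)
    then have 4: "\<bar>(b - a) \<bullet> e\<bar> \<le> norm (b - a) / 2" using 1 3 by linarith
    have "b - a = (P b - P a) + ((b - a) \<bullet> e) *\<^sub>R e"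
      by (simp add: P_def inner_simps algebra_simps)
    then have "norm (b - a) \<le> norm (P b - P a) + norm (((b - a) \<bullet> e) *\<^sub>R e)"
      by (metis norm_triangle_ineq)
    also have "norm (((b - a) \<bullet> e) *\<^sub>R e) = \<bar>(b - a) \<bullet> e\<bar>" using e1 by simp
    finally show ?thesis using 4 by simp
  qed
  define g where "g = inv_into A P"
  have inj: "inj_on P A"
  proof (rule inj_onI)
    fix a b assume "a \<in> A" "b \<in> A" "P a = P b"
    then show "a = b" using key[of a b] by simp
  qed
  have "P ` A \<subseteq> {x. e \<bullet> x = 0}"
    using e1 by (auto simp: P_def inner_simps inner_commute norm_eq_1)
  moreover have "e \<noteq> 0" using e1 by auto
  ultimately have "negligible (P ` A)"
    using negligible_hyperplane[of e 0] negligible_subset by blast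
  then have "negligible (g ` (P ` A))"
  proof (rule negligible_locally_Lipschitz_image[rotated])
    fix x assume "x \<in> P ` A"
    have "norm (g y - g x) \<le> 2 * norm (y - x)" if "y \<in> P ` A" for y
      using that \<open>x \<in> P ` A\<close> key inj by (auto simp: g_def)
    then show "\<exists>T B. open T \<and> x \<in> T \<and> (\<forall>y\<in>P ` A \<inter> T. norm (g y - g x) \<le> B * norm (y - x))"
      by (intro exI[of _ UNIV] exI[of _ 2]) auto
  qed simp
  moreover have "g ` (P ` A) = A"
    using inj by (auto simp: g_def image_image)
  ultimately have "negligible A" by simp
  then show "\<exists>U. openin (top_of_set (frontier E)) U \<and> p \<in> U \<and> negligible U"
    using p R by (intro exI[of _ A]) (auto simp: A_def)
qed

section \<open>Limits of sequences of sets\<close>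

text \<open>
  Pointwise convergence is first arranged on a countable dense set, after division by the
  pointwise bounds to make them uniform; equicontinuity extends it to all points.
\<close>

lemma lipschitz_pointwise_convergent_subsequence:
  fixes s :: "nat \<Rightarrow> 'a::euclidean_space \<Rightarrow> real"
  assumes lip: "\<And>h x y. \<bar>s h x - s h y\<bar> \<le> L * dist x y"
    and bd: "\<And>h x. \<bar>s h x\<bar> \<le> B x"
  obtains r \<sigma> where "strict_mono (r :: nat \<Rightarrow> nat)" "\<And>x. (\<lambda>h. s (r h) x) \<longlonglongrightarrow> \<sigma> x"
proof -
  obtain D :: "'a set" where D: "countable D" "\<And>X. open X \<Longrightarrow> X \<noteq> {} \<Longrightarrow> \<exists>d\<in>D. d \<in> X"
    using countable_dense_setE by metis
  define f where "f h x = s h x / (1 + \<bar>B x\<bar>)" for h x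
  have f_bd: "norm (f h x) \<le> 1" for h x
  proof -
    have "\<bar>s h x\<bar> \<le> 1 + \<bar>B x\<bar>" "1 + \<bar>B x\<bar> > 0" using bd[of h x] by linarith+
    then show ?thesis by (simp only: f_def real_norm_def abs_divide abs_of_pos divide_le_eq_1_pos)
  qed
  obtain r where r: "strict_mono (r :: nat \<Rightarrow> nat)" "\<And>x. x \<in> D \<Longrightarrow> \<exists>l. (\<lambda>n. f (r n) x) \<longlonglongrightarrow> l"
    by (rule function_convergent_subsequence[OF D(1), of f 1]) (use f_bd in auto)
  have conv_D: "Cauchy (\<lambda>n. s (r n) x)" if x: "x \<in> D" for x
  proof -
    obtain l where "(\<lambda>n. f (r n) x) \<longlonglongrightarrow> l" using r(2)[OF x] by blast
    then have "(\<lambda>n. f (r n) x * (1 + \<bar>B x\<bar>)) \<longlonglongrightarrow> l * (1 + \<bar>B x\<bar>)"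
      by (intro tendsto_intros)
    moreover have "f h x * (1 + \<bar>B x\<bar>) = s h x" for h
    proof -
      have "1 + \<bar>B x\<bar> \<noteq> 0" using abs_ge_zero[of "B x"] by linarith
      then show ?thesis by (simp add: f_def)
    qed
    ultimately show ?thesis by (auto intro: LIMSEQ_imp_Cauchy)
  qed
  have "convergent (\<lambda>n. s (r n) x)" for x
  proof -
    have "Cauchy (\<lambda>n. s (r n) x)"
    proof (rule CauchyI)
      fix e :: real assume e: "e > 0"
      define \<delta> where "\<delta> = e / (3 * (\<bar>L\<bar> + 1))"
      have pos: "\<bar>L\<bar> + 1 > 0" by simp
      have \<delta>: "\<delta> > 0" using e pos by (simp add: \<delta>_def)
      then obtain y where y: "y \<in> D" "dist x y < \<delta>"
        using D(2)[of "ball x \<delta>"] by auto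
      obtain N where N: "\<And>m n. m \<ge> N \<Longrightarrow> n \<ge> N \<Longrightarrow> norm (s (r m) y - s (r n) y) < e / 3"
        using CauchyD[OF conv_D[OF y(1)], of "e / 3"] e by auto
      have "L * dist x y \<le> (\<bar>L\<bar> + 1) * dist x y"
        by (intro mult_right_mono) auto
      also have "\<dots> \<le> (\<bar>L\<bar> + 1) * \<delta>" using y(2) pos by (intro mult_left_mono) auto
      also have "\<dots> = e / 3" using pos by (simp add: \<delta>_def field_simps)
      finally have close: "\<bar>s h x - s h y\<bar> \<le> e / 3" for h
        using lip[of h x y] by linarith
      have "norm (s (r m) x - s (r n) x) < e" if "m \<ge> N" "n \<ge> N" for m n
        using close[of "r m"] close[of "r n"] N[OF that] unfolding real_norm_def by linarith
      then show "\<exists>N. \<forall>m\<ge>N. \<forall>n\<ge>N. norm (s (r m) x - s (r n) x) < e" by blast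
    qed
    then show ?thesis by (rule Cauchy_convergent)
  qed
  then have "(\<lambda>n. s (r n) x) \<longlonglongrightarrow> lim (\<lambda>n. s (r n) x)" for x
    by (simp add: convergent_LIMSEQ_iff)
  with r(1) show thesis by (rule that)
qed

lemma lipschitz_limit_diagonal:
  fixes s :: "nat \<Rightarrow> 'a::metric_space \<Rightarrow> real"
  assumes lip: "\<And>h x y. \<bar>s h x - s h y\<bar> \<le> L * dist x y"
    and lim: "\<And>x. (\<lambda>h. s h x) \<longlonglongrightarrow> \<sigma> x" and x: "x \<longlonglongrightarrow> p" and r: "strict_mono (r :: nat \<Rightarrow> nat)"
  shows "(\<lambda>k. s (r k) (x k)) \<longlonglongrightarrow> \<sigma> p"
proof -
  have "(\<lambda>k. L * dist (x k) p) \<longlonglongrightarrow> L * 0"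
    by (intro tendsto_mult tendsto_const tendsto_dist_iff[THEN iffD1, OF x])
  then have bound: "(\<lambda>k. L * dist (x k) p) \<longlonglongrightarrow> 0" by simp
  have "(\<lambda>k. s (r k) (x k) - s (r k) p) \<longlonglongrightarrow> 0"
    by (rule Lim_null_comparison[OF always_eventually bound]) (simp add: lip)
  moreover have "(\<lambda>k. s (r k) p) \<longlonglongrightarrow> \<sigma> p"
    using LIMSEQ_subseq_LIMSEQ[OF lim r] by (simp add: o_def)
  ultimately show ?thesis
    using tendsto_add[of "\<lambda>k. s (r k) (x k) - s (r k) p" 0 sequentially "\<lambda>k. s (r k) p" "\<sigma> p"] by simp
qed

lemma lipschitz_limit_lipschitz:
  fixes s :: "nat \<Rightarrow> 'a::metric_space \<Rightarrow> real"
  assumes lip: "\<And>h x y. \<bar>s h x - s h y\<bar> \<le> L * dist x y"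
    and lim: "\<And>x. (\<lambda>h. s h x) \<longlonglongrightarrow> \<sigma> x"
  shows "\<bar>\<sigma> x - \<sigma> y\<bar> \<le> L * dist x y"
proof (rule LIMSEQ_le_const2)
  show "(\<lambda>h. \<bar>s h x - s h y\<bar>) \<longlonglongrightarrow> \<bar>\<sigma> x - \<sigma> y\<bar>"
    by (intro tendsto_intros lim)
qed (use lip in blast)

lemma lipschitz_limit_uniform:
  fixes s :: "nat \<Rightarrow> 'a::metric_space \<Rightarrow> real"
  assumes lip: "\<And>h x y. \<bar>s h x - s h y\<bar> \<le> L * dist x y"
    and lim: "\<And>x. (\<lambda>h. s h x) \<longlonglongrightarrow> \<sigma> x" and K: "compact K" and e: "e > 0"
  shows "\<forall>\<^sub>F h in sequentially. \<forall>x\<in>K. \<bar>s h x - \<sigma> x\<bar> < e"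
proof -
  define \<delta> where "\<delta> = e / (3 * (\<bar>L\<bar> + 1))"
  have pos: "\<bar>L\<bar> + 1 > 0" by simp
  have \<delta>: "\<delta> > 0" using e pos by (simp add: \<delta>_def)
  obtain F where F: "finite F" "F \<subseteq> K" "K \<subseteq> (\<Union>y\<in>F. ball y \<delta>)"
    using compactE_image[OF K, of K "\<lambda>y. ball y \<delta>"] \<delta> by force
  have "\<forall>\<^sub>F h in sequentially. \<forall>y\<in>F. \<bar>s h y - \<sigma> y\<bar> < e / 3"
  proof (rule eventually_ball_finite[OF F(1)], rule ballI)
    fix y show "\<forall>\<^sub>F h in sequentially. \<bar>s h y - \<sigma> y\<bar> < e / 3"
      using tendstoD[OF lim[of y], of "e / 3"] e by (simp add: dist_real_def)
  qed
  then show ?thesis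
  proof eventually_elim
    case (elim h)
    show ?case
    proof
      fix x assume "x \<in> K"
      then obtain y where y: "y \<in> F" "dist x y < \<delta>"
        using F(3) by (auto simp: dist_commute)
      have "L * dist x y \<le> (\<bar>L\<bar> + 1) * dist x y"
        by (intro mult_right_mono) auto
      also have "\<dots> < (\<bar>L\<bar> + 1) * \<delta>" using y(2) pos by (intro mult_strict_left_mono) auto
      also have "\<dots> = e / 3" using pos by (simp add: \<delta>_def field_simps)
      finally have small: "L * dist x y < e / 3" .
      have "\<bar>s h y - \<sigma> y\<bar> < e / 3" using elim y(1) by blast
      then show "\<bar>s h x - \<sigma> x\<bar> < e"
        using small lip[of h x y] lipschitz_limit_lipschitz[OF lip lim, of x y] by linarith
    qed
  qed
qed

text \<open>
  The limit of a sequence of sets is read off from the pointwise limit \<open>\<sigma>\<close> of their signed distance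
  functions. All properties of the limit set come from the stability of this limit under
  convergent sequences of points and unit normals.
\<close>

locale signed_dist_limit =
  fixes R :: real and F :: "nat \<Rightarrow> 'a::euclidean_space set" and c :: 'a and M :: real
    and \<sigma> :: "'a \<Rightarrow> real"
  assumes R: "R > 0"
    and F_class: "\<And>h. F h \<in> ball_class R"
    and F_ne: "\<And>h. F h \<noteq> {}"
    and F_bd: "\<And>h. F h \<subseteq> ball c M"
    and lim: "\<And>x. (\<lambda>h. signed_dist (F h) x) \<longlonglongrightarrow> \<sigma> x"
begin

definition "limit_set = {x. \<sigma> x \<le> 0}"

lemma F_closed: "closed (F h)" and F_bounded: "bounded (F h)"
  and F_normal: "p \<in> frontier (F h) \<Longrightarrow> \<exists>v. unit_normal R (F h) p v"
  using F_class[of h] ball_class_iff[OF R] by auto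

lemma le_0_iff: "signed_dist (F h) x \<le> 0 \<longleftrightarrow> x \<in> F h"
  by (rule signed_dist_le_0_iff[OF F_closed F_ne])

lemma eq_0_iff: "signed_dist (F h) x = 0 \<longleftrightarrow> x \<in> frontier (F h)"
  by (rule signed_dist_eq_0_iff[OF F_closed F_ne F_bounded])

lemmas diagonal = lipschitz_limit_diagonal[OF signed_dist_lipschitz lim]

lemma \<sigma>_lipschitz: "\<bar>\<sigma> x - \<sigma> y\<bar> \<le> 2 * dist x y"
  by (rule lipschitz_limit_lipschitz[OF signed_dist_lipschitz lim])

lemma \<sigma>_continuous: "continuous_on A \<sigma>"
proof -
  have "2-lipschitz_on A \<sigma>"
    using \<sigma>_lipschitz by (intro lipschitz_onI) (auto simp: dist_real_def)
  then show ?thesis by (rule lipschitz_on_continuous_on)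
qed

lemma limit_set_closed: "closed limit_set"
  unfolding limit_set_def by (intro closed_Collect_le \<sigma>_continuous continuous_on_const)

lemma limit_set_subset: "limit_set \<subseteq> cball c M"
proof
  fix x assume x: "x \<in> limit_set"
  show "x \<in> cball c M"
  proof (rule ccontr)
    assume "x \<notin> cball c M"
    then have d: "dist c x > M" by simp
    have "signed_dist (F h) x \<ge> dist c x - M" for h
    proof -
      have "x \<notin> F h" using F_bd[of h] d by auto
      moreover have "infdist x (F h) \<ge> dist c x - M"
        unfolding infdist_notempty[OF F_ne]
      proof (rule cINF_greatest[OF F_ne])
        fix y assume "y \<in> F h"
        then have "dist c y < M" using F_bd[of h] by auto
        then show "dist c x - M \<le> dist x y"
          using dist_triangle[of c x y] by (simp add: dist_commute)
      qed
      ultimately show ?thesis by (simp add: signed_dist_outside)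
    qed
    then have "\<sigma> x \<ge> dist c x - M"
      by (intro LIMSEQ_le_const[OF lim]) auto
    with d x show False by (simp add: limit_set_def)
  qed
qed

lemma limit_set_bounded: "bounded limit_set"
  using bounded_cball limit_set_subset by (rule bounded_subset)

text \<open>
  At a zero of \<open>\<sigma>\<close> there are nearby boundary points of the approximating sets. Their
  normals subconverge, and the lower and upper bounds which the touching balls impose on the signed
  distances pass to the limit.
\<close>

lemma zero_imp_normal:
  assumes "\<sigma> x = 0"
  obtains v where "norm v = 1"
    "\<And>y. dist (x + R *\<^sub>R v) y < R \<Longrightarrow> \<sigma> y \<ge> R - dist (x + R *\<^sub>R v) y"
    "\<And>y. dist (x - R *\<^sub>R v) y < R \<Longrightarrow> \<sigma> y \<le> - (R - dist (x - R *\<^sub>R v) y)"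
proof -
  have "\<forall>h. \<exists>p\<in>frontier (F h). dist x p \<le> \<bar>signed_dist (F h) x\<bar>"
    using frontier_near_signed_dist[OF F_closed F_ne F_bounded] by blast
  then obtain p where p: "\<And>h. p h \<in> frontier (F h)" "\<And>h. dist x (p h) \<le> \<bar>signed_dist (F h) x\<bar>"
    by metis
  have "(\<lambda>h. \<bar>signed_dist (F h) x\<bar>) \<longlonglongrightarrow> \<bar>\<sigma> x\<bar>"
    by (intro tendsto_rabs lim)
  then have bound: "(\<lambda>h. \<bar>signed_dist (F h) x\<bar>) \<longlonglongrightarrow> 0" using assms by simp
  have "(\<lambda>h. dist (p h) x) \<longlonglongrightarrow> 0"
    by (rule Lim_null_comparison[OF always_eventually bound]) (use p(2) in \<open>simp add: dist_commute\<close>)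
  then have p_lim: "p \<longlonglongrightarrow> x" by (rule tendsto_dist_iff[THEN iffD2])
  obtain v where v: "\<And>h. unit_normal R (F h) (p h) (v h)"
    using F_normal[OF p(1)] by metis
  have "\<forall>h. v h \<in> sphere 0 1" using v by (simp add: unit_normal_def)
  then obtain w r where w: "w \<in> sphere 0 1" "strict_mono (r :: nat \<Rightarrow> nat)" "(v \<circ> r) \<longlonglongrightarrow> w"
    using compact_sphere[of "0::'a" 1] unfolding compact_def by blast
  have pr: "(\<lambda>k. p (r k)) \<longlonglongrightarrow> x"
    using LIMSEQ_subseq_LIMSEQ[OF p_lim w(2)] by (simp add: o_def)
  have vr: "(\<lambda>k. v (r k)) \<longlonglongrightarrow> w" using w(3) by (simp add: o_def)
  have s: "(\<lambda>k. signed_dist (F (r k)) y) \<longlonglongrightarrow> \<sigma> y" for y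
    using LIMSEQ_subseq_LIMSEQ[OF lim w(2)] by (simp add: o_def)
  show thesis
  proof (rule that[of w])
    show "norm w = 1" using w(1) by simp
    fix y assume y: "dist (x + R *\<^sub>R w) y < R"
    have l: "(\<lambda>k. dist (p (r k) + R *\<^sub>R v (r k)) y) \<longlonglongrightarrow> dist (x + R *\<^sub>R w) y"
      by (intro tendsto_intros pr vr)
    have ev: "\<forall>\<^sub>F k in sequentially. R - dist (p (r k) + R *\<^sub>R v (r k)) y \<le> signed_dist (F (r k)) y"
      using order_tendstoD(2)[OF l y]
    proof eventually_elim
      case (elim k)
      then show ?case
        using v[of "r k"] F_ne by (intro signed_dist_exterior_ball) (auto simp: unit_normal_def)
    qed
    show "R - dist (x + R *\<^sub>R w) y \<le> \<sigma> y"
      by (rule tendsto_le[OF sequentially_bot s tendsto_diff[OF tendsto_const l] ev])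
  next
    fix y assume y: "dist (x - R *\<^sub>R w) y < R"
    have l: "(\<lambda>k. dist (p (r k) - R *\<^sub>R v (r k)) y) \<longlonglongrightarrow> dist (x - R *\<^sub>R w) y"
      by (intro tendsto_intros pr vr)
    have ev: "\<forall>\<^sub>F k in sequentially. signed_dist (F (r k)) y \<le> - (R - dist (p (r k) - R *\<^sub>R v (r k)) y)"
      using order_tendstoD(2)[OF l y]
    proof eventually_elim
      case (elim k)
      then show ?case
        using v[of "r k"] F_bounded by (intro signed_dist_interior_ball) (auto simp: unit_normal_def)
    qed
    show "\<sigma> y \<le> - (R - dist (x - R *\<^sub>R w) y)"
      by (rule tendsto_le[OF sequentially_bot tendsto_minus[OF tendsto_diff[OF tendsto_const l]] s ev])
  qed
qed

lemma zero_imp_unit_normal: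
  assumes "\<sigma> x = 0"
  obtains v where "unit_normal R limit_set x v"
    "\<And>y. dist (x + R *\<^sub>R v) y < R \<Longrightarrow> \<sigma> y \<ge> R - dist (x + R *\<^sub>R v) y"
    "\<And>y. dist (x - R *\<^sub>R v) y < R \<Longrightarrow> \<sigma> y \<le> - (R - dist (x - R *\<^sub>R v) y)"
proof -
  obtain v where v: "norm v = 1"
    "\<And>y. dist (x + R *\<^sub>R v) y < R \<Longrightarrow> \<sigma> y \<ge> R - dist (x + R *\<^sub>R v) y"
    "\<And>y. dist (x - R *\<^sub>R v) y < R \<Longrightarrow> \<sigma> y \<le> - (R - dist (x - R *\<^sub>R v) y)"
    by (rule zero_imp_normal[OF assms]) (rule that)
  have "ball (x - R *\<^sub>R v) R \<subseteq> limit_set" "ball (x + R *\<^sub>R v) R \<inter> limit_set = {}"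
    using v(2,3) by (force simp: limit_set_def)+
  with v(1) have "unit_normal R limit_set x v" by (simp add: unit_normal_def)
  then show thesis using v(2,3) by (rule that)
qed

text \<open>
  A zero of \<open>\<sigma>\<close> could be an interior point of \<open>limit_set\<close> for a general sequence of sets; here it
  is a limit of points of its exterior ball.
\<close>

lemma frontier_iff: "x \<in> frontier limit_set \<longleftrightarrow> \<sigma> x = 0"
proof
  assume x: "x \<in> frontier limit_set"
  have "\<sigma> x \<le> 0"
    using x limit_set_closed by (auto simp: frontier_def limit_set_def)
  moreover have "\<not> \<sigma> x < 0"
  proof
    assume "\<sigma> x < 0"
    moreover have "open {x. \<sigma> x < 0}"
      by (intro open_Collect_less \<sigma>_continuous continuous_on_const)
    moreover have "{x. \<sigma> x < 0} \<subseteq> limit_set" by (auto simp: limit_set_def)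
    ultimately have "x \<in> interior limit_set" by (auto simp: interior_def)
    with x show False by (simp add: frontier_def)
  qed
  ultimately show "\<sigma> x = 0" by simp
next
  assume x: "\<sigma> x = 0"
  obtain v where "unit_normal R limit_set x v"
    by (rule zero_imp_unit_normal[OF x]) (rule that)
  then have v: "norm v = 1" "ball (x + R *\<^sub>R v) R \<subseteq> - limit_set"
    by (auto simp: unit_normal_def)
  have "x \<in> closure (ball (x + R *\<^sub>R v) R)"
    using R v(1) by (simp add: dist_norm)
  then have "x \<in> closure (- limit_set)"
    using closure_mono[OF v(2)] by blast
  moreover have "x \<in> limit_set" using x by (simp add: limit_set_def)
  ultimately show "x \<in> frontier limit_set"
    using limit_set_closed by (simp add: frontier_closures)
qed

text \<open>The bounds hold for every normal, not only for the limit normal, by uniqueness.\<close>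

lemma frontier_normal:
  assumes "x \<in> frontier limit_set" "unit_normal R limit_set x v"
  shows "dist (x + R *\<^sub>R v) y < R \<Longrightarrow> \<sigma> y \<ge> R - dist (x + R *\<^sub>R v) y"
    and "dist (x - R *\<^sub>R v) y < R \<Longrightarrow> \<sigma> y \<le> - (R - dist (x - R *\<^sub>R v) y)"
proof -
  have "\<sigma> x = 0" using assms(1) by (simp add: frontier_iff)
  then obtain w where w: "unit_normal R limit_set x w"
    "\<And>y. dist (x + R *\<^sub>R w) y < R \<Longrightarrow> \<sigma> y \<ge> R - dist (x + R *\<^sub>R w) y"
    "\<And>y. dist (x - R *\<^sub>R w) y < R \<Longrightarrow> \<sigma> y \<le> - (R - dist (x - R *\<^sub>R w) y)"
    by (rule zero_imp_unit_normal) (rule that)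
  have "w = v" by (rule unit_normal_unique[OF w(1) assms(2) R])
  with w(2,3) show "dist (x + R *\<^sub>R v) y < R \<Longrightarrow> \<sigma> y \<ge> R - dist (x + R *\<^sub>R v) y"
    and "dist (x - R *\<^sub>R v) y < R \<Longrightarrow> \<sigma> y \<le> - (R - dist (x - R *\<^sub>R v) y)" by auto
qed

lemma limit_set_in_ball_class: "limit_set \<in> ball_class R"
  unfolding ball_class_iff[OF R]
proof (intro conjI ballI limit_set_closed limit_set_bounded)
  fix p assume "p \<in> frontier limit_set"
  then have "\<sigma> p = 0" by (simp add: frontier_iff)
  then show "\<exists>v. unit_normal R limit_set p v"
    by (rule zero_imp_unit_normal) blast
qed

lemma kuratowski_limit: "kuratowski_convergent F limit_set"
  unfolding kuratowski_convergent_def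
proof (intro conjI allI impI ballI)
  fix r q p assume A: "strict_mono (r :: nat \<Rightarrow> nat) \<and> (\<forall>k. q k \<in> F (r k)) \<and> q \<longlonglongrightarrow> p"
  then have "(\<lambda>k. signed_dist (F (r k)) (q k)) \<longlonglongrightarrow> \<sigma> p"
    by (intro diagonal) auto
  then have "\<sigma> p \<le> 0"
    by (rule LIMSEQ_le_const2) (use A le_0_iff in blast)
  then show "p \<in> limit_set" by (simp add: limit_set_def)
next
  fix p assume p: "p \<in> limit_set"
  have "\<exists>q\<in>F h. dist q p \<le> max 0 (signed_dist (F h) p)" for h
  proof (cases "p \<in> F h")
    case True
    then show ?thesis by (intro bexI[of _ p]) auto
  next
    case False
    obtain q where "q \<in> F h" "infdist p (F h) = dist p q"
      by (metis infdist_attains_inf[OF F_closed F_ne])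
    with False show ?thesis
      by (intro bexI[of _ q]) (auto simp: signed_dist_outside dist_commute)
  qed
  then obtain q where q: "\<And>h. q h \<in> F h" "\<And>h. dist (q h) p \<le> max 0 (signed_dist (F h) p)"
    by metis
  have "(\<lambda>h. max 0 (signed_dist (F h) p)) \<longlonglongrightarrow> max 0 (\<sigma> p)"
    by (intro tendsto_intros lim)
  then have bound: "(\<lambda>h. max 0 (signed_dist (F h) p)) \<longlonglongrightarrow> 0"
    using p by (simp add: limit_set_def max_absorb1)
  have "(\<lambda>h. dist (q h) p) \<longlonglongrightarrow> 0"
    by (rule Lim_null_comparison[OF always_eventually bound]) (use q(2) in simp)
  then have "q \<longlonglongrightarrow> p" by (rule tendsto_dist_iff[THEN iffD2])
  with q(1) show "\<exists>q. (\<forall>h. q h \<in> F h) \<and> q \<longlonglongrightarrow> p" by blast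
qed

lemma kuratowski_frontier_limit: "kuratowski_convergent (\<lambda>h. frontier (F h)) (frontier limit_set)"
  unfolding kuratowski_convergent_def
proof (intro conjI allI impI ballI)
  fix r q p assume A: "strict_mono (r :: nat \<Rightarrow> nat) \<and> (\<forall>k. q k \<in> frontier (F (r k))) \<and> q \<longlonglongrightarrow> p"
  then have "(\<lambda>k. signed_dist (F (r k)) (q k)) \<longlonglongrightarrow> \<sigma> p"
    by (intro diagonal) auto
  moreover have "signed_dist (F (r k)) (q k) = 0" for k
    using A by (simp add: eq_0_iff)
  ultimately have "(\<lambda>k::nat. 0) \<longlonglongrightarrow> \<sigma> p" by simp
  then have "\<sigma> p = 0" by (simp add: LIMSEQ_const_iff)
  then show "p \<in> frontier limit_set" by (simp add: frontier_iff)
next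
  fix p assume p: "p \<in> frontier limit_set"
  have "\<forall>h. \<exists>q\<in>frontier (F h). dist p q \<le> \<bar>signed_dist (F h) p\<bar>"
    using frontier_near_signed_dist[OF F_closed F_ne F_bounded] by blast
  then obtain q where q: "\<And>h. q h \<in> frontier (F h)" "\<And>h. dist p (q h) \<le> \<bar>signed_dist (F h) p\<bar>"
    by metis
  have "(\<lambda>h. \<bar>signed_dist (F h) p\<bar>) \<longlonglongrightarrow> \<bar>\<sigma> p\<bar>"
    by (intro tendsto_rabs lim)
  then have bound: "(\<lambda>h. \<bar>signed_dist (F h) p\<bar>) \<longlonglongrightarrow> 0" using p by (simp add: frontier_iff)
  have "(\<lambda>h. dist (q h) p) \<longlonglongrightarrow> 0"
    by (rule Lim_null_comparison[OF always_eventually bound]) (use q(2) in \<open>simp add: dist_commute\<close>)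
  then have "q \<longlonglongrightarrow> p" by (rule tendsto_dist_iff[THEN iffD2])
  with q(1) show "\<exists>q. (\<forall>h. q h \<in> frontier (F h)) \<and> q \<longlonglongrightarrow> p" by blast
qed

text \<open>Off the negligible boundary of the limit set, \<open>\<sigma>\<close> has a sign, which decides membership eventually.\<close>

lemma L1_limit: "L1_set_convergent F limit_set"
proof -
  have F_sets: "F h \<in> sets lebesgue" for h
    using F_closed by auto
  have L_sets: "limit_set \<in> sets lebesgue" using limit_set_closed by auto
  have ind: "integrable lebesgue (indicator A :: 'a \<Rightarrow> real)" if "A \<in> lmeasurable" for A
    by (rule integrable_real_indicator) (use that in \<open>auto simp: fmeasurable_def\<close>)
  have C_int: "integrable lebesgue (indicator (cball c M) :: 'a \<Rightarrow> real)"
    by (rule ind[OF lmeasurable_cball])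
  have F_int: "integrable lebesgue (indicator (F h) :: 'a \<Rightarrow> real)" for h
    by (rule ind[OF bounded_set_imp_lmeasurable[OF F_bounded F_sets]])
  have L_int: "integrable lebesgue (indicator limit_set :: 'a \<Rightarrow> real)"
    by (rule ind[OF bounded_set_imp_lmeasurable[OF limit_set_bounded L_sets]])
  have "(\<lambda>h. \<integral>x. \<bar>indicator (F h) x - indicator limit_set x :: real\<bar> \<partial>lebesgue)
      \<longlonglongrightarrow> (\<integral>x. 0 \<partial>(lebesgue :: 'a measure))"
  proof (rule integral_dominated_convergence[OF _ _ C_int])
    show "(\<lambda>x. \<bar>indicator (F h) x - indicator limit_set x :: real\<bar>) \<in> borel_measurable lebesgue" for h
      using F_int[of h] L_int by auto
    show "AE x in lebesgue. norm \<bar>indicator (F h) x - indicator limit_set x :: real\<bar>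
        \<le> indicator (cball c M) x" for h
    proof -
      have "F h \<subseteq> cball c M" by (rule subset_trans[OF F_bd ball_subset_cball])
      then show ?thesis
        using limit_set_subset by (intro AE_I2) (auto simp: indicator_def)
    qed
    have "frontier limit_set \<in> null_sets lebesgue"
      using negligible_frontier_ball_class[OF R limit_set_in_ball_class]
      by (simp add: negligible_iff_null_sets)
    then have "AE x in lebesgue. x \<notin> frontier limit_set" by (rule AE_not_in)
    then show "AE x in lebesgue. (\<lambda>h. \<bar>indicator (F h) x - indicator limit_set x :: real\<bar>) \<longlonglongrightarrow> 0"
    proof eventually_elim
      case (elim x)
      then have "\<sigma> x \<noteq> 0" by (simp add: frontier_iff)
      then have "\<sigma> x < 0 \<or> \<sigma> x > 0" by linarith
      then have "\<forall>\<^sub>F h in sequentially. 0 = \<bar>indicator (F h) x - indicator limit_set x :: real\<bar>"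
      proof
        assume \<sigma>: "\<sigma> x < 0"
        from order_tendstoD(2)[OF lim \<sigma>] show ?thesis
        proof eventually_elim
          case (elim h)
          then have "x \<in> F h" using le_0_iff[of h x] by simp
          then show ?case using \<sigma> by (simp add: limit_set_def)
        qed
      next
        assume \<sigma>: "\<sigma> x > 0"
        from order_tendstoD(1)[OF lim \<sigma>] show ?thesis
        proof eventually_elim
          case (elim h)
          then have "x \<notin> F h" using le_0_iff[of h x] by simp
          then show ?case using \<sigma> by (simp add: limit_set_def)
        qed
      qed
      then show ?case by (rule Lim_transform_eventually[OF tendsto_const])
    qed
  qed simp
  then show ?thesis
    unfolding L1_set_convergent_def L1_convergent_def using F_int L_int by simp
qed

text \<open>
  Once the signed distances are \<open>d\<close>-close to \<open>\<sigma>\<close>, either of the two boundaries meets all normal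
  segments of half-length \<open>d\<close> of the other one. The two measures then differ at most by the factor
  \<open>(R / (R - d)) ^ k\<close>, which tends to \<open>1\<close>. Multiplicative bounds make sense for infinite measures too.
\<close>

lemma hausdorff_limit:
  "(\<lambda>h. hausdorff_measure k (frontier (F h))) \<longlonglongrightarrow> hausdorff_measure k (frontier limit_set)"
proof -
  define q where "q d = (R / (R - d)) ^ k" for d
  let ?H = "hausdorff_measure k (frontier limit_set)"
  have bounds: "\<forall>\<^sub>F h in sequentially.
      hausdorff_measure k (frontier (F h)) \<le> ennreal (q d) * ?H \<and>
      ?H \<le> ennreal (q d) * hausdorff_measure k (frontier (F h))" if d: "0 < d" "d < R" for d
  proof -
    have "\<forall>\<^sub>F h in sequentially. \<forall>x\<in>cball c (M + R). \<bar>signed_dist (F h) x - \<sigma> x\<bar> < d"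
      by (rule lipschitz_limit_uniform[OF signed_dist_lipschitz lim compact_cball d(1)])
    then show ?thesis
    proof eventually_elim
      case (elim h)
      have near: "b - d *\<^sub>R v \<in> cball c (M + R)" "b + d *\<^sub>R v \<in> cball c (M + R)"
        if "b \<in> cball c M" "norm v = 1" for b v
        using that d dist_triangle[of c "b - d *\<^sub>R v" b] dist_triangle[of c "b + d *\<^sub>R v" b]
        by (auto simp: dist_norm)
      have along: "dist (b + R *\<^sub>R v) (b + d *\<^sub>R v) = R - d" "dist (b - R *\<^sub>R v) (b - d *\<^sub>R v) = R - d"
        if "norm v = 1" for b v :: 'a
      proof -
        have "(b + R *\<^sub>R v) - (b + d *\<^sub>R v) = (R - d) *\<^sub>R v"
          "(b - R *\<^sub>R v) - (b - d *\<^sub>R v) = (d - R) *\<^sub>R v" by (simp_all add: algebra_simps)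
        then show "dist (b + R *\<^sub>R v) (b + d *\<^sub>R v) = R - d" "dist (b - R *\<^sub>R v) (b - d *\<^sub>R v) = R - d"
          using that d by (simp_all add: dist_norm)
      qed
      have F_sub: "frontier (F h) \<subseteq> cball c M"
        using F_bd[of h] frontier_subset_closed[OF F_closed[of h]] by force
      have L_sub: "frontier limit_set \<subseteq> cball c M"
        using limit_set_subset frontier_subset_closed[OF limit_set_closed] by blast
      have "hausdorff_measure k (frontier (F h)) \<le> ennreal (q d) * ?H"
        unfolding q_def
      proof (rule hausdorff_measure_frontier_le[OF R d F_class \<sigma>_continuous])
        show "x \<in> frontier limit_set" if "\<sigma> x = 0" for x using that by (simp add: frontier_iff)
        fix b v assume b: "b \<in> frontier (F h)" and v: "unit_normal R (F h) b v"
        have v1: "norm v = 1" using v by (simp add: unit_normal_def)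
        have "signed_dist (F h) (b + d *\<^sub>R v) \<ge> R - dist (b + R *\<^sub>R v) (b + d *\<^sub>R v)"
          using v F_ne along[OF v1] d
          by (intro signed_dist_exterior_ball) (auto simp: unit_normal_def)
        moreover have "signed_dist (F h) (b - d *\<^sub>R v) \<le> - (R - dist (b - R *\<^sub>R v) (b - d *\<^sub>R v))"
          using v F_bounded along[OF v1] d
          by (intro signed_dist_interior_ball) (auto simp: unit_normal_def)
        moreover have "\<bar>signed_dist (F h) (b + d *\<^sub>R v) - \<sigma> (b + d *\<^sub>R v)\<bar> < d"
          "\<bar>signed_dist (F h) (b - d *\<^sub>R v) - \<sigma> (b - d *\<^sub>R v)\<bar> < d"
          using elim near[OF _ v1, of b] b F_sub by auto
        ultimately show "\<sigma> (b - d *\<^sub>R v) < 0 \<and> 0 < \<sigma> (b + d *\<^sub>R v)"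
          unfolding along[OF v1] by linarith
      qed
      moreover have "?H \<le> ennreal (q d) * hausdorff_measure k (frontier (F h))"
        unfolding q_def
      proof (rule hausdorff_measure_frontier_le[OF R d limit_set_in_ball_class continuous_on_signed_dist])
        show "x \<in> frontier (F h)" if "signed_dist (F h) x = 0" for x using that by (simp add: eq_0_iff)
        fix b v assume b: "b \<in> frontier limit_set" and v: "unit_normal R limit_set b v"
        have v1: "norm v = 1" using v by (simp add: unit_normal_def)
        have "\<sigma> (b + d *\<^sub>R v) \<ge> R - dist (b + R *\<^sub>R v) (b + d *\<^sub>R v)"
          using along[OF v1] d by (intro frontier_normal(1)[OF b v]) simp
        moreover have "\<sigma> (b - d *\<^sub>R v) \<le> - (R - dist (b - R *\<^sub>R v) (b - d *\<^sub>R v))"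
          using along[OF v1] d by (intro frontier_normal(2)[OF b v]) simp
        moreover have "\<bar>signed_dist (F h) (b + d *\<^sub>R v) - \<sigma> (b + d *\<^sub>R v)\<bar> < d"
          "\<bar>signed_dist (F h) (b - d *\<^sub>R v) - \<sigma> (b - d *\<^sub>R v)\<bar> < d"
          using elim near[OF _ v1, of b] b L_sub by auto
        ultimately show "signed_dist (F h) (b - d *\<^sub>R v) < 0 \<and> 0 < signed_dist (F h) (b + d *\<^sub>R v)"
          unfolding along[OF v1] by linarith
      qed
      ultimately show ?case by simp
    qed
  qed
  have q_pos: "q d > 0" if "d < R" for d
    using that R by (simp add: q_def)
  have q_lim: "(q \<longlongrightarrow> 1) (at_right 0)"
  proof -
    have "((\<lambda>d. (R / (R - d)) ^ k) \<longlongrightarrow> (R / (R - 0)) ^ k) (at_right 0)"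
      using R by (intro tendsto_intros) auto
    then show ?thesis using R by (simp add: q_def[abs_def])
  qed
  have small: "\<forall>\<^sub>F d in at_right 0. 0 < d \<and> d < R"
    using R by (auto simp: eventually_at_right_field intro!: exI[of _ R])
  have up: "((\<lambda>d. ennreal (q d) * ?H) \<longlongrightarrow> ?H) (at_right 0)"
  proof -
    have "((\<lambda>d. ennreal (q d) * ?H) \<longlongrightarrow> ennreal 1 * ?H) (at_right 0)"
      by (intro tendsto_mult_ennreal tendsto_ennrealI q_lim tendsto_const) auto
    then show ?thesis by simp
  qed
  have down: "((\<lambda>d. ennreal (inverse (q d)) * ?H) \<longlongrightarrow> ?H) (at_right 0)"
  proof -
    have "((\<lambda>d. ennreal (inverse (q d)) * ?H) \<longlongrightarrow> ennreal (inverse 1) * ?H) (at_right 0)"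
      by (intro tendsto_mult_ennreal tendsto_ennrealI tendsto_inverse q_lim tendsto_const) auto
    then show ?thesis by simp
  qed
  show ?thesis
  proof (rule order_tendstoI)
    fix a assume "a < ?H"
    then have "\<forall>\<^sub>F d in at_right 0. a < ennreal (inverse (q d)) * ?H"
      using order_tendstoD(1)[OF down] by blast
    with small have ev: "\<forall>\<^sub>F d in at_right 0. 0 < d \<and> d < R \<and> a < ennreal (inverse (q d)) * ?H"
      by eventually_elim simp
    have "\<exists>d. 0 < d \<and> d < R \<and> a < ennreal (inverse (q d)) * ?H"
      by (rule eventually_happens'[OF _ ev]) simp
    then obtain d where d: "0 < d" "d < R" "a < ennreal (inverse (q d)) * ?H" by auto
    from bounds[OF d(1,2)] show "\<forall>\<^sub>F h in sequentially. a < hausdorff_measure k (frontier (F h))"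
    proof eventually_elim
      case (elim h)
      then have "ennreal (inverse (q d)) * ?H
          \<le> ennreal (inverse (q d)) * (ennreal (q d) * hausdorff_measure k (frontier (F h)))"
        by (intro mult_left_mono) auto
      also have "\<dots> = hausdorff_measure k (frontier (F h))"
        using q_pos[OF d(2)] by (simp add: mult.assoc[symmetric] ennreal_mult[symmetric])
      finally show ?case using d(3) by simp
    qed
  next
    fix a assume "?H < a"
    then have "\<forall>\<^sub>F d in at_right 0. ennreal (q d) * ?H < a"
      using order_tendstoD(2)[OF up] by blast
    with small have ev: "\<forall>\<^sub>F d in at_right 0. 0 < d \<and> d < R \<and> ennreal (q d) * ?H < a"
      by eventually_elim simp
    have "\<exists>d. 0 < d \<and> d < R \<and> ennreal (q d) * ?H < a"
      by (rule eventually_happens'[OF _ ev]) simp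
    then obtain d where d: "0 < d" "d < R" "ennreal (q d) * ?H < a" by auto
    from bounds[OF d(1,2)] show "\<forall>\<^sub>F h in sequentially. hausdorff_measure k (frontier (F h)) < a"
    proof eventually_elim
      case (elim h)
      show ?case by (rule le_less_trans[OF conjunct1[OF elim] d(3)])
    qed
  qed
qed

end

section \<open>Construction of test functions\<close>

text \<open>
  The powers in front of \<open>exp (- 1 / t)\<close> are there because its derivatives are combinations of such
  terms.
\<close>

definition flat_exp :: "nat \<Rightarrow> real \<Rightarrow> real" where
  "flat_exp n t = (if t \<le> 0 then 0 else (1 / t) ^ n * exp (- (1 / t)))"

lemma flat_exp_tendsto_0: "(flat_exp n \<longlongrightarrow> 0) (at_right 0)"
proof -
  have lim: "((\<lambda>t::real. inverse t ^ n / exp (inverse t)) \<longlongrightarrow> 0) (at_right 0)"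
    by (rule filterlim_compose[OF tendsto_power_div_exp_0 filterlim_inverse_at_top_right])
  have ev: "\<forall>\<^sub>F t in at_right 0. inverse t ^ n / exp (inverse t) = flat_exp n t"
    by (auto simp: eventually_at_filter flat_exp_def exp_minus divide_inverse)
  show ?thesis
    by (rule Lim_transform_eventually[OF lim ev])
qed

lemma flat_exp_has_real_derivative:
  "(flat_exp n has_real_derivative flat_exp (n + 2) t - real n * flat_exp (n + 1) t) (at t)"
proof -
  consider "t < 0" | "t > 0" | "t = 0" by linarith
  then show ?thesis
  proof cases
    case 1
    have "((\<lambda>_. 0 :: real) has_real_derivative 0) (at t)" by simp
    then have "(flat_exp n has_real_derivative 0) (at t)"
      by (rule has_field_derivative_transform_within_open[where S = "{..<0}"])
        (use 1 in \<open>auto simp: flat_exp_def\<close>)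
    then show ?thesis using 1 by (simp add: flat_exp_def)
  next
    case 2
    have d: "((\<lambda>t. (1 / t) ^ n * exp (- (1 / t))) has_real_derivative
        real n * (1 / t) ^ (n - 1) * (- 1 / t\<^sup>2) * exp (- (1 / t)) +
        (1 / t) ^ n * (exp (- (1 / t)) * (1 / t\<^sup>2))) (at t)"
    proof -
      have r: "((\<lambda>t. 1 / t) has_real_derivative - 1 / t\<^sup>2) (at t)"
        using DERIV_inverse'[OF DERIV_ident, of t] 2
        by (simp add: inverse_eq_divide power2_eq_square)
      have e: "((\<lambda>t. exp (- (1 / t))) has_real_derivative exp (- (1 / t)) * (1 / t\<^sup>2)) (at t)"
        using DERIV_fun_exp[OF DERIV_minus[OF r]] by simp
      show ?thesis
        using DERIV_mult[OF DERIV_power[OF r, of n] e] by (simp add: algebra_simps)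
    qed
    have "real n * (1 / t) ^ (n - 1) * (- 1 / t\<^sup>2) = - (real n * (1 / t) ^ (n + 1))"
    proof (cases n)
      case (Suc m)
      have "(1 / t) ^ (n + 1) = (1 / t) ^ m * (1 / t)\<^sup>2"
        unfolding Suc by (simp add: power2_eq_square)
      then show ?thesis by (simp add: Suc power_divide power2_eq_square)
    qed simp
    moreover have "(1 / t) ^ n * (exp (- (1 / t)) * (1 / t\<^sup>2)) = (1 / t) ^ (n + 2) * exp (- (1 / t))"
      by (simp add: power_add power2_eq_square)
    ultimately have "real n * (1 / t) ^ (n - 1) * (- 1 / t\<^sup>2) * exp (- (1 / t)) +
        (1 / t) ^ n * (exp (- (1 / t)) * (1 / t\<^sup>2)) =
        flat_exp (n + 2) t - real n * flat_exp (n + 1) t"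
      using 2 by (simp only: flat_exp_def not_le[symmetric] if_False) simp
    with d have "((\<lambda>t. (1 / t) ^ n * exp (- (1 / t))) has_real_derivative
        flat_exp (n + 2) t - real n * flat_exp (n + 1) t) (at t)"
      by (simp only:)
    then show ?thesis
      by (rule has_field_derivative_transform_within_open[where S = "{0<..}"])
        (use 2 in \<open>auto simp: flat_exp_def\<close>)
  next
    case 3
    have r: "((\<lambda>h. (flat_exp n (0 + h) - flat_exp n 0) / h) \<longlongrightarrow> 0) (at_right 0)"
      by (rule Lim_transform_eventually[OF flat_exp_tendsto_0[of "n + 1"]])
        (auto simp: eventually_at_filter flat_exp_def)
    have l: "((\<lambda>h. (flat_exp n (0 + h) - flat_exp n 0) / h) \<longlongrightarrow> 0) (at_left 0)"
      by (rule Lim_transform_eventually[OF tendsto_const])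
        (auto simp: eventually_at_filter flat_exp_def)
    have "(flat_exp n has_real_derivative 0) (at 0)"
      unfolding DERIV_def using l r by (rule filterlim_split_at)
    then show ?thesis using 3 by (simp add: flat_exp_def)
  qed
qed

text \<open>
  Smoothness asks for all iterated derivatives at once. This family is closed under partial
  derivatives, so each of its members is smooth.
\<close>

inductive_set bump_algebra :: "('a::euclidean_space \<Rightarrow> real) set" where
  gen: "i \<in> Basis \<Longrightarrow> (\<lambda>x. flat_exp n (c * (x \<bullet> i) + d)) \<in> bump_algebra"
| const: "(\<lambda>_. c) \<in> bump_algebra"
| add: "f \<in> bump_algebra \<Longrightarrow> g \<in> bump_algebra \<Longrightarrow> (\<lambda>x. f x + g x) \<in> bump_algebra"
| mult: "f \<in> bump_algebra \<Longrightarrow> g \<in> bump_algebra \<Longrightarrow> (\<lambda>x. f x * g x) \<in> bump_algebra"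

lemma bump_algebra_derivative:
  assumes "f \<in> bump_algebra"
  shows "\<exists>D. (\<forall>x. (f has_derivative D x) (at x)) \<and> (\<forall>v. (\<lambda>x. D x v) \<in> bump_algebra)"
  using assms
proof induction
  case (gen i n c d)
  let ?e = "\<lambda>n x. flat_exp n (c * (x \<bullet> i) + d)"
  have 1: "(?e n has_derivative
      (\<lambda>v. (c * (v \<bullet> i)) * (?e (n + 2) x - real n * ?e (n + 1) x))) (at x)" for x
  proof (rule has_derivative_compose[where g = "flat_exp n" and f = "\<lambda>x. c * (x \<bullet> i) + d"
        and g' = "\<lambda>u. u * (?e (n + 2) x - real n * ?e (n + 1) x)" and f' = "\<lambda>v. c * (v \<bullet> i)"])
    show "((\<lambda>x. c * (x \<bullet> i) + d) has_derivative (\<lambda>v. c * (v \<bullet> i))) (at x)"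
      by (auto intro!: derivative_eq_intros)
    show "(flat_exp n has_derivative (\<lambda>u. u * (?e (n + 2) x - real n * ?e (n + 1) x)))
        (at (c * (x \<bullet> i) + d))"
      using flat_exp_has_real_derivative[of n "c * (x \<bullet> i) + d"]
      by (simp add: has_field_derivative_def mult_commute_abs)
  qed
  have 2: "(\<lambda>x. (c * (v \<bullet> i)) * (?e (n + 2) x + (- real n) * ?e (n + 1) x)) \<in> bump_algebra" for v
    by (intro bump_algebra.mult bump_algebra.add bump_algebra.const bump_algebra.gen gen)
  show ?case
    using 1 2
    by (intro exI[of _ "\<lambda>x v. (c * (v \<bullet> i)) * (?e (n + 2) x - real n * ?e (n + 1) x)"]) simp
next
  case (const c)
  show ?case
    by (intro exI[of _ "\<lambda>_ _. 0"]) (simp add: bump_algebra.const)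
next
  case (add f g)
  then obtain D D' where
    "\<forall>x. (f has_derivative D x) (at x)" "\<forall>v. (\<lambda>x. D x v) \<in> bump_algebra"
    "\<forall>x. (g has_derivative D' x) (at x)" "\<forall>v. (\<lambda>x. D' x v) \<in> bump_algebra" by auto
  then show ?case
    by (intro exI[of _ "\<lambda>x v. D x v + D' x v"]) (simp add: bump_algebra.add has_derivative_add)
next
  case (mult f g)
  then obtain D D' where
    "\<forall>x. (f has_derivative D x) (at x)" "\<forall>v. (\<lambda>x. D x v) \<in> bump_algebra"
    "\<forall>x. (g has_derivative D' x) (at x)" "\<forall>v. (\<lambda>x. D' x v) \<in> bump_algebra" by auto
  with mult show ?case
    by (intro exI[of _ "\<lambda>x v. f x * D' x v + D x v * g x"])
      (simp add: bump_algebra.add bump_algebra.mult has_derivative_mult)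
qed

lemma bump_algebra_smooth:
  assumes "f \<in> bump_algebra"
  shows "smooth f"
proof -
  have "iterated_partial vs f \<in> bump_algebra" for vs
  proof (induction vs)
    case (Cons v vs)
    from bump_algebra_derivative[OF this] obtain D where
      D: "\<And>x. (iterated_partial vs f has_derivative D x) (at x)" "(\<lambda>x. D x v) \<in> bump_algebra"
      by auto
    have "iterated_partial (v # vs) f = (\<lambda>x. D x v)"
      using frechet_derivative_at[OF D(1)] by (simp add: fun_eq_iff)
    with D show ?case by simp
  qed (use assms in simp)
  then show ?thesis
    unfolding smooth_def differentiable_def using bump_algebra_derivative by blast
qed

lemma bump_algebra_prod:
  assumes "\<And>i. i \<in> I \<Longrightarrow> f i \<in> bump_algebra"
  shows "(\<lambda>x. \<Prod>i\<in>I. f i x) \<in> bump_algebra"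
  using assms
  by (induction I rule: infinite_finite_induct) (auto intro: bump_algebra.const bump_algebra.mult)

lemma flat_exp_0_bounds: "0 \<le> flat_exp 0 t" "flat_exp 0 t \<le> 1" "t \<le> 0 \<Longrightarrow> flat_exp 0 t = 0"
  by (auto simp: flat_exp_def)

lemma flat_exp_0_scaled_tendsto:
  assumes "t > 0"
  shows "(\<lambda>k. flat_exp 0 (real k * t)) \<longlonglongrightarrow> 1"
proof -
  have "(\<lambda>k. exp (- (inverse (real k) * inverse t))) \<longlonglongrightarrow> exp (- (0 * inverse t))"
    by (intro tendsto_intros lim_inverse_n)
  moreover have "\<forall>\<^sub>F k in sequentially. exp (- (inverse (real k) * inverse t)) = flat_exp 0 (real k * t)"
    using eventually_gt_at_top[of 0]
    by eventually_elim (use assms in \<open>auto simp: flat_exp_def field_simps not_le\<close>)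
  ultimately show ?thesis
    by (auto intro: Lim_transform_eventually)
qed

definition box_bump :: "'a::euclidean_space \<Rightarrow> 'a \<Rightarrow> nat \<Rightarrow> 'a \<Rightarrow> real" where
  "box_bump a b k x =
     (\<Prod>i\<in>Basis. flat_exp 0 (real k * (x \<bullet> i) + - (real k * (a \<bullet> i))) *
                 flat_exp 0 (- real k * (x \<bullet> i) + real k * (b \<bullet> i)))"

lemma box_bump_in_bump_algebra: "box_bump a b k \<in> bump_algebra"
  unfolding box_bump_def[abs_def]
  by (intro bump_algebra_prod bump_algebra.mult bump_algebra.gen)

lemma box_bump_bounds: "0 \<le> box_bump a b k x" "box_bump a b k x \<le> 1"
proof -
  have *: "0 \<le> flat_exp 0 s * flat_exp 0 t \<and> flat_exp 0 s * flat_exp 0 t \<le> 1" for s t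
    using mult_le_one[of "flat_exp 0 s" "flat_exp 0 t"] flat_exp_0_bounds(1,2) by simp
  show "0 \<le> box_bump a b k x" "box_bump a b k x \<le> 1"
    unfolding box_bump_def using * by (auto intro: prod_nonneg prod_le_1)
qed

lemma box_bump_zero: "x \<notin> box a b \<Longrightarrow> box_bump a b k x = 0"
proof -
  assume "x \<notin> box a b"
  then obtain i where i: "i \<in> Basis" "x \<bullet> i \<le> a \<bullet> i \<or> b \<bullet> i \<le> x \<bullet> i"
    by (auto simp: mem_box not_less)
  from i(2) have "flat_exp 0 (real k * (x \<bullet> i) + - (real k * (a \<bullet> i))) *
                 flat_exp 0 (- real k * (x \<bullet> i) + real k * (b \<bullet> i)) = 0"
  proof
    assume "x \<bullet> i \<le> a \<bullet> i"
    then have "real k * (x \<bullet> i) \<le> real k * (a \<bullet> i)" by (intro mult_left_mono) simp_all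
    then show ?thesis by (simp add: flat_exp_0_bounds(3))
  next
    assume "b \<bullet> i \<le> x \<bullet> i"
    then have "real k * (b \<bullet> i) \<le> real k * (x \<bullet> i)" by (intro mult_left_mono) simp_all
    then show ?thesis by (simp add: flat_exp_0_bounds(3))
  qed
  with i show ?thesis
    unfolding box_bump_def by (intro prod_zero) auto
qed

lemma box_bump_tendsto:
  assumes "x \<in> box a b"
  shows "(\<lambda>k. box_bump a b k x) \<longlonglongrightarrow> 1"
proof -
  have *: "(\<lambda>k. box_bump a b k x) = (\<lambda>k. \<Prod>i\<in>Basis. flat_exp 0 (real k * (x \<bullet> i - a \<bullet> i)) *
                 flat_exp 0 (real k * (b \<bullet> i - x \<bullet> i)))"
    by (simp add: box_bump_def fun_eq_iff algebra_simps)
  have "(\<lambda>k. box_bump a b k x) \<longlonglongrightarrow> (\<Prod>i\<in>(Basis::'a set). 1 * 1)"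
    unfolding * using assms
    by (intro tendsto_prod tendsto_mult flat_exp_0_scaled_tendsto) (auto simp: mem_box)
  then show ?thesis by simp
qed

text \<open>
  The open set is a countable union of boxes. The indicator of the first \<open>k\<close> of them is
  replaced by the complementary product \<open>1 - \<Prod>(1 - \<beta>\<^sub>i)\<close> of bumps, which becomes steeper with \<open>k\<close>.
\<close>

lemma open_indicator_limit_of_test_functions:
  fixes U :: "'a::euclidean_space set"
  assumes "open U"
  obtains \<phi> where "\<And>k. test_function U (\<phi> k)" "\<And>k x. 0 \<le> \<phi> k x" "\<And>k x. \<phi> k x \<le> 1"
    "\<And>k x. x \<notin> U \<Longrightarrow> \<phi> k x = 0" "\<And>x. (\<lambda>k. \<phi> k x) \<longlonglongrightarrow> indicator U x"
proof -
  define P :: "('a \<times> 'a) set" where "P = {(a, b). cbox a b \<subseteq> U}"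
  have cover: "\<exists>(a, b)\<in>P. x \<in> box a b" if xU: "x \<in> U" for x
  proof -
    obtain a b where "cbox a b \<subseteq> U" "x \<in> box a b"
      using open_contains_cbox[OF \<open>open U\<close> xU] by metis
    then show ?thesis by (intro bexI[of _ "(a, b)"]) (auto simp: P_def)
  qed
  obtain F where F: "F \<subseteq> (\<lambda>(a, b). box a b) ` P" "countable F"
      "\<Union>F = \<Union>((\<lambda>(a, b). box a b) ` P)"
  proof (rule Lindelof)
    show "open S" if "S \<in> (\<lambda>(a, b). box a b) ` P" for S
      using that by (auto simp: open_box)
  qed
  obtain Q where Q: "Q \<subseteq> P" "countable Q" "F = (\<lambda>(a, b). box a b) ` Q"
    using countable_subset_image[THEN iffD1, OF conjI[OF F(2,1)]] by auto
  \<comment> \<open>The empty box is added only to have a nonempty family to enumerate.\<close>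
  define c where "c = from_nat_into (insert (One, 0) Q)"
  have c_range: "range c = insert (One, 0) Q"
    unfolding c_def using Q by (intro range_from_nat_into) auto
  have "cbox One (0 :: 'a) = {}"
    using SOME_Basis by (auto simp: box_eq_empty)
  then have "(One, 0) \<in> P"
    by (simp add: P_def)
  then have c_P: "c i \<in> P" for i
    using rangeI[of c i] c_range Q(1) by auto
  have c_cover: "\<exists>i. x \<in> box (fst (c i)) (snd (c i))" if "x \<in> U" for x
  proof -
    have "x \<in> \<Union>F"
      using cover[OF that] F(3) by auto
    then obtain q where q: "q \<in> Q" "x \<in> box (fst q) (snd q)"
      using Q(3) by (auto simp: case_prod_unfold)
    moreover have "q \<in> range c"
      using q(1) c_range by simp
    ultimately show ?thesis by auto
  qed
  define \<beta> where "\<beta> i k x = box_bump (fst (c i)) (snd (c i)) k x" for i k x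
  define \<phi> where "\<phi> k x = 1 + (- 1) * (\<Prod>i<k. 1 + (- 1) * \<beta> i k x)" for k :: nat and x
  have \<beta>: "0 \<le> \<beta> i k x" "\<beta> i k x \<le> 1" for i k x
    using box_bump_bounds by (auto simp: \<beta>_def)
  have smooth: "smooth (\<phi> k)" for k
    unfolding \<phi>_def \<beta>_def
    by (intro bump_algebra_smooth bump_algebra.add bump_algebra.mult bump_algebra.const
        bump_algebra_prod box_bump_in_bump_algebra)
  have prod01: "0 \<le> (\<Prod>i<k. 1 + (- 1) * \<beta> i k x)" "(\<Prod>i<k. 1 + (- 1) * \<beta> i k x) \<le> 1" for k x
    using \<beta> by (auto intro!: prod_nonneg prod_le_1)
  define K where "K k = (\<Union>i<k. cbox (fst (c i)) (snd (c i)))" for k :: nat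
  have "compact (K k)" for k
    unfolding K_def by (intro compact_UN) auto
  have K_sub: "K k \<subseteq> U" for k
  proof -
    have "cbox (fst (c i)) (snd (c i)) \<subseteq> U" for i
      using c_P[of i] by (simp add: P_def case_prod_unfold)
    then show ?thesis by (auto simp: K_def)
  qed
  have support: "{x. \<phi> k x \<noteq> 0} \<subseteq> K k" for k
  proof
    fix x assume x: "x \<in> {x. \<phi> k x \<noteq> 0}"
    show "x \<in> K k"
    proof (rule ccontr)
      assume "x \<notin> K k"
      then have "\<beta> i k x = 0" if "i < k" for i
        using that box_subset_cbox[of "fst (c i)" "snd (c i)"]
        by (auto simp: \<beta>_def K_def intro!: box_bump_zero)
      then have "(\<Prod>i<k. 1 + (- 1) * \<beta> i k x) = 1"
        by (intro prod.neutral) auto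
      with x show False by (simp add: \<phi>_def)
    qed
  qed
  then have clos: "closure {x. \<phi> k x \<noteq> 0} \<subseteq> K k" for k
    using \<open>compact (K k)\<close> by (simp add: closure_minimal compact_imp_closed)
  have "compact (closure {x. \<phi> k x \<noteq> 0})" for k
    unfolding compact_closure
    by (rule bounded_subset[OF compact_imp_bounded[OF \<open>compact (K k)\<close>] support])
  then have test: "test_function U (\<phi> k)" for k
    unfolding test_function_def using smooth[of k] subset_trans[OF clos K_sub, of k] by simp
  have outside: "\<phi> k x = 0" if "x \<notin> U" for k x
    using support[of k] K_sub[of k] that by auto
  have "(\<lambda>k. \<phi> k x) \<longlonglongrightarrow> indicator U x" for x
  proof (cases "x \<in> U")
    case True
    then obtain i where i: "x \<in> box (fst (c i)) (snd (c i))"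
      using c_cover by blast
    have low: "\<beta> i k x \<le> \<phi> k x" if "i < k" for k
    proof -
      have "(\<Prod>j<k. 1 + (- 1) * \<beta> j k x) =
          (1 + (- 1) * \<beta> i k x) * (\<Prod>j\<in>{..<k} - {i}. 1 + (- 1) * \<beta> j k x)"
        using that by (subst prod.remove[of _ i]) auto
      also have "\<dots> \<le> (1 + (- 1) * \<beta> i k x) * 1"
        using \<beta> by (intro mult_left_mono prod_le_1) auto
      finally show ?thesis by (simp add: \<phi>_def)
    qed
    have "(\<lambda>k. \<phi> k x) \<longlonglongrightarrow> 1"
    proof (rule tendsto_sandwich)
      show "(\<lambda>k. \<beta> i k x) \<longlonglongrightarrow> 1"
        unfolding \<beta>_def using i by (rule box_bump_tendsto)
      show "\<forall>\<^sub>F k in sequentially. \<beta> i k x \<le> \<phi> k x"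
        using eventually_gt_at_top[of i] by eventually_elim (rule low)
      show "\<forall>\<^sub>F k in sequentially. \<phi> k x \<le> 1"
        using prod01 by (simp add: \<phi>_def)
    qed simp
    with True show ?thesis by simp
  qed (simp add: outside)
  with that[of \<phi>] test outside prod01 show thesis
    by (simp add: \<phi>_def)
qed

section \<open>Calculus of test functions\<close>

lemma iterated_partial_append:
  "iterated_partial (vs @ ws) f = iterated_partial vs (iterated_partial ws f)"
  by (induction vs) auto

lemma frechet_derivative_zero_outside_support:
  assumes "x \<notin> closure {x. \<phi> x \<noteq> (0::real)}"
  shows "frechet_derivative \<phi> (at x) v = 0"
proof -
  have "((\<lambda>_. 0) has_derivative (\<lambda>_. 0)) (at x)" by simp
  then have "(\<phi> has_derivative (\<lambda>_. 0)) (at x)"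
    by (rule has_derivative_transform_within_open[where s = "- closure {x. \<phi> x \<noteq> 0}"])
      (use assms closure_subset[of "{x. \<phi> x \<noteq> 0}"] in auto)
  then show ?thesis
    by (metis frechet_derivative_at)
qed

lemma test_function_partial:
  assumes "test_function \<Omega> \<phi>" "v \<in> Basis"
  shows "test_function \<Omega> (\<lambda>x. frechet_derivative \<phi> (at x) v)" (is "test_function \<Omega> ?D")
proof -
  have sub: "closure {x. ?D x \<noteq> 0} \<subseteq> closure {x. \<phi> x \<noteq> 0}"
    using frechet_derivative_zero_outside_support[of _ \<phi> v]
    by (intro closure_minimal) auto
  have "smooth ?D"
    unfolding smooth_def
  proof (intro allI impI)
    fix vs :: "'a list" and x assume "set vs \<subseteq> Basis"
    then have "iterated_partial (vs @ [v]) \<phi> differentiable (at x)"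
      using assms unfolding test_function_def smooth_def by simp
    then show "iterated_partial vs ?D differentiable (at x)"
      by (simp add: iterated_partial_append)
  qed
  moreover have "compact (closure {x. ?D x \<noteq> 0})"
  proof -
    have "bounded (closure {x. \<phi> x \<noteq> 0})"
      using assms(1) by (auto simp: test_function_def)
    then show ?thesis
      using sub closure_subset bounded_subset unfolding compact_closure by meson
  qed
  ultimately show ?thesis
    using sub assms(1) unfolding test_function_def by blast
qed

lemma test_function_iterated_partial:
  assumes "test_function \<Omega> \<phi>" "set vs \<subseteq> Basis"
  shows "test_function \<Omega> (iterated_partial vs \<phi>)"
  using assms(2) by (induction vs) (use assms(1) test_function_partial in auto)

lemma test_function_differentiable:
  assumes "test_function \<Omega> \<phi>"
  shows "(\<phi> has_derivative frechet_derivative \<phi> (at x)) (at x)"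
proof -
  have "iterated_partial [] \<phi> differentiable (at x)"
    using assms unfolding test_function_def smooth_def by (metis empty_set empty_subsetI)
  then show ?thesis by (simp add: frechet_derivative_works)
qed

lemma test_function_continuous: "test_function \<Omega> \<phi> \<Longrightarrow> continuous_on A \<phi>"
  by (intro continuous_at_imp_continuous_on ballI
      has_derivative_continuous[OF test_function_differentiable])

lemma test_function_measurable: "test_function \<Omega> \<phi> \<Longrightarrow> \<phi> \<in> borel_measurable borel"
  by (intro borel_measurable_continuous_onI test_function_continuous)

lemma test_function_zero: "test_function \<Omega> \<phi> \<Longrightarrow> x \<notin> \<Omega> \<Longrightarrow> \<phi> x = 0"
  using closure_subset[of "{x. \<phi> x \<noteq> 0}"] by (auto simp: test_function_def)

lemma test_function_bounded:
  assumes "test_function \<Omega> \<phi>"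
  obtains B where "\<And>x. \<bar>\<phi> x\<bar> \<le> B" "B > 0"
proof -
  let ?K = "closure {x. \<phi> x \<noteq> 0}"
  have "bounded (\<phi> ` ?K)"
    using assms test_function_continuous[OF assms, of ?K]
    by (intro compact_imp_bounded compact_continuous_image) (auto simp: test_function_def)
  then obtain B where B: "B > 0" "\<And>x. x \<in> ?K \<Longrightarrow> \<bar>\<phi> x\<bar> \<le> B"
    by (auto simp: bounded_pos)
  have "\<bar>\<phi> x\<bar> \<le> B" for x
    using B closure_subset[of "{x. \<phi> x \<noteq> 0}"] by (cases "\<phi> x = 0") auto
  with that B show thesis by blast
qed

lemma test_function_integrable:
  assumes "test_function \<Omega> \<phi>"
  shows "integrable lborel \<phi>"
proof -
  let ?K = "closure {x. \<phi> x \<noteq> 0}"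
  have "set_integrable lborel ?K \<phi>"
    unfolding set_integrable_def
    using assms test_function_continuous[OF assms]
    by (intro borel_integrable_compact) (simp_all add: test_function_def)
  moreover have "(\<lambda>x. indicator ?K x *\<^sub>R \<phi> x) = \<phi>"
    using closure_subset[of "{x. \<phi> x \<noteq> 0}"] by (auto simp: fun_eq_iff indicator_def)
  ultimately show ?thesis by (simp add: set_integrable_def)
qed

section \<open>Testing against smooth functions\<close>

lemma test_function_mono: "test_function A \<phi> \<Longrightarrow> A \<subseteq> B \<Longrightarrow> test_function B \<phi>"
  by (auto simp: test_function_def)

lemma integral_lebesgue_on_test_function:
  assumes "open \<Omega>" "test_function \<Omega> \<phi>"
  shows "(\<integral>x. g x * \<phi> x \<partial>lebesgue_on \<Omega>) = (\<integral>x. g x * \<phi> x \<partial>lebesgue)"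
proof -
  have "\<Omega> \<in> sets lebesgue" using assms(1) by auto
  then have "(\<integral>x. g x * \<phi> x \<partial>lebesgue_on \<Omega>) = (\<integral>x. indicator \<Omega> x *\<^sub>R (g x * \<phi> x) \<partial>lebesgue)"
    by (intro integral_restrict_space) simp
  also have "\<dots> = (\<integral>x. g x * \<phi> x \<partial>lebesgue)"
    using test_function_zero[OF assms(2)]
    by (intro Bochner_Integration.integral_cong refl) (auto simp: indicator_def)
  finally show ?thesis .
qed

lemma open_sets_Int_stable: "Int_stable (Collect open)"
  by (auto simp: Int_stable_def)

text \<open>
  Approximating indicators of open sets by test functions gives vanishing integrals over open
  sets; these generate the Borel sets and are stable under intersections.
\<close>

lemma vanishing_against_test_functions_local:
  fixes G :: "'a::euclidean_space \<Rightarrow> real"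
  assumes W: "open W" and int: "integrable lebesgue (\<lambda>x. indicator W x * G x)"
    and zero: "\<And>\<phi>. test_function W \<phi> \<Longrightarrow> (\<integral>x. G x * \<phi> x \<partial>lebesgue) = 0"
  shows "AE x in lebesgue. x \<in> W \<longrightarrow> G x = 0"
proof -
  define g where "g x = indicator W x * G x" for x
  have g: "integrable lebesgue g"
    using int by (simp add: g_def[abs_def])
  have gA: "integrable lebesgue (\<lambda>x. g x * indicator A x)" if "A \<in> sets borel" for A
    using that g by (intro integrable_real_mult_indicator) auto
  have "g \<in> borel_measurable (completion lborel)"
    using g by (rule borel_measurable_integrable)
  then obtain g' where g': "g' \<in> borel_measurable lborel" "AE x in lborel. g x = g' x"
    using completion_ex_borel_measurable_real by blast
  have eq: "AE x in lebesgue. g x = g' x"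
    using AE_completion[OF g'(2)] .
  have g'_int: "integrable lborel g'"
  proof -
    have "integrable lebesgue g'"
      using g g' eq by (subst integrable_cong_AE[of g' _ g]) (auto intro: measurable_completion)
    then show ?thesis
      using g'(1) integrable_completion[of g' lborel] by simp
  qed
  have P_open: "(\<integral>x. g x * indicator U x \<partial>lebesgue) = 0" if "open U" for U
  proof -
    have oUW: "open (U \<inter> W)" using that W by auto
    obtain \<phi> where \<phi>: "\<And>k. test_function (U \<inter> W) (\<phi> k)" "\<And>k x. 0 \<le> \<phi> k x" "\<And>k x. \<phi> k x \<le> 1"
      "\<And>k x. x \<notin> U \<inter> W \<Longrightarrow> \<phi> k x = 0" "\<And>x. (\<lambda>k. \<phi> k x) \<longlonglongrightarrow> indicator (U \<inter> W) x"
      using open_indicator_limit_of_test_functions[OF oUW] by metis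
    have meas: "\<phi> k \<in> borel_measurable lebesgue" for k
      using test_function_measurable[OF \<phi>(1)] by (simp add: measurable_completion)
    have "(\<lambda>k. \<integral>x. g x * \<phi> k x \<partial>lebesgue) \<longlonglongrightarrow> (\<integral>x. g x * indicator (U \<inter> W) x \<partial>lebesgue)"
    proof (rule integral_dominated_convergence)
      show "integrable lebesgue (\<lambda>x. \<bar>g x\<bar>)" using g by auto
      show "AE x in lebesgue. (\<lambda>k. g x * \<phi> k x) \<longlonglongrightarrow> g x * indicator (U \<inter> W) x"
        using \<phi>(5) by (intro AE_I2 tendsto_intros)
      show "AE x in lebesgue. norm (g x * \<phi> k x) \<le> \<bar>g x\<bar>" for k
        using \<phi>(2,3)[of k] by (intro AE_I2) (simp add: abs_mult mult_left_le)
      show "(\<lambda>x. g x * indicator (U \<inter> W) x) \<in> borel_measurable lebesgue"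
        using gA[of "U \<inter> W"] oUW borel_measurable_integrable by auto
      show "(\<lambda>x. g x * \<phi> k x) \<in> borel_measurable lebesgue" for k
        using g meas by (intro borel_measurable_times) auto
    qed
    moreover have "(\<integral>x. g x * \<phi> k x \<partial>lebesgue) = 0" for k
    proof -
      have "(\<lambda>x. g x * \<phi> k x) = (\<lambda>x. G x * \<phi> k x)"
        using \<phi>(4)[of _ k] by (auto simp: fun_eq_iff g_def indicator_def)
      then show ?thesis
        using zero[of "\<phi> k"] test_function_mono[OF \<phi>(1), of W] by simp
    qed
    ultimately have "(\<integral>x. g x * indicator (U \<inter> W) x \<partial>lebesgue) = 0"
      using LIMSEQ_unique[OF _ tendsto_const[of "0::real"]] by simp
    moreover have "(\<lambda>x. g x * indicator (U \<inter> W) x) = (\<lambda>x. g x * indicator U x)"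
      by (auto simp: fun_eq_iff g_def indicator_def)
    ultimately show ?thesis by simp
  qed
  have P: "(\<integral>x. g x * indicator A x \<partial>lebesgue) = 0" if "A \<in> sets borel" for A
  proof -
    have A: "A \<in> sigma_sets UNIV (Collect open)"
      using that by (simp add: sets_borel)
    have "Collect open \<subseteq> Pow (UNIV :: 'a set)" by simp
    from open_sets_Int_stable this A show ?thesis
    proof (induction rule: sigma_sets_induct_disjoint)
      case (basic U)
      then show ?case using P_open by simp
    next
      case empty
      show ?case by simp
    next
      case (compl A)
      then have A: "A \<in> sets borel" by (simp add: sets_borel)
      have "(\<integral>x. g x * indicator (UNIV - A) x \<partial>lebesgue)
          = (\<integral>x. g x * indicator UNIV x - g x * indicator A x \<partial>lebesgue)"
        by (intro Bochner_Integration.integral_cong) (auto simp: indicator_def)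
      also have "\<dots> = (\<integral>x. g x * indicator UNIV x \<partial>lebesgue) - (\<integral>x. g x * indicator A x \<partial>lebesgue)"
        using gA[OF A] gA[of UNIV] by (intro Bochner_Integration.integral_diff) auto
      also have "\<dots> = 0"
        using compl P_open[OF open_UNIV] by simp
      finally show ?case .
    next
      case (union A)
      then have A: "A i \<in> sets borel" for i by (auto simp: sets_borel)
      have "(\<lambda>n. \<Sum>i<n. \<integral>x. g x * indicator (A i) x \<partial>lebesgue) \<longlonglongrightarrow>
          (\<integral>x. g x * indicator (\<Union>i. A i) x \<partial>lebesgue)"
      proof -
        have "(\<lambda>n. \<integral>x. (\<Sum>i<n. g x * indicator (A i) x) \<partial>lebesgue) \<longlonglongrightarrow>
            (\<integral>x. g x * indicator (\<Union>i. A i) x \<partial>lebesgue)"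
        proof (rule integral_dominated_convergence)
          show "integrable lebesgue (\<lambda>x. \<bar>g x\<bar>)" using g by auto
          show "(\<lambda>x. g x * indicator (\<Union>i. A i) x) \<in> borel_measurable lebesgue"
            using A by (intro borel_measurable_integrable gA) auto
          show "(\<lambda>x. \<Sum>i<n. g x * indicator (A i) x) \<in> borel_measurable lebesgue" for n
            using A by (intro borel_measurable_integrable Bochner_Integration.integrable_sum gA) auto
          have sum_ind: "(\<Sum>i<n. g x * indicator (A i) x) = g x * indicator (\<Union>i<n. A i) x" for n x
            using union(1)
            by (simp add: sum_distrib_left[symmetric] indicator_UN_disjoint disjoint_family_on_def)
          show "AE x in lebesgue. norm (\<Sum>i<n. g x * indicator (A i) x) \<le> \<bar>g x\<bar>" for n
            unfolding sum_ind by (intro AE_I2) (auto simp: indicator_def)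
          show "AE x in lebesgue. (\<lambda>n. \<Sum>i<n. g x * indicator (A i) x) \<longlonglongrightarrow>
              g x * indicator (\<Union>i. A i) x"
            unfolding sum_ind by (intro AE_I2 tendsto_intros LIMSEQ_indicator_UN)
        qed
        then show ?thesis
          using A by (subst (asm) Bochner_Integration.integral_sum) (auto intro: gA)
      qed
      then show ?case
        using union(3) LIMSEQ_unique[OF _ tendsto_const[of "0::real"]] by simp
    qed
  qed
  have "AE x in lborel. g' x = 0"
  proof (rule sigma_finite_measure.density_zero[OF sigma_finite_lborel g'_int])
    fix A :: "'a set" assume "A \<in> sets lborel"
    then have A: "A \<in> sets borel" by simp
    have "(\<integral>x. g' x * indicator A x \<partial>lborel) = (\<integral>x. g' x * indicator A x \<partial>lebesgue)"
      using g'(1) A by (intro integral_completion[symmetric]) auto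
    also have "\<dots> = (\<integral>x. g x * indicator A x \<partial>lebesgue)"
    proof (rule integral_cong_AE)
      show "(\<lambda>x. g' x * indicator A x) \<in> borel_measurable lebesgue"
        using g'(1) A by (intro measurable_completion) auto
      show "(\<lambda>x. g x * indicator A x) \<in> borel_measurable lebesgue"
        by (rule borel_measurable_integrable[OF gA[OF A]])
      show "AE x in lebesgue. g' x * indicator A x = g x * indicator A x"
        using eq by eventually_elim simp
    qed
    finally show "set_lebesgue_integral lborel A g' = 0"
      using P[OF A] by (simp add: set_lebesgue_integral_def mult.commute)
  qed
  then have "AE x in lebesgue. g' x = 0"
    by (rule AE_completion)
  with eq show ?thesis
    by eventually_elim (auto simp: g_def)
qed

text \<open>
  Uniqueness of weak derivatives: a locally integrable function that vanishes against all test
  functions vanishes almost everywhere, since this holds on small balls and negligibility is local.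
\<close>

lemma vanishing_against_test_functions:
  fixes G :: "'a::euclidean_space \<Rightarrow> real"
  assumes \<Omega>: "open \<Omega>" and int: "locally_integrable \<Omega> G"
    and zero: "\<And>\<phi>. test_function \<Omega> \<phi> \<Longrightarrow> (\<integral>x. G x * \<phi> x \<partial>lebesgue_on \<Omega>) = 0"
  shows "AE x in lebesgue_on \<Omega>. G x = 0"
proof -
  define N where "N = {x \<in> \<Omega>. G x \<noteq> 0}"
  have "negligible N"
  proof (rule locally_negligible_alt[THEN iffD2, rule_format])
    fix x assume "x \<in> N"
    then have "x \<in> \<Omega>" by (simp add: N_def)
    then obtain r where r: "r > 0" "cball x r \<subseteq> \<Omega>"
      using \<Omega> unfolding open_contains_cball by auto
    have sub: "ball x r \<subseteq> \<Omega>" by (rule subset_trans[OF ball_subset_cball r(2)])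
    have "integrable (lebesgue_on (cball x r)) G"
      using int r by (auto simp: locally_integrable_def)
    then have "integrable lebesgue (\<lambda>y. indicator (cball x r) y * G y)"
      by (subst (asm) integrable_restrict_space) auto
    then have "integrable lebesgue (\<lambda>y. (indicator (cball x r) y * G y) * indicator (ball x r) y)"
      by (intro integrable_real_mult_indicator) auto
    moreover have "(\<lambda>y. (indicator (cball x r) y * G y) * indicator (ball x r) y)
        = (\<lambda>y. indicator (ball x r) y * G y)"
      by (auto simp: fun_eq_iff indicator_def)
    ultimately have int_r: "integrable lebesgue (\<lambda>y. indicator (ball x r) y * G y)"
      by simp
    have zero_r: "(\<integral>y. G y * \<phi> y \<partial>lebesgue) = 0" if "test_function (ball x r) \<phi>" for \<phi>
      using test_function_mono[OF that sub] zero integral_lebesgue_on_test_function[OF \<Omega>] by metis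
    have "AE y in lebesgue. y \<in> ball x r \<longrightarrow> G y = 0"
      by (rule vanishing_against_test_functions_local[OF open_ball int_r zero_r])
    then obtain Z where Z: "{y \<in> space lebesgue. \<not> (y \<in> ball x r \<longrightarrow> G y = 0)} \<subseteq> Z"
        "emeasure lebesgue Z = 0" "Z \<in> sets lebesgue"
      by (rule AE_E)
    then have "negligible Z"
      by (simp add: negligible_iff_null_sets null_sets_def)
    moreover have "N \<inter> ball x r \<subseteq> Z"
      using Z(1) by (auto simp: N_def)
    ultimately have "negligible (N \<inter> ball x r)"
      by (rule negligible_subset)
    then show "\<exists>U. openin (top_of_set N) U \<and> x \<in> U \<and> negligible U"
      using \<open>x \<in> N\<close> r by (intro exI[of _ "N \<inter> ball x r"]) auto
  qed
  then have "N \<in> null_sets lebesgue"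
    by (simp add: negligible_iff_null_sets)
  then have "AE x in lebesgue. x \<notin> N"
    by (rule AE_not_in)
  then show ?thesis
    using \<Omega> by (subst AE_restrict_space_iff) (auto simp: N_def)
qed

lemma integrable_bounded_mult:
  fixes w f :: "'a \<Rightarrow> real"
  assumes "w \<in> borel_measurable M" "AE x in M. \<bar>w x\<bar> \<le> K" "integrable M f"
  shows "integrable M (\<lambda>x. w x * f x)"
proof (rule Bochner_Integration.integrable_bound[of M "\<lambda>x. \<bar>K\<bar> * \<bar>f x\<bar>"])
  show "integrable M (\<lambda>x. \<bar>K\<bar> * \<bar>f x\<bar>)" using assms(3) by simp
  show "(\<lambda>x. w x * f x) \<in> borel_measurable M"
    using assms(1,3) by (intro borel_measurable_times) auto
  show "AE x in M. norm (w x * f x) \<le> norm (\<bar>K\<bar> * \<bar>f x\<bar>)"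
    using assms(2) by eventually_elim (auto simp: abs_mult intro!: mult_right_mono)
qed

text \<open>The bound on the sequence makes the set of admissible \<open>\<psi>\<close> closed in \<open>L\<^sup>1\<close>.\<close>

lemma bounded_weak_limit_L1_closed:
  fixes w :: "nat \<Rightarrow> 'a \<Rightarrow> real"
  assumes w: "\<And>j. w j \<in> borel_measurable M" "\<And>j. AE x in M. \<bar>w j x\<bar> \<le> K"
    and \<psi>: "integrable M \<psi>"
    and approx: "\<And>e. e > 0 \<Longrightarrow> \<exists>\<psi>'. integrable M \<psi>' \<and> (\<integral>x. \<bar>\<psi> x - \<psi>' x\<bar> \<partial>M) < e \<and>
        (\<lambda>j. \<integral>x. w j x * \<psi>' x \<partial>M) \<longlonglongrightarrow> 0"
  shows "(\<lambda>j. \<integral>x. w j x * \<psi> x \<partial>M) \<longlonglongrightarrow> 0"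
proof (rule LIMSEQ_I)
  fix e :: real assume e: "e > 0"
  define e' where "e' = e / (2 * (\<bar>K\<bar> + 1))"
  have e': "e' > 0" using e by (simp add: e'_def)
  then obtain \<psi>' where \<psi>': "integrable M \<psi>'" "(\<integral>x. \<bar>\<psi> x - \<psi>' x\<bar> \<partial>M) < e'"
      "(\<lambda>j. \<integral>x. w j x * \<psi>' x \<partial>M) \<longlonglongrightarrow> 0"
    using approx by meson
  have int: "integrable M (\<lambda>x. w j x * f x)" if "integrable M f" for f j
    by (rule integrable_bounded_mult[OF w that])
  have diff: "\<bar>(\<integral>x. w j x * \<psi> x \<partial>M) - (\<integral>x. w j x * \<psi>' x \<partial>M)\<bar> \<le> e / 2" for j
  proof -
    have "(\<integral>x. w j x * \<psi> x \<partial>M) - (\<integral>x. w j x * \<psi>' x \<partial>M) = (\<integral>x. w j x * (\<psi> x - \<psi>' x) \<partial>M)"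
      using int[OF \<psi>] int[OF \<psi>'(1)] by (simp add: right_diff_distrib)
    also have "\<bar>\<dots>\<bar> \<le> (\<integral>x. \<bar>K\<bar> * \<bar>\<psi> x - \<psi>' x\<bar> \<partial>M)"
    proof -
      have i: "integrable M (\<lambda>x. \<psi> x - \<psi>' x)" using \<psi> \<psi>'(1) by simp
      have "\<bar>\<integral>x. w j x * (\<psi> x - \<psi>' x) \<partial>M\<bar> \<le> (\<integral>x. \<bar>w j x * (\<psi> x - \<psi>' x)\<bar> \<partial>M)"
        by (rule integral_abs_bound)
      also have "\<dots> \<le> (\<integral>x. \<bar>K\<bar> * \<bar>\<psi> x - \<psi>' x\<bar> \<partial>M)"
      proof (rule integral_mono_AE)
        show "integrable M (\<lambda>x. \<bar>w j x * (\<psi> x - \<psi>' x)\<bar>)" using int[OF i] by simp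
        show "integrable M (\<lambda>x. \<bar>K\<bar> * \<bar>\<psi> x - \<psi>' x\<bar>)" using i by simp
        show "AE x in M. \<bar>w j x * (\<psi> x - \<psi>' x)\<bar> \<le> \<bar>K\<bar> * \<bar>\<psi> x - \<psi>' x\<bar>"
          using w(2)[of j] by eventually_elim (auto simp: abs_mult intro!: mult_right_mono)
      qed
      finally show ?thesis .
    qed
    also have "\<dots> \<le> \<bar>K\<bar> * e'"
      using \<psi>'(2) by (simp add: mult_left_mono)
    also have "\<dots> \<le> (\<bar>K\<bar> + 1) * e'" using e' by simp
    also have "\<dots> = e / 2"
      using abs_ge_zero[of K] by (simp add: e'_def divide_simps)
    finally show ?thesis .
  qed
  obtain N where N: "\<And>j. j \<ge> N \<Longrightarrow> norm ((\<integral>x. w j x * \<psi>' x \<partial>M) - 0) < e / 2"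
    using LIMSEQ_D[OF \<psi>'(3), of "e / 2"] e by auto
  have "norm ((\<integral>x. w j x * \<psi> x \<partial>M) - 0) < e" if "j \<ge> N" for j
    using diff[of j] N[OF that] by (simp add: abs_if split: if_splits)
  then show "\<exists>N. \<forall>j\<ge>N. norm ((\<integral>x. w j x * \<psi> x \<partial>M) - 0) < e" by blast
qed

text \<open>
  Indicators of measurable sets are approximated from outside by indicators of open sets, and
  these by test functions; sums and limits lead to all integrable functions.
\<close>

lemma bounded_weak_limit_from_test_functions:
  fixes w :: "nat \<Rightarrow> 'a::euclidean_space \<Rightarrow> real"
  assumes \<Omega>: "open \<Omega>"
    and w: "\<And>j. w j \<in> borel_measurable (lebesgue_on \<Omega>)" "\<And>j. AE x in lebesgue_on \<Omega>. \<bar>w j x\<bar> \<le> K"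
    and test: "\<And>\<phi>. test_function \<Omega> \<phi> \<Longrightarrow> (\<lambda>j. \<integral>x. w j x * \<phi> x \<partial>lebesgue_on \<Omega>) \<longlonglongrightarrow> 0"
    and \<psi>: "integrable (lebesgue_on \<Omega>) \<psi>"
  shows "(\<lambda>j. \<integral>x. w j x * \<psi> x \<partial>lebesgue_on \<Omega>) \<longlonglongrightarrow> 0"
  using \<psi>
proof induction
  case (base A c)
  let ?M = "lebesgue_on \<Omega>"
  have sp: "space ?M = \<Omega>" by (simp add: space_restrict_space)
  have \<Omega>s: "\<Omega> \<in> sets lebesgue" using \<Omega> by auto
  have A: "A \<in> sets lebesgue" "A \<subseteq> \<Omega>"
    using base(1) \<Omega>s by (auto simp: sets_restrict_space_iff)
  have emA: "emeasure lebesgue A < \<infinity>"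
    using base(2) A \<Omega>s by (simp add: emeasure_restrict_space)

  have ind: "integrable ?M (\<lambda>x. indicator B x :: real)"
    if "B \<in> sets lebesgue" "B \<subseteq> \<Omega>" "emeasure lebesgue B < \<infinity>" for B
    using that \<Omega>s
    by (simp add: sp Int_absorb2 sets_restrict_space_iff emeasure_restrict_space)
  have intA: "integrable ?M (\<lambda>x. indicator A x :: real)"
    using A emA by (rule ind)
  have "(\<lambda>j. \<integral>x. w j x * indicator A x \<partial>?M) \<longlonglongrightarrow> 0"
  proof (rule bounded_weak_limit_L1_closed[OF w intA])
    fix e :: real assume e: "e > 0"
    obtain T where T: "open T" "A \<subseteq> T" "T - A \<in> lmeasurable" "emeasure lebesgue (T - A) < ennreal (e / 2)"
      using sets_lebesgue_outer_open[OF A(1), of "e / 2"] e by auto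
    define U where "U = T \<inter> \<Omega>"
    have U: "open U" "A \<subseteq> U" "U \<subseteq> \<Omega>" "U - A \<subseteq> T - A"
      using T \<Omega> A by (auto simp: U_def)
    have Us: "U \<in> sets lebesgue" using U by auto
    have UAs: "U - A \<in> sets lebesgue" using Us A by auto
    have em: "emeasure lebesgue (U - A) < ennreal (e / 2)"
      using emeasure_mono[OF U(4), of lebesgue] T(3,4) by (auto simp: fmeasurable_def)
    have "emeasure lebesgue U \<le> emeasure lebesgue A + emeasure lebesgue (U - A)"
      using emeasure_subadditive[OF A(1) UAs] U(2) by (simp add: Un_absorb1)
    also have "\<dots> < \<infinity>"
      using emA order_less_trans[OF em ennreal_less_top] by simp
    finally have emU: "emeasure lebesgue U < \<infinity>" .
    have intU: "integrable ?M (\<lambda>x. indicator U x :: real)"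
      using Us U(3) emU by (rule ind)
    obtain \<phi> where \<phi>: "\<And>k. test_function U (\<phi> k)" "\<And>k x. 0 \<le> \<phi> k x" "\<And>k x. \<phi> k x \<le> 1"
        "\<And>k x. x \<notin> U \<Longrightarrow> \<phi> k x = 0" "\<And>x. (\<lambda>k. \<phi> k x) \<longlonglongrightarrow> indicator U x"
      using open_indicator_limit_of_test_functions[OF U(1)] by metis
    have meas: "\<phi> k \<in> borel_measurable ?M" for k
      using test_function_measurable[OF \<phi>(1)]
      by (intro measurable_restrict_space1 measurable_completion) simp
    have le: "\<bar>\<phi> k x\<bar> \<le> indicator U x" for k x
      using \<phi>(2,3)[of k x] \<phi>(4)[of x k] by (auto simp: indicator_def)
    have int_\<phi>: "integrable ?M (\<phi> k)" for k
      by (rule Bochner_Integration.integrable_bound[OF intU meas]) (use le in auto)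
    have "(\<lambda>k. \<integral>x. \<bar>indicator U x - \<phi> k x\<bar> \<partial>?M) \<longlonglongrightarrow> (\<integral>x. 0 \<partial>?M)"
    proof (rule integral_dominated_convergence)
      show "integrable ?M (\<lambda>x. 2 * indicator U x :: real)"
        using intU by (rule Bochner_Integration.integrable_mult_right)
      show "(\<lambda>x. \<bar>indicator U x - \<phi> k x\<bar>) \<in> borel_measurable ?M" for k
        using intU meas by auto
      show "AE x in ?M. norm \<bar>indicator U x - \<phi> k x\<bar> \<le> 2 * indicator U x" for k
        using le[of k] by (intro AE_I2) (auto simp: indicator_def abs_le_iff split: if_splits)
      have "(\<lambda>k. \<bar>indicator U x - \<phi> k x\<bar>) \<longlonglongrightarrow> \<bar>indicator U x - indicator U x\<bar>" for x
        using \<phi>(5) by (intro tendsto_intros)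
      then show "AE x in ?M. (\<lambda>k. \<bar>indicator U x - \<phi> k x\<bar>) \<longlonglongrightarrow> 0" by simp
    qed simp
    then have "(\<lambda>k. \<integral>x. \<bar>indicator U x - \<phi> k x\<bar> \<partial>?M) \<longlonglongrightarrow> 0" by simp
    then obtain k where k: "\<bar>\<integral>x. \<bar>indicator U x - \<phi> k x\<bar> \<partial>?M\<bar> < e / 2"
      using LIMSEQ_D[of _ 0 "e / 2"] e by fastforce

    have intUA: "integrable ?M (\<lambda>x. indicator (U - A) x :: real)"
      using order_less_trans[OF em ennreal_less_top] UAs U(3)
      by (intro ind) auto
    have "(\<integral>x. \<bar>indicator A x - \<phi> k x\<bar> \<partial>?M)
        \<le> (\<integral>x. indicator (U - A) x + \<bar>indicator U x - \<phi> k x\<bar> \<partial>?M)"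
    proof (rule integral_mono)
      show "integrable ?M (\<lambda>x. \<bar>indicator A x - \<phi> k x\<bar>)" using intA int_\<phi> by auto
      show "integrable ?M (\<lambda>x. indicator (U - A) x + \<bar>indicator U x - \<phi> k x\<bar>)"
        using intUA intU int_\<phi> by auto
      show "\<bar>indicator A x - \<phi> k x\<bar> \<le> indicator (U - A) x + \<bar>indicator U x - \<phi> k x\<bar>" for x
        using U(2) by (auto simp: indicator_def)
    qed
    also have "\<dots> = (\<integral>x. indicator (U - A) x \<partial>?M) + (\<integral>x. \<bar>indicator U x - \<phi> k x\<bar> \<partial>?M)"
      using intUA intU int_\<phi> by (intro Bochner_Integration.integral_add) auto
    also have "(\<integral>x. indicator (U - A) x \<partial>?M) = measure lebesgue (U - A)"
    proof -
      have "(U - A) \<inter> \<Omega> = U - A" using U(3) by auto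
      then show ?thesis
        using UAs \<Omega>s U(3) by (simp add: sp measure_restrict_space subset_trans[OF Diff_subset])
    qed
    also have "\<dots> < e / 2"
      using em e enn2real_less_iff[OF order_less_trans[OF em ennreal_less_top], of "e / 2"]
      by (simp add: measure_def)
    finally have "(\<integral>x. \<bar>indicator A x - \<phi> k x\<bar> \<partial>?M) < e"
      using k by simp
    moreover have "(\<lambda>j. \<integral>x. w j x * \<phi> k x \<partial>?M) \<longlonglongrightarrow> 0"
      using test test_function_mono[OF \<phi>(1) U(3)] by simp
    ultimately show "\<exists>\<psi>'. integrable ?M \<psi>' \<and> (\<integral>x. \<bar>indicator A x - \<psi>' x\<bar> \<partial>?M) < e \<and>
        (\<lambda>j. \<integral>x. w j x * \<psi>' x \<partial>?M) \<longlonglongrightarrow> 0"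
      using int_\<phi>[of k] by (intro exI[of _ "\<phi> k"]) simp
  qed
  then have "(\<lambda>j. (\<integral>x. w j x * indicator A x \<partial>?M) * c) \<longlonglongrightarrow> 0 * c"
    by (intro tendsto_intros)
  moreover have "(\<integral>x. w j x * (indicator A x *\<^sub>R c) \<partial>?M) = (\<integral>x. w j x * indicator A x \<partial>?M) * c" for j
    by (simp add: mult.assoc[symmetric])
  ultimately show ?case by simp
next
  case (add f g)
  have int: "integrable (lebesgue_on \<Omega>) (\<lambda>x. w j x * f x)" if "integrable (lebesgue_on \<Omega>) f" for f j
    by (rule integrable_bounded_mult[OF w that])
  have "(\<integral>x. w j x * (f x + g x) \<partial>lebesgue_on \<Omega>) =
      (\<integral>x. w j x * f x \<partial>lebesgue_on \<Omega>) + (\<integral>x. w j x * g x \<partial>lebesgue_on \<Omega>)" for j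
    using int add by (simp add: distrib_left)
  then show ?case
    using tendsto_add[OF add(3,4)] by simp
next
  case (lim f s)
  let ?M = "lebesgue_on \<Omega>"
  show ?case
  proof (rule bounded_weak_limit_L1_closed[OF w lim(4)])
    fix e :: real assume e: "e > 0"
    have "(\<lambda>k. \<integral>x. \<bar>f x - s k x\<bar> \<partial>?M) \<longlonglongrightarrow> (\<integral>x. 0 \<partial>?M)"
    proof (rule integral_dominated_convergence)
      show "integrable ?M (\<lambda>x. 3 * \<bar>f x\<bar>)" using lim(4) by simp
      show "(\<lambda>x. \<bar>f x - s k x\<bar>) \<in> borel_measurable ?M" for k
        using lim(1)[of k] lim(4) by auto
      show "AE x in ?M. norm \<bar>f x - s k x\<bar> \<le> 3 * \<bar>f x\<bar>" for k
        using lim(3)[of _ k] by (intro AE_I2) fastforce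
      have "(\<lambda>k. \<bar>f x - s k x\<bar>) \<longlonglongrightarrow> \<bar>f x - f x\<bar>" if "x \<in> space ?M" for x
        using lim(2)[OF that] by (intro tendsto_intros)
      then show "AE x in ?M. (\<lambda>k. \<bar>f x - s k x\<bar>) \<longlonglongrightarrow> 0"
        by (intro AE_I2) simp
    qed simp
    then have "(\<lambda>k. \<integral>x. \<bar>f x - s k x\<bar> \<partial>?M) \<longlonglongrightarrow> 0" by simp
    then obtain k where k: "\<bar>\<integral>x. \<bar>f x - s k x\<bar> \<partial>?M\<bar> < e"
      using LIMSEQ_D[of _ 0 "e"] e by fastforce
    then show "\<exists>\<psi>'. integrable ?M \<psi>' \<and> (\<integral>x. \<bar>f x - \<psi>' x\<bar> \<partial>?M) < e \<and>
        (\<lambda>j. \<integral>x. w j x * \<psi>' x \<partial>?M) \<longlonglongrightarrow> 0"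
      using lim(1)[of k] lim(5)[of k] by (intro exI[of _ "s k"]) simp
  qed
qed

section \<open>Weak compactness of bounded sequences\<close>

inductive_set midpoint_hull :: "(nat \<Rightarrow> 'a \<Rightarrow> real) \<Rightarrow> nat \<Rightarrow> ('a \<Rightarrow> real) set" for u k where
  tail: "k \<le> i \<Longrightarrow> u i \<in> midpoint_hull u k"
| midpoint: "v \<in> midpoint_hull u k \<Longrightarrow> w \<in> midpoint_hull u k \<Longrightarrow>
    (\<lambda>x. (v x + w x) / 2) \<in> midpoint_hull u k"

lemma midpoint_hull_antimono: "w \<in> midpoint_hull u k \<Longrightarrow> j \<le> k \<Longrightarrow> w \<in> midpoint_hull u j"
  by (induction rule: midpoint_hull.induct) (auto intro: midpoint_hull.intros)

lemma midpoint_hull_bounded: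
  assumes "w \<in> midpoint_hull u k" "\<And>i x. \<bar>u i x\<bar> \<le> K"
  shows "\<bar>w x\<bar> \<le> K"
  using assms(1)
proof (induction rule: midpoint_hull.induct)
  case (midpoint v w)
  then show ?case by (simp add: abs_le_iff)
qed (rule assms(2))

lemma midpoint_hull_measurable:
  assumes "w \<in> midpoint_hull u k" "\<And>i. u i \<in> borel_measurable M"
  shows "w \<in> borel_measurable M"
  using assms(1)
proof (induction rule: midpoint_hull.induct)
  case (midpoint v w)
  then show ?case by measurable
qed (rule assms(2))

lemma midpoint_hull_integral_close:
  fixes u :: "nat \<Rightarrow> 'a \<Rightarrow> real"
  assumes w: "w \<in> midpoint_hull u k"
    and u: "\<And>i. u i \<in> borel_measurable M" "\<And>i x. \<bar>u i x\<bar> \<le> K" and \<phi>: "integrable M \<phi>"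
    and close: "\<And>i. k \<le> i \<Longrightarrow> \<bar>(\<integral>x. u i x * \<phi> x \<partial>M) - l\<bar> \<le> e"
  shows "\<bar>(\<integral>x. w x * \<phi> x \<partial>M) - l\<bar> \<le> e"
  using w
proof (induction rule: midpoint_hull.induct)
  case (tail i)
  then show ?case by (rule close)
next
  case (midpoint v w)
  have int: "integrable M (\<lambda>x. f x * \<phi> x)" if "f \<in> midpoint_hull u k" for f
    by (rule integrable_bounded_mult[OF midpoint_hull_measurable[OF that u(1)]
          AE_I2[OF midpoint_hull_bounded[OF that u(2)]] \<phi>])
  have "(\<integral>x. (v x + w x) / 2 * \<phi> x \<partial>M) = (\<integral>x. (v x * \<phi> x + w x * \<phi> x) / 2 \<partial>M)"
    by (intro Bochner_Integration.integral_cong) (auto simp: algebra_simps)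
  also have "\<dots> = ((\<integral>x. v x * \<phi> x \<partial>M) + (\<integral>x. w x * \<phi> x \<partial>M)) / 2"
    using int midpoint by simp
  finally show ?case
    using midpoint.IH by (simp add: abs_le_iff field_simps)
qed

text \<open>
  Mazur's trick. Let \<open>d\<^sub>k\<close> be the infimum of the squared \<open>L\<^sup>2\<close> norms over the midpoint hull of the
  tail \<open>u\<^sub>k, u\<^sub>k\<^sub>+\<^sub>1, \<dots>\<close>. As \<open>d\<^sub>k\<close> increases to a finite limit, the parallelogram law makes almost
  minimal elements of these hulls a Cauchy sequence, so that they converge strongly, while
  they keep all weak limits of the sequence \<open>u\<close>. Midpoint hulls replace convex hulls because the
  parallelogram law involves midpoints only.
\<close>

lemma (in finite_measure) bounded_sequence_weak_limit:
  fixes u :: "nat \<Rightarrow> 'a \<Rightarrow> real"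
  assumes u: "\<And>i. u i \<in> borel_measurable M" "\<And>i x. \<bar>u i x\<bar> \<le> K"
  obtains G where "G \<in> borel_measurable M" "\<And>x. \<bar>G x\<bar> \<le> K"
    "\<And>\<phi> l. integrable M \<phi> \<Longrightarrow> (\<lambda>k. \<integral>x. u k x * \<phi> x \<partial>M) \<longlonglongrightarrow> l \<Longrightarrow> (\<integral>x. G x * \<phi> x \<partial>M) = l"
proof -
  have bdd: "\<bar>w x\<bar> \<le> K" if "w \<in> midpoint_hull u k" for w x k
    using midpoint_hull_bounded[OF that] u(2) by blast
  have meas: "w \<in> borel_measurable M" if "w \<in> midpoint_hull u k" for w k
    using midpoint_hull_measurable[OF that u(1)] .
  have K: "0 \<le> K" using u(2)[of undefined undefined] by linarith
  define H where "H = midpoint_hull u"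
  define q :: "('a \<Rightarrow> real) \<Rightarrow> real" where "q w = (\<integral>x. (w x)\<^sup>2 \<partial>M)" for w
  define d where "d k = Inf (q ` H k)" for k
  have u_H: "u k \<in> H k" for k by (simp add: H_def midpoint_hull.tail)
  have int2: "integrable M (\<lambda>x. v x * w x)" if "v \<in> H j" "w \<in> H k" for v w j k
  proof (rule integrable_bounded_mult)
    show "v \<in> borel_measurable M" "AE x in M. \<bar>v x\<bar> \<le> K"
      using that meas bdd by (auto simp: H_def)
    show "integrable M w"
      using that meas bdd by (intro integrable_const_bound[of _ K]) (auto simp: H_def)
  qed
  have q_nonneg: "0 \<le> q w" for w unfolding q_def by simp
  have bdd_below: "bdd_below (q ` H k)" for k
    using q_nonneg by (intro bdd_belowI[of _ 0]) auto
  have d_le: "d k \<le> q w" if "w \<in> H k" for w k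
    unfolding d_def using bdd_below that by (intro cInf_lower) auto
  have d_mono: "d j \<le> d k" if "j \<le> k" for j k
    unfolding d_def
  proof (rule cInf_superset_mono)
    show "q ` H k \<noteq> {}" using u_H by auto
    show "q ` H k \<subseteq> q ` H j" using midpoint_hull_antimono[OF _ that] by (auto simp: H_def)
  qed (rule bdd_below)
  have d_upper: "d k \<le> K\<^sup>2 * measure M (space M)" for k
  proof -
    have "(u k x)\<^sup>2 \<le> K\<^sup>2" for x
      using u(2)[of k x] power_mono[of "\<bar>u k x\<bar>" K 2] by simp
    then have "q (u k) \<le> (\<integral>x. K\<^sup>2 \<partial>M)"
      unfolding q_def using int2[OF u_H u_H, of k k]
      by (intro integral_mono) (auto simp: power2_eq_square)
    then show ?thesis using d_le[OF u_H, of k] by (simp add: mult.commute)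
  qed
  have "convergent d"
    using d_upper d_mono
    by (intro Bseq_mono_convergent incseq_bounded) (auto simp: incseq_def)
  then have "Cauchy d" by (rule convergent_Cauchy)
  have "\<exists>w. w \<in> H k \<and> q w < d k + 1 / real (Suc k)" for k
  proof -
    have "Inf (q ` H k) < d k + 1 / real (Suc k)" by (simp add: d_def)
    then have "\<exists>y\<in>q ` H k. y < d k + 1 / real (Suc k)"
      using u_H bdd_below by (subst (asm) cInf_less_iff) auto
    then show ?thesis by auto
  qed
  then obtain w where w: "\<And>k. w k \<in> H k" "\<And>k. q (w k) < d k + 1 / real (Suc k)"
    by metis
  have w_meas: "w k \<in> borel_measurable M" and w_bdd: "\<bar>w k x\<bar> \<le> K" for k x
    using w(1)[of k] meas bdd by (auto simp: H_def)
  have w_int: "integrable M (w k)" for k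
    using w_meas w_bdd by (intro integrable_const_bound[of _ K]) auto
  have L2: "\<exists>N. \<forall>i\<ge>N. \<forall>j\<ge>N. (\<integral>x. (w i x - w j x)\<^sup>2 \<partial>M) < e" if e: "e > 0" for e
  proof -
    obtain N1 where N1: "\<And>i j. i \<ge> N1 \<Longrightarrow> j \<ge> N1 \<Longrightarrow> norm (d i - d j) < e / 8"
      using CauchyD[OF \<open>Cauchy d\<close>, of "e / 8"] e by auto
    obtain N2 where N2: "1 / real (Suc N2) < e / 8"
      using reals_Archimedean[of "e / 8"] e by (auto simp: inverse_eq_divide)
    define N where "N = max N1 N2"
    have small: "q (w i) < d N + e / 4" if "i \<ge> N" for i
    proof -
      have "1 / real (Suc i) \<le> 1 / real (Suc N2)"
        using that by (intro divide_left_mono) (auto simp: N_def)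
      moreover have "norm (d i - d N) < e / 8"
        using that by (intro N1) (auto simp: N_def)
      ultimately show ?thesis
        using w(2)[of i] N2 unfolding real_norm_def abs_less_iff by linarith
    qed
    have "(\<integral>x. (w i x - w j x)\<^sup>2 \<partial>M) < e" if ij: "i \<ge> N" "j \<ge> N" for i j
    proof -
      let ?m = "\<lambda>x. (w i x + w j x) / 2"
      have "w i \<in> H N" "w j \<in> H N"
        using midpoint_hull_antimono[OF w(1)[unfolded H_def]] ij by (auto simp: H_def)
      then have m: "?m \<in> H N"
        by (simp add: H_def midpoint_hull.midpoint)
      have "(\<integral>x. (w i x - w j x)\<^sup>2 \<partial>M) = (\<integral>x. 2 * (w i x)\<^sup>2 + 2 * (w j x)\<^sup>2 - 4 * (?m x)\<^sup>2 \<partial>M)"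
        by (intro Bochner_Integration.integral_cong) (auto simp: power2_eq_square field_simps)
      also have "\<dots> = 2 * q (w i) + 2 * q (w j) - 4 * q ?m"
      proof -
        have "integrable M (\<lambda>x. (v x)\<^sup>2)" if "v \<in> H k" for v k
          using int2[OF that that] by (simp add: power2_eq_square)
        note sq = this[OF w(1)] this[OF m]
        have "(\<integral>x. 2 * a x + 2 * b x - 4 * c x \<partial>M) =
            2 * (\<integral>x. a x \<partial>M) + 2 * (\<integral>x. b x \<partial>M) - 4 * (\<integral>x. c x \<partial>M)"
          if "integrable M a" "integrable M b" "integrable M c" for a b c :: "'a \<Rightarrow> real"
          using that by simp
        from this[OF sq(1,1,2)] show ?thesis unfolding q_def .
      qed
      also have "\<dots> < e"
        using small[OF ij(1)] small[OF ij(2)] d_le[OF m] by simp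
      finally show ?thesis .
    qed
    then show ?thesis by blast
  qed
  have L1: "\<exists>N. \<forall>i\<ge>N. \<forall>j\<ge>N. (\<integral>x. norm (w i x - w j x) \<partial>M) < e" if e: "e > 0" for e
  proof -
    define t where "t = e / (2 * (measure M (space M) + 1))"
    have pos: "measure M (space M) + 1 > 0"
      using measure_nonneg[of M "space M"] by linarith
    then have t: "t > 0" using e by (simp add: t_def)
    have te: "t * measure M (space M) < e / 2"
      using pos e by (simp add: t_def field_simps)
    obtain N where N: "\<And>i j. i \<ge> N \<Longrightarrow> j \<ge> N \<Longrightarrow> (\<integral>x. (w i x - w j x)\<^sup>2 \<partial>M) < t * (e / 2)"
      using L2[of "t * (e / 2)"] t e by auto
    have "(\<integral>x. norm (w i x - w j x) \<partial>M) < e" if ij: "i \<ge> N" "j \<ge> N" for i j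
    proof -
      have i2: "integrable M (\<lambda>x. (w i x - w j x)\<^sup>2)"
      proof -
        have "integrable M (\<lambda>x. w i x * w i x - 2 * (w i x * w j x) + w j x * w j x)"
          using int2[OF w(1) w(1)] by simp
        then show ?thesis by (simp add: power2_eq_square algebra_simps)
      qed
      have "\<bar>h\<bar> \<le> t + h\<^sup>2 / t" for h :: real
      proof (cases "\<bar>h\<bar> \<le> t")
        case True
        then show ?thesis using t by (simp add: add_increasing2)
      next
        case False
        then have "\<bar>h\<bar> * t \<le> \<bar>h\<bar> * \<bar>h\<bar>" by (intro mult_left_mono) auto
        then have "\<bar>h\<bar> \<le> h\<^sup>2 / t" using t by (simp add: field_simps power2_eq_square)
        then show ?thesis using t by simp
      qed
      then have "(\<integral>x. norm (w i x - w j x) \<partial>M) \<le> (\<integral>x. t + (w i x - w j x)\<^sup>2 / t \<partial>M)"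
        using w_int i2 by (intro integral_mono) auto
      also have "\<dots> = t * measure M (space M) + (\<integral>x. (w i x - w j x)\<^sup>2 \<partial>M) / t"
        using i2 by simp
      also have "(\<integral>x. (w i x - w j x)\<^sup>2 \<partial>M) / t < e / 2"
        using N[OF ij] t by (simp add: field_simps)
      finally show ?thesis using te by simp
    qed
    then show ?thesis by blast
  qed
  obtain r where r: "strict_mono r" "AE x in M. Cauchy (\<lambda>i. w (r i) x)"
    using cauchy_L1_AE_cauchy_subseq[OF w_int L1] by blast
  \<comment> \<open>Truncation bounds the limit also where the sequence diverges.\<close>
  define G where "G x = max (- K) (min K (lim (\<lambda>i. w (r i) x)))" for x
  have conv: "AE x in M. (\<lambda>i. w (r i) x) \<longlonglongrightarrow> G x"
    using r(2)
  proof eventually_elim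
    case (elim x)
    then have lim: "(\<lambda>i. w (r i) x) \<longlonglongrightarrow> lim (\<lambda>i. w (r i) x)"
      by (simp add: Cauchy_convergent convergent_LIMSEQ_iff[symmetric])
    have "- K \<le> w (r i) x" "w (r i) x \<le> K" for i
      using w_bdd[of "r i" x] by (auto simp: abs_le_iff)
    then have "- K \<le> lim (\<lambda>i. w (r i) x)" "lim (\<lambda>i. w (r i) x) \<le> K"
      using LIMSEQ_le_const[OF lim] LIMSEQ_le_const2[OF lim] by auto
    with lim show ?case by (simp add: G_def)
  qed
  have G_meas: "G \<in> borel_measurable M"
    unfolding G_def using w_meas
    by (intro borel_measurable_max borel_measurable_min borel_measurable_lim_metric) auto
  have G_bdd: "\<bar>G x\<bar> \<le> K" for x
    using K by (auto simp: G_def abs_le_iff)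
  have "(\<integral>x. G x * \<phi> x \<partial>M) = l"
    if \<phi>: "integrable M \<phi>" and l: "(\<lambda>k. \<integral>x. u k x * \<phi> x \<partial>M) \<longlonglongrightarrow> l" for \<phi> l
  proof -
    have "(\<lambda>k. \<integral>x. w (r k) x * \<phi> x \<partial>M) \<longlonglongrightarrow> (\<integral>x. G x * \<phi> x \<partial>M)"
    proof (rule integral_dominated_convergence)
      show "integrable M (\<lambda>x. K * \<bar>\<phi> x\<bar>)" using \<phi> by simp
      show "(\<lambda>x. G x * \<phi> x) \<in> borel_measurable M" using G_meas \<phi> by auto
      show "(\<lambda>x. w (r k) x * \<phi> x) \<in> borel_measurable M" for k using w_meas \<phi> by auto
      show "AE x in M. (\<lambda>k. w (r k) x * \<phi> x) \<longlonglongrightarrow> G x * \<phi> x"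
        using conv by eventually_elim (intro tendsto_intros)
      show "AE x in M. norm (w (r k) x * \<phi> x) \<le> K * \<bar>\<phi> x\<bar>" for k
        using w_bdd by (intro AE_I2) (simp add: abs_mult mult_right_mono)
    qed
    moreover have "(\<lambda>k. \<integral>x. w (r k) x * \<phi> x \<partial>M) \<longlonglongrightarrow> l"
    proof (rule LIMSEQ_I)
      fix e :: real assume e: "e > 0"
      obtain N where N: "\<And>i. i \<ge> N \<Longrightarrow> norm ((\<integral>x. u i x * \<phi> x \<partial>M) - l) < e / 2"
        using LIMSEQ_D[OF l, of "e / 2"] e by auto
      have "norm ((\<integral>x. w (r k) x * \<phi> x \<partial>M) - l) < e" if "k \<ge> N" for k
      proof -
        have "r k \<ge> N" using that seq_suble[OF r(1), of k] by linarith
        then have "w (r k) \<in> midpoint_hull u N"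
          using w(1)[of "r k"] midpoint_hull_antimono by (auto simp: H_def)
        then have "\<bar>(\<integral>x. w (r k) x * \<phi> x \<partial>M) - l\<bar> \<le> e / 2"
          by (rule midpoint_hull_integral_close[OF _ u \<phi>]) (use N in \<open>simp add: less_imp_le\<close>)
        then show ?thesis using e by simp
      qed
      then show "\<exists>N. \<forall>k\<ge>N. norm ((\<integral>x. w (r k) x * \<phi> x \<partial>M) - l) < e" by blast
    qed
    ultimately show ?thesis by (rule LIMSEQ_unique)
  qed
  then show thesis using that G_meas G_bdd by simp
qed

section \<open>Difference quotients and weak derivatives\<close>

lemma continuous_mult_test_function_integrable:
  assumes "test_function \<Omega> \<phi>" "continuous_on UNIV (f :: 'a::euclidean_space \<Rightarrow> real)"
  shows "integrable lborel (\<lambda>x. f x * \<phi> x)"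
proof -
  let ?K = "closure {x. \<phi> x \<noteq> 0}"
  have "compact ?K" using assms(1) by (simp add: test_function_def)
  have "integrable lborel (\<lambda>x. indicator ?K x *\<^sub>R (f x * \<phi> x))"
    by (rule borel_integrable_compact[OF \<open>compact ?K\<close>])
      (intro continuous_intros test_function_continuous[OF assms(1)] continuous_on_subset[OF assms(2)] subset_UNIV)
  moreover have "(\<lambda>x. indicator ?K x *\<^sub>R (f x * \<phi> x)) = (\<lambda>x. f x * \<phi> x)"
    using closure_subset[of "{x. \<phi> x \<noteq> 0}"] by (auto simp: fun_eq_iff indicator_def)
  ultimately show ?thesis by simp
qed

lemma continuous_integral_lebesgue_on_test_function:
  assumes "open \<Omega>" "test_function \<Omega> \<phi>" "continuous_on UNIV (f :: 'a::euclidean_space \<Rightarrow> real)"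
  shows "(\<integral>x. f x * \<phi> x \<partial>lebesgue_on \<Omega>) = (\<integral>x. f x * \<phi> x \<partial>lborel)"
  unfolding integral_lebesgue_on_test_function[OF assms(1,2)]
  using borel_measurable_integrable[OF continuous_mult_test_function_integrable[OF assms(2,3)]]
  by (intro integral_completion) simp

lemma lborel_integral_translation:
  fixes f :: "'a::euclidean_space \<Rightarrow> real"
  assumes "f \<in> borel_measurable borel"
  shows "(\<integral>x. f (c + x) \<partial>lborel) = (\<integral>x. f x \<partial>lborel)"
proof -
  have "(\<integral>x. f x \<partial>lborel) = (\<integral>x. f x \<partial>distr lborel borel ((+) c))"
    by (simp add: lborel_distr_plus)
  also have "\<dots> = (\<integral>x. f (c + x) \<partial>lborel)"
    using assms by (intro integral_distr) auto
  finally show ?thesis by simp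
qed

lemma test_function_line_derivative:
  assumes "test_function \<Omega> \<phi>"
  shows "((\<lambda>s. \<phi> (x + s *\<^sub>R v)) has_field_derivative frechet_derivative \<phi> (at (x + s *\<^sub>R v)) v) (at s)"
proof -
  let ?D = "frechet_derivative \<phi> (at (x + s *\<^sub>R v))"
  have D: "(\<phi> has_derivative ?D) (at (x + s *\<^sub>R v))"
    by (rule test_function_differentiable[OF assms])
  have l: "((\<lambda>s. x + s *\<^sub>R v) has_derivative (\<lambda>h. h *\<^sub>R v)) (at s)"
    by (auto intro!: derivative_eq_intros)
  have "((\<lambda>s. \<phi> (x + s *\<^sub>R v)) has_derivative (\<lambda>h. ?D (h *\<^sub>R v))) (at s)"
    by (rule has_derivative_compose[OF l D])
  moreover have "?D (h *\<^sub>R v) = ?D v * h" for h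
    using linear_scale[OF has_derivative_linear[OF D]] by simp
  ultimately show ?thesis
    by (simp add: has_field_derivative_def)
qed

lemma test_function_difference_bound:
  assumes "test_function \<Omega> \<phi>" "v \<in> Basis"
  obtains B where "\<And>x s. \<bar>\<phi> (x + s *\<^sub>R v) - \<phi> x\<bar> \<le> B * \<bar>s\<bar>" "B > 0"
proof -
  obtain B where B: "\<And>x. \<bar>frechet_derivative \<phi> (at x) v\<bar> \<le> B" "B > 0"
    using test_function_bounded[OF test_function_partial[OF assms]] by metis
  have "\<bar>\<phi> (x + s *\<^sub>R v) - \<phi> x\<bar> \<le> B * \<bar>s\<bar>" for x s
    using field_differentiable_bound[of UNIV "\<lambda>s. \<phi> (x + s *\<^sub>R v)" _ B s 0,
        OF convex_UNIV test_function_line_derivative[OF assms(1)]] B by simp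
  with that B show thesis by blast
qed

lemma difference_quotient_tendsto:
  assumes "test_function \<Omega> \<phi>"
  shows "(\<lambda>k. (\<phi> (x - inverse (real (Suc k)) *\<^sub>R v) - \<phi> x) / inverse (real (Suc k)))
    \<longlonglongrightarrow> - frechet_derivative \<phi> (at x) v"
proof -
  have "((\<lambda>s. \<phi> (x + s *\<^sub>R v)) has_field_derivative frechet_derivative \<phi> (at x) v) (at 0)"
    using test_function_line_derivative[OF assms, of x v 0] by simp
  then have lim: "((\<lambda>h. (\<phi> (x + h *\<^sub>R v) - \<phi> x) / h) \<longlongrightarrow> frechet_derivative \<phi> (at x) v) (at 0)"
    by (simp add: DERIV_def)
  have "filterlim (\<lambda>k. - inverse (real (Suc k))) (at 0) sequentially"
    using tendsto_minus[OF LIMSEQ_inverse_real_of_nat] by (auto simp: filterlim_at)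
  from tendsto_minus[OF filterlim_compose[OF lim this]] show ?thesis by simp
qed

abbreviation difference_quotient :: "('a::euclidean_space \<Rightarrow> real) \<Rightarrow> 'a \<Rightarrow> nat \<Rightarrow> 'a \<Rightarrow> real" where
  "difference_quotient f v k x \<equiv>
     (f (x + inverse (real (Suc k)) *\<^sub>R v) - f x) / inverse (real (Suc k))"

text \<open>Discrete integration by parts: a translation moves the difference quotient to \<open>\<phi>\<close>.\<close>

lemma difference_quotient_integral_tendsto:
  fixes f :: "'a::euclidean_space \<Rightarrow> real"
  assumes f: "continuous_on UNIV f" and \<phi>: "test_function \<Omega> \<phi>" and v: "v \<in> Basis"
  shows "(\<lambda>k. \<integral>x. difference_quotient f v k x * \<phi> x \<partial>lborel)
    \<longlonglongrightarrow> - (\<integral>x. f x * frechet_derivative \<phi> (at x) v \<partial>lborel)"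
proof -
  let ?t = "\<lambda>k. inverse (real (Suc k))"
  let ?q = "\<lambda>k x. (\<phi> (x - ?t k *\<^sub>R v) - \<phi> x) / ?t k"
  have f_meas: "f \<in> borel_measurable borel"
    using f by (rule borel_measurable_continuous_onI)
  have f_shift: "continuous_on UNIV (\<lambda>x. f (x + c))" for c
    by (rule continuous_on_compose2[OF f]) (auto intro!: continuous_intros)
  have \<phi>_meas: "\<phi> \<in> borel_measurable borel" using \<phi> by (rule test_function_measurable)
  have \<phi>_shift_meas: "(\<lambda>x. \<phi> (x - c)) \<in> borel_measurable borel" for c
    using \<phi>_meas by measurable
  have int1: "integrable lborel (\<lambda>x. f (x + c) * \<phi> x)" for c
    by (rule continuous_mult_test_function_integrable[OF \<phi> f_shift])
  have int0: "integrable lborel (\<lambda>x. f x * \<phi> x)"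
    by (rule continuous_mult_test_function_integrable[OF \<phi> f])
  have int2: "integrable lborel (\<lambda>x. f x * \<phi> (x - c))" for c
  proof -
    have "integrable (distr lborel borel ((+) c)) (\<lambda>x. f x * \<phi> (x - c))
        \<longleftrightarrow> integrable lborel (\<lambda>x. f (c + x) * \<phi> (c + x - c))"
      by (rule integrable_distr_eq)
        (use f_meas \<phi>_shift_meas in \<open>auto intro!: borel_measurable_times\<close>)
    then show ?thesis
      using int1[of c] by (simp add: lborel_distr_plus add.commute)
  qed
  have shift: "(\<integral>x. f (x + c) * \<phi> x \<partial>lborel) = (\<integral>x. f x * \<phi> (x - c) \<partial>lborel)" for c
    using lborel_integral_translation[of "\<lambda>x. f x * \<phi> (x - c)" c] f_meas \<phi>_shift_meas
    by (simp add: add.commute)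
  have eq: "(\<integral>x. difference_quotient f v k x * \<phi> x \<partial>lborel) = (\<integral>x. f x * ?q k x \<partial>lborel)" for k
  proof -
    have "(\<integral>x. difference_quotient f v k x * \<phi> x \<partial>lborel)
        = (\<integral>x. (f (x + ?t k *\<^sub>R v) * \<phi> x - f x * \<phi> x) / ?t k \<partial>lborel)"
      by (intro Bochner_Integration.integral_cong refl) (simp add: algebra_simps)
    also have "\<dots> = ((\<integral>x. f (x + ?t k *\<^sub>R v) * \<phi> x \<partial>lborel) - (\<integral>x. f x * \<phi> x \<partial>lborel)) / ?t k"
      unfolding integral_divide_zero Bochner_Integration.integral_diff[OF int1 int0] ..
    also have "\<dots> = ((\<integral>x. f x * \<phi> (x - ?t k *\<^sub>R v) \<partial>lborel) - (\<integral>x. f x * \<phi> x \<partial>lborel)) / ?t k"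
      unfolding shift ..
    also have "\<dots> = (\<integral>x. (f x * \<phi> (x - ?t k *\<^sub>R v) - f x * \<phi> x) / ?t k \<partial>lborel)"
      unfolding integral_divide_zero Bochner_Integration.integral_diff[OF int2 int0] ..
    also have "\<dots> = (\<integral>x. f x * ?q k x \<partial>lborel)"
      by (intro Bochner_Integration.integral_cong refl) (simp add: algebra_simps)
    finally show ?thesis .
  qed
  obtain B where B: "\<And>x s. \<bar>\<phi> (x + s *\<^sub>R v) - \<phi> x\<bar> \<le> B * \<bar>s\<bar>" "B > 0"
    using test_function_difference_bound[OF \<phi> v] by metis
  have "bounded (closure {x. \<phi> x \<noteq> 0})"
    using \<phi> by (auto simp: test_function_def)
  then obtain r where r: "\<And>x. \<phi> x \<noteq> 0 \<Longrightarrow> norm x \<le> r"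
    using closure_subset[of "{x. \<phi> x \<noteq> 0}"] by (auto simp: bounded_iff)
  let ?C = "cball (0::'a) (r + 1)"
  have q_zero: "?q k x = 0" if "x \<notin> ?C" for k x
  proof -
    have "norm (?t k *\<^sub>R v) \<le> 1"
      using v by (simp add: inverse_le_1_iff)
    moreover have "norm x > r + 1" using that by simp
    ultimately have "norm (x - ?t k *\<^sub>R v) > r" "norm x > r"
      using norm_triangle_ineq2[of x "?t k *\<^sub>R v"] by linarith+
    then have "\<phi> (x - ?t k *\<^sub>R v) = 0" "\<phi> x = 0"
      using r by (meson not_less)+
    then show ?thesis by simp
  qed
  have q_bound: "\<bar>?q k x\<bar> \<le> B" for k x
  proof -
    have "\<bar>\<phi> (x - ?t k *\<^sub>R v) - \<phi> x\<bar> \<le> B * ?t k"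
      using B(1)[of x "- ?t k"] by simp
    moreover have "?t k > 0" by simp
    ultimately show ?thesis
      by (simp only: abs_divide abs_of_pos pos_divide_le_eq)
  qed
  have "(\<lambda>k. \<integral>x. f x * ?q k x \<partial>lborel) \<longlonglongrightarrow> (\<integral>x. f x * (- frechet_derivative \<phi> (at x) v) \<partial>lborel)"
  proof (rule integral_dominated_convergence)
    have "integrable lborel (\<lambda>x. indicator ?C x *\<^sub>R (\<bar>f x\<bar> * B))"
      by (rule borel_integrable_compact)
        (auto intro!: continuous_intros continuous_on_subset[OF f])
    then show "integrable lborel (\<lambda>x. indicator ?C x * (\<bar>f x\<bar> * B))" by simp
    show "AE x in lborel. (\<lambda>k. f x * ?q k x) \<longlonglongrightarrow> f x * (- frechet_derivative \<phi> (at x) v)"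
      by (intro AE_I2 tendsto_mult tendsto_const difference_quotient_tendsto[OF \<phi>])
    have "norm (f x * ?q k x) \<le> indicator ?C x * (\<bar>f x\<bar> * B)" for k x
    proof (cases "x \<in> ?C")
      case True
      then show ?thesis
        using mult_left_mono[OF q_bound[of x k], of "\<bar>f x\<bar>"] by (simp add: abs_mult)
    next
      case False
      then show ?thesis using q_zero[OF False, of k] by simp
    qed
    then show "AE x in lborel. norm (f x * ?q k x) \<le> indicator ?C x * (\<bar>f x\<bar> * B)" for k
      by simp
    show "(\<lambda>x. f x * (- frechet_derivative \<phi> (at x) v)) \<in> borel_measurable lborel"
      using f_meas test_function_measurable[OF test_function_partial[OF \<phi> v]] by simp
    show "(\<lambda>x. f x * ?q k x) \<in> borel_measurable lborel" for k
      using f_meas \<phi>_meas \<phi>_shift_meas by simp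
  qed
  then show ?thesis unfolding eq by simp
qed

lemma difference_quotient_bound:
  fixes f :: "'a::euclidean_space \<Rightarrow> real"
  assumes "\<And>x y. \<bar>f x - f y\<bar> \<le> K * dist x y" "v \<in> Basis"
  shows "\<bar>difference_quotient f v k x\<bar> \<le> K"
proof -
  have "\<bar>f (x + inverse (real (Suc k)) *\<^sub>R v) - f x\<bar> \<le> K * inverse (real (Suc k))"
    using assms(1)[of "x + inverse (real (Suc k)) *\<^sub>R v" x] assms(2) by (simp add: dist_norm)
  moreover have "inverse (real (Suc k)) > 0" by simp
  ultimately show ?thesis
    by (simp only: abs_divide abs_of_pos pos_divide_le_eq)
qed

lemma lipschitz_imp_continuous:
  fixes f :: "'a::metric_space \<Rightarrow> real"
  assumes "\<And>x y. \<bar>f x - f y\<bar> \<le> K * dist x y"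
  shows "continuous_on A f"
proof -
  have "\<bar>f x - f y\<bar> \<le> \<bar>K\<bar> * dist x y" for x y
    using assms[of x y] mult_right_mono[OF abs_ge_self[of K] zero_le_dist[of x y]] by linarith
  then have "\<bar>K\<bar>-lipschitz_on A f"
    by (intro lipschitz_onI) (auto simp: dist_real_def)
  then show ?thesis by (rule lipschitz_on_continuous_on)
qed

lemma lipschitz_difference_quotient_continuous:
  fixes f :: "'a::euclidean_space \<Rightarrow> real"
  assumes "\<And>x y. \<bar>f x - f y\<bar> \<le> K * dist x y"
  shows "continuous_on UNIV (difference_quotient f v k)"
proof -
  have f: "continuous_on UNIV f" by (rule lipschitz_imp_continuous[OF assms])
  have "continuous_on UNIV (\<lambda>x. f (x + c))" for c
    by (rule continuous_on_compose2[OF f]) (auto intro!: continuous_intros)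
  then show ?thesis using f by (intro continuous_intros) auto
qed

lemma continuous_measurable_lebesgue_on:
  "continuous_on UNIV (f :: 'a::euclidean_space \<Rightarrow> real) \<Longrightarrow> f \<in> borel_measurable (lebesgue_on \<Omega>)"
  by (intro measurable_restrict_space1 measurable_completion)
    (simp add: borel_measurable_continuous_onI)

text \<open>
  Lipschitz functions have bounded weak derivatives: the difference quotients are bounded by
  the Lipschitz constant, and any weak limit of theirs is a weak derivative.
\<close>

lemma lipschitz_weak_partial_derivative:
  fixes f :: "'a::euclidean_space \<Rightarrow> real"
  assumes \<Omega>: "open \<Omega>" "bounded \<Omega>" and f: "\<And>x y. \<bar>f x - f y\<bar> \<le> K * dist x y" and v: "v \<in> Basis"
  obtains G where "G \<in> borel_measurable (lebesgue_on \<Omega>)" "\<And>x. \<bar>G x\<bar> \<le> K"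
    "\<And>\<phi>. test_function \<Omega> \<phi> \<Longrightarrow> (\<integral>x. G x * \<phi> x \<partial>lebesgue_on \<Omega>) =
       - (\<integral>x. f x * frechet_derivative \<phi> (at x) v \<partial>lebesgue_on \<Omega>)"
proof -
  have "\<Omega> \<in> lmeasurable" using \<Omega> by (simp add: lmeasurable_open)
  then interpret finite_measure "lebesgue_on \<Omega>" by (rule finite_measure_lebesgue_on)
  have cont: "continuous_on UNIV f" by (rule lipschitz_imp_continuous[OF f])
  have dq_cont: "continuous_on UNIV (difference_quotient f v k)" for k
    by (rule lipschitz_difference_quotient_continuous[OF f])
  obtain G where G: "G \<in> borel_measurable (lebesgue_on \<Omega>)" "\<And>x. \<bar>G x\<bar> \<le> K"
    "\<And>\<phi> l. integrable (lebesgue_on \<Omega>) \<phi> \<Longrightarrow>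
      (\<lambda>k. \<integral>x. difference_quotient f v k x * \<phi> x \<partial>lebesgue_on \<Omega>) \<longlonglongrightarrow> l \<Longrightarrow>
      (\<integral>x. G x * \<phi> x \<partial>lebesgue_on \<Omega>) = l"
    by (rule bounded_sequence_weak_limit[OF continuous_measurable_lebesgue_on[OF dq_cont]
        difference_quotient_bound[OF f v]]) (rule that)
  have "(\<integral>x. G x * \<phi> x \<partial>lebesgue_on \<Omega>) =
       - (\<integral>x. f x * frechet_derivative \<phi> (at x) v \<partial>lebesgue_on \<Omega>)" if \<phi>: "test_function \<Omega> \<phi>" for \<phi>
  proof (rule G(3))
    have "integrable lebesgue \<phi>"
      using test_function_integrable[OF \<phi>] integrable_completion[of \<phi> lborel]
        test_function_measurable[OF \<phi>] by simp
    then show "integrable (lebesgue_on \<Omega>) \<phi>"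
      using \<Omega>(1) integrable_mult_indicator[of \<Omega> lebesgue \<phi>]
      by (simp add: integrable_restrict_space)
    show "(\<lambda>k. \<integral>x. difference_quotient f v k x * \<phi> x \<partial>lebesgue_on \<Omega>) \<longlonglongrightarrow>
        - (\<integral>x. f x * frechet_derivative \<phi> (at x) v \<partial>lebesgue_on \<Omega>)"
      unfolding continuous_integral_lebesgue_on_test_function[OF \<Omega>(1) \<phi> dq_cont]
        continuous_integral_lebesgue_on_test_function[OF \<Omega>(1) test_function_partial[OF \<phi> v] cont]
      by (rule difference_quotient_integral_tendsto[OF cont \<phi> v])
  qed
  then show thesis by (rule that[OF G(1,2)])
qed

text \<open>
  The limit of the difference quotients matters in \<open>\<Omega>\<close> only, since \<open>\<phi>\<close> vanishes outside; the
  Lipschitz constant supplies the dominating function \<open>K |\<phi>|\<close>.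
\<close>

lemma lipschitz_classical_partial_derivative:
  fixes f :: "'a::euclidean_space \<Rightarrow> real"
  assumes \<Omega>: "open \<Omega>" and f: "\<And>x y. \<bar>f x - f y\<bar> \<le> K * dist x y" and v: "v \<in> Basis"
    and h: "continuous_on UNIV h" "\<And>x. x \<in> \<Omega> \<Longrightarrow> (\<lambda>k. difference_quotient f v k x) \<longlonglongrightarrow> h x"
    and \<phi>: "test_function \<Omega> \<phi>"
  shows "(\<integral>x. h x * \<phi> x \<partial>lebesgue_on \<Omega>) =
       - (\<integral>x. f x * frechet_derivative \<phi> (at x) v \<partial>lebesgue_on \<Omega>)"
proof -
  have cont: "continuous_on UNIV f" by (rule lipschitz_imp_continuous[OF f])
  have dq_cont: "continuous_on UNIV (difference_quotient f v k)" for k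
    by (rule lipschitz_difference_quotient_continuous[OF f])
  have "(\<lambda>k. \<integral>x. difference_quotient f v k x * \<phi> x \<partial>lborel) \<longlonglongrightarrow> (\<integral>x. h x * \<phi> x \<partial>lborel)"
  proof (rule integral_dominated_convergence)
    show "integrable lborel (\<lambda>x. K * \<bar>\<phi> x\<bar>)" using test_function_integrable[OF \<phi>] by simp
    show "(\<lambda>x. h x * \<phi> x) \<in> borel_measurable lborel"
      using borel_measurable_integrable[OF continuous_mult_test_function_integrable[OF \<phi> h(1)]] .
    show "(\<lambda>x. difference_quotient f v k x * \<phi> x) \<in> borel_measurable lborel" for k
      using borel_measurable_integrable[OF continuous_mult_test_function_integrable[OF \<phi> dq_cont]] .
    show "AE x in lborel. norm (difference_quotient f v k x * \<phi> x) \<le> K * \<bar>\<phi> x\<bar>" for k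
      by (intro AE_I2)
        (simp only: real_norm_def abs_mult mult_right_mono[OF difference_quotient_bound[OF f v] abs_ge_zero])
    have "(\<lambda>k. difference_quotient f v k x * \<phi> x) \<longlonglongrightarrow> h x * \<phi> x" for x
    proof (cases "x \<in> \<Omega>")
      case True
      then show ?thesis by (intro tendsto_mult h(2) tendsto_const)
    next
      case False
      then show ?thesis using test_function_zero[OF \<phi> False] by simp
    qed
    then show "AE x in lborel. (\<lambda>k. difference_quotient f v k x * \<phi> x) \<longlonglongrightarrow> h x * \<phi> x"
      by simp
  qed
  from LIMSEQ_unique[OF this difference_quotient_integral_tendsto[OF cont \<phi> v]]
  show ?thesis
    unfolding continuous_integral_lebesgue_on_test_function[OF \<Omega> \<phi> h(1)]
        continuous_integral_lebesgue_on_test_function[OF \<Omega> test_function_partial[OF \<phi> v] cont] .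
qed

section \<open>Bounded Sobolev functions and weak* convergence\<close>

lemma lebesgue_on_measurable_AE:
  fixes f g :: "'a::euclidean_space \<Rightarrow> real"
  assumes \<Omega>: "\<Omega> \<in> sets lebesgue" and g: "g \<in> borel_measurable (lebesgue_on \<Omega>)"
    and eq: "AE x in lebesgue_on \<Omega>. f x = g x"
  shows "f \<in> borel_measurable (lebesgue_on \<Omega>)"
proof -
  have "AE x in lebesgue. x \<in> \<Omega> \<longrightarrow> f x = g x"
    using eq \<Omega> by (subst (asm) AE_restrict_space_iff) auto
  then obtain N where N: "{x \<in> space lebesgue. \<not> (x \<in> \<Omega> \<longrightarrow> f x = g x)} \<subseteq> N"
      "emeasure lebesgue N = 0" "N \<in> sets lebesgue"
    by (rule AE_E)
  then have null: "N \<in> null_sets lebesgue" by auto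
  show ?thesis
    unfolding borel_measurable_iff_le
  proof
    fix a
    have split: "{x \<in> \<Omega>. f x \<le> a} = ({x \<in> \<Omega>. g x \<le> a} - N) \<union> (N \<inter> {x \<in> \<Omega>. f x \<le> a})"
      using N(1) by auto
    have g_set: "{x \<in> \<Omega>. g x \<le> a} \<in> sets lebesgue"
    proof -
      have "{x \<in> space (lebesgue_on \<Omega>). g x \<le> a} \<in> sets (lebesgue_on \<Omega>)"
        using g unfolding borel_measurable_iff_le by simp
      then show ?thesis
        using \<Omega> by (simp add: sets_restrict_space_iff space_restrict_space)
    qed
    have N_set: "N \<inter> {x \<in> \<Omega>. f x \<le> a} \<in> sets lebesgue"
      using null_sets_completion_subset[OF _ null, of "N \<inter> {x \<in> \<Omega>. f x \<le> a}"] by auto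
    have "{x \<in> \<Omega>. f x \<le> a} \<in> sets lebesgue"
      by (subst split) (intro sets.Un sets.Diff g_set N_set N(3))
    then show "{x \<in> space (lebesgue_on \<Omega>). f x \<le> a} \<in> sets (lebesgue_on \<Omega>)"
      using \<Omega> by (simp add: sets_restrict_space_iff space_restrict_space)
  qed
qed

lemma bounded_imp_locally_integrable:
  fixes f :: "'a::euclidean_space \<Rightarrow> real"
  assumes "f \<in> borel_measurable (lebesgue_on \<Omega>)" "\<And>x. \<bar>f x\<bar> \<le> C"
  shows "locally_integrable \<Omega> f"
  unfolding locally_integrable_def
proof (intro allI impI)
  fix K assume K: "compact K \<and> K \<subseteq> \<Omega>"
  then have "K \<in> lmeasurable" by (intro lmeasurable_compact) simp
  then interpret finite_measure "lebesgue_on K" by (rule finite_measure_lebesgue_on)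
  have "f \<in> borel_measurable (lebesgue_on K)"
    by (rule measurable_restrict_mono[OF assms(1)]) (use K in simp)
  then show "integrable (lebesgue_on K) f"
    using assms(2) by (intro integrable_const_bound[of _ C]) auto
qed

lemma locally_integrable_mult_test_function:
  fixes f :: "'a::euclidean_space \<Rightarrow> real"
  assumes \<Omega>: "open \<Omega>" and f: "locally_integrable \<Omega> f" and \<phi>: "test_function \<Omega> \<phi>"
  shows "integrable (lebesgue_on \<Omega>) (\<lambda>x. f x * \<phi> x)"
proof -
  let ?K = "closure {x. \<phi> x \<noteq> 0}"
  have K: "compact ?K" "?K \<subseteq> \<Omega>" using \<phi> by (auto simp: test_function_def)
  have Ks: "?K \<in> sets lebesgue" by (simp add: lebesgue_closedin)
  obtain B where B: "\<And>x. \<bar>\<phi> x\<bar> \<le> B" "B > 0"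
    by (rule test_function_bounded[OF \<phi>]) (rule that)
  have "integrable (lebesgue_on ?K) f"
    using f K by (simp add: locally_integrable_def)
  then have g: "integrable lebesgue (\<lambda>x. indicator ?K x *\<^sub>R f x)"
    using Ks by (subst (asm) integrable_restrict_space) simp_all
  have m: "\<phi> \<in> borel_measurable lebesgue"
    using test_function_measurable[OF \<phi>] by (simp add: measurable_completion)
  have i: "integrable lebesgue (\<lambda>x. (indicator ?K x *\<^sub>R f x) * \<phi> x)"
  proof (rule Bochner_Integration.integrable_bound)
    show "integrable lebesgue (\<lambda>x. B * (indicator ?K x *\<^sub>R f x))"
      using g by (rule integrable_mult_right)
    show "(\<lambda>x. (indicator ?K x *\<^sub>R f x) * \<phi> x) \<in> borel_measurable lebesgue"
      by (intro borel_measurable_times borel_measurable_integrable[OF g] m)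
    show "AE x in lebesgue. norm ((indicator ?K x *\<^sub>R f x) * \<phi> x) \<le> norm (B * (indicator ?K x *\<^sub>R f x))"
      by (intro AE_I2)
        (simp add: abs_mult mult.commute[of _ "\<bar>\<phi> _\<bar>"] abs_of_pos[OF B(2)] mult_right_mono[OF B(1)])
  qed
  have "(\<lambda>x. indicator \<Omega> x *\<^sub>R (f x * \<phi> x)) = (\<lambda>x. (indicator ?K x *\<^sub>R f x) * \<phi> x)"
    using closure_subset[of "{x. \<phi> x \<noteq> 0}"] K(2) by (auto simp: fun_eq_iff indicator_def)
  with i \<Omega> show ?thesis
    by (simp add: integrable_restrict_space)
qed

lemma weak_derivative_unique:
  fixes f :: "'a::euclidean_space \<Rightarrow> real"
  assumes \<Omega>: "open \<Omega>" and g: "has_weak_derivative \<Omega> vs f g" "has_weak_derivative \<Omega> vs f g'"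
  shows "AE x in lebesgue_on \<Omega>. g x = g' x"
proof -
  have li: "locally_integrable \<Omega> g" "locally_integrable \<Omega> g'"
    using g by (auto simp: has_weak_derivative_def)
  have "AE x in lebesgue_on \<Omega>. g x - g' x = 0"
  proof (rule vanishing_against_test_functions[OF \<Omega>])
    show "locally_integrable \<Omega> (\<lambda>x. g x - g' x)"
      using li by (simp add: locally_integrable_def)
    fix \<phi> assume \<phi>: "test_function \<Omega> \<phi>"
    have "(-1) ^ length vs * (\<integral>x. g x * \<phi> x \<partial>lebesgue_on \<Omega>)
        = (-1) ^ length vs * (\<integral>x. g' x * \<phi> x \<partial>lebesgue_on \<Omega>)"
    proof -
      have "(\<integral>x. f x * iterated_partial vs \<phi> x \<partial>lebesgue_on \<Omega>) =
          (-1) ^ length vs * (\<integral>x. h x * \<phi> x \<partial>lebesgue_on \<Omega>)"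
        if "has_weak_derivative \<Omega> vs f h" for h
        using that \<phi> by (simp add: has_weak_derivative_def)
      from this[OF g(1)] this[OF g(2)] show ?thesis by simp
    qed
    then have "(\<integral>x. g x * \<phi> x \<partial>lebesgue_on \<Omega>) = (\<integral>x. g' x * \<phi> x \<partial>lebesgue_on \<Omega>)"
      by simp
    then show "(\<integral>x. (g x - g' x) * \<phi> x \<partial>lebesgue_on \<Omega>) = 0"
      using locally_integrable_mult_test_function[OF \<Omega> li(1) \<phi>]
        locally_integrable_mult_test_function[OF \<Omega> li(2) \<phi>]
      by (simp add: left_diff_distrib)
  qed
  then show ?thesis by eventually_elim simp
qed

text \<open>
  The closed ball of radius \<open>C\<close> in the Sobolev space. The bounds are required at every point and
  not only almost everywhere, which the representatives at hand satisfy.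
\<close>

definition sobolev_ball :: "nat \<Rightarrow> real \<Rightarrow> 'a::euclidean_space set \<Rightarrow> ('a \<Rightarrow> real) set" where
  "sobolev_ball k C \<Omega> =
     {f. f \<in> borel_measurable (lebesgue_on \<Omega>) \<and> (\<forall>x. \<bar>f x\<bar> \<le> C) \<and>
        (\<forall>vs. set vs \<subseteq> Basis \<and> length vs \<le> k \<longrightarrow>
          (\<exists>g. g \<in> borel_measurable (lebesgue_on \<Omega>) \<and> (\<forall>x. \<bar>g x\<bar> \<le> C) \<and>
             has_weak_derivative \<Omega> vs f g))}"

lemma bounded_in_L_infinity:
  "f \<in> borel_measurable (lebesgue_on \<Omega>) \<Longrightarrow> (\<forall>x. \<bar>f x\<bar> \<le> C) \<Longrightarrow> f \<in> L_infinity \<Omega>"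
  by (auto simp: L_infinity_def)

lemma sobolev_ball_subset: "f \<in> sobolev_ball k C \<Omega> \<Longrightarrow> f \<in> sobolev_infinity k \<Omega>"
proof -
  assume f: "f \<in> sobolev_ball k C \<Omega>"
  have "\<exists>g\<in>L_infinity \<Omega>. has_weak_derivative \<Omega> vs f g" if vs: "set vs \<subseteq> Basis \<and> length vs \<le> k" for vs
  proof -
    obtain g where "g \<in> borel_measurable (lebesgue_on \<Omega>)" "\<forall>x. \<bar>g x\<bar> \<le> C" "has_weak_derivative \<Omega> vs f g"
      using f vs by (auto simp: sobolev_ball_def)
    then show ?thesis by (intro bexI[of _ g] bounded_in_L_infinity)
  qed
  moreover have "f \<in> L_infinity \<Omega>"
    using f by (intro bounded_in_L_infinity[of f \<Omega> C]) (simp_all add: sobolev_ball_def)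
  ultimately show ?thesis by (simp add: sobolev_infinity_def)
qed

lemma sobolev_ball_weak_derivative:
  fixes f :: "'a::euclidean_space \<Rightarrow> real"
  assumes \<Omega>: "open \<Omega>" and f: "f \<in> sobolev_ball k C \<Omega>" and vs: "set vs \<subseteq> Basis" "length vs \<le> k"
  shows "has_weak_derivative \<Omega> vs f (weak_derivative \<Omega> vs f)"
    and "weak_derivative \<Omega> vs f \<in> borel_measurable (lebesgue_on \<Omega>)"
    and "AE x in lebesgue_on \<Omega>. \<bar>weak_derivative \<Omega> vs f x\<bar> \<le> C"
proof -
  obtain g where g: "g \<in> borel_measurable (lebesgue_on \<Omega>)" "\<And>x. \<bar>g x\<bar> \<le> C"
      "has_weak_derivative \<Omega> vs f g"
    using f vs by (auto simp: sobolev_ball_def)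
  show w: "has_weak_derivative \<Omega> vs f (weak_derivative \<Omega> vs f)"
    unfolding weak_derivative_def by (rule someI[of "has_weak_derivative \<Omega> vs f", OF g(3)])
  have eq: "AE x in lebesgue_on \<Omega>. weak_derivative \<Omega> vs f x = g x"
    by (rule weak_derivative_unique[OF \<Omega> w g(3)])
  have "\<Omega> \<in> sets lebesgue" using \<Omega> by auto
  then show "weak_derivative \<Omega> vs f \<in> borel_measurable (lebesgue_on \<Omega>)"
    using g(1) eq by (rule lebesgue_on_measurable_AE)
  show "AE x in lebesgue_on \<Omega>. \<bar>weak_derivative \<Omega> vs f x\<bar> \<le> C"
    using eq by eventually_elim (simp add: g(2))
qed

text \<open>
  Uniform bounds turn pointwise convergence into weak* convergence of all derivatives: against
  test functions the derivatives can be moved over, and test functions determine weak limits of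
  bounded sequences.
\<close>

lemma sobolev_ball_weak_star_convergent:
  fixes f :: "'a::euclidean_space \<Rightarrow> real"
  assumes \<Omega>: "open \<Omega>" and f: "f \<in> sobolev_ball k C \<Omega>"
    and fj: "\<forall>\<^sub>F j in sequentially. fj j \<in> sobolev_ball k C \<Omega>"
    and lim: "\<And>x. x \<in> \<Omega> \<Longrightarrow> (\<lambda>j. fj j x) \<longlonglongrightarrow> f x"
  shows "sobolev_weak_star_convergent k \<Omega> fj f"
  unfolding sobolev_weak_star_convergent_def
proof (intro conjI allI impI)
  show "f \<in> sobolev_infinity k \<Omega>" using f by (rule sobolev_ball_subset)
  show "\<forall>\<^sub>F j in sequentially. fj j \<in> sobolev_infinity k \<Omega>"
    using fj by eventually_elim (rule sobolev_ball_subset)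
  fix vs :: "'a list" assume vs: "set vs \<subseteq> Basis \<and> length vs \<le> k"
  let ?M = "lebesgue_on \<Omega>"
  let ?D = "weak_derivative \<Omega> vs"
  have D: "has_weak_derivative \<Omega> vs h (?D h)" "?D h \<in> borel_measurable ?M"
      "AE x in ?M. \<bar>?D h x\<bar> \<le> C" if "h \<in> sobolev_ball k C \<Omega>" for h
    using sobolev_ball_weak_derivative[OF \<Omega> that] vs by auto
  have D_Linf: "?D h \<in> L_infinity \<Omega>" if "h \<in> sobolev_ball k C \<Omega>" for h
    using D(2,3)[OF that] by (auto simp: L_infinity_def)
  define w where "w j x = (if fj j \<in> sobolev_ball k C \<Omega> then ?D (fj j) x - ?D f x else 0)" for j x
  have w_meas: "w j \<in> borel_measurable ?M" for j
    using D(2)[of "fj j"] D(2)[OF f] by (cases "fj j \<in> sobolev_ball k C \<Omega>") (simp_all add: w_def[abs_def])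
  have w_bound: "AE x in ?M. \<bar>w j x\<bar> \<le> 2 * C" for j
  proof (cases "fj j \<in> sobolev_ball k C \<Omega>")
    case True
    show ?thesis
      using D(3)[OF True] D(3)[OF f] by eventually_elim (simp add: w_def True)
  next
    case False
    have "\<bar>f undefined\<bar> \<le> C" using f by (simp add: sobolev_ball_def)
    then have "0 \<le> C" by linarith
    with False show ?thesis by (simp add: w_def)
  qed
  have weak: "(\<lambda>j. \<integral>x. w j x * \<psi> x \<partial>?M) \<longlonglongrightarrow> 0" if "integrable ?M \<psi>" for \<psi>
  proof (rule bounded_weak_limit_from_test_functions[OF \<Omega> w_meas w_bound _ that])
    fix \<phi> assume \<phi>: "test_function \<Omega> \<phi>"
    let ?P = "iterated_partial vs \<phi>"
    have P: "test_function \<Omega> ?P"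
      using test_function_iterated_partial[OF \<phi>] vs by blast
    have "integrable lebesgue ?P"
      using test_function_integrable[OF P] integrable_completion[of ?P lborel]
        test_function_measurable[OF P] by simp
    then have P_int: "integrable ?M ?P"
      using \<Omega> integrable_mult_indicator[of \<Omega> lebesgue ?P] by (simp add: integrable_restrict_space)
    define fb where "fb j = (if fj j \<in> sobolev_ball k C \<Omega> then fj j else f)" for j
    have fb: "fb j \<in> sobolev_ball k C \<Omega>" for j using f by (simp add: fb_def)
    have bd: "h \<in> borel_measurable ?M" "\<And>x. \<bar>h x\<bar> \<le> C" if "h \<in> sobolev_ball k C \<Omega>" for h
      using that by (auto simp: sobolev_ball_def)
    have "(\<lambda>j. \<integral>x. fb j x * ?P x \<partial>?M) \<longlonglongrightarrow> (\<integral>x. f x * ?P x \<partial>?M)"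
    proof (rule integral_dominated_convergence)
      show "integrable ?M (\<lambda>x. C * \<bar>?P x\<bar>)" using P_int by simp
      show "(\<lambda>x. f x * ?P x) \<in> borel_measurable ?M"
        by (intro borel_measurable_times bd f borel_measurable_integrable P_int)
      show "(\<lambda>x. fb j x * ?P x) \<in> borel_measurable ?M" for j
        by (intro borel_measurable_times bd fb borel_measurable_integrable P_int)
      show "AE x in ?M. norm (fb j x * ?P x) \<le> C * \<bar>?P x\<bar>" for j
        using bd(2)[OF fb[of j]] by (intro AE_I2) (simp add: abs_mult mult_right_mono)
      have "(\<lambda>j. fb j x * ?P x) \<longlonglongrightarrow> f x * ?P x" if "x \<in> \<Omega>" for x
      proof -
        have "\<forall>\<^sub>F j in sequentially. fj j x = fb j x"
          using fj by eventually_elim (simp add: fb_def)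
        from Lim_transform_eventually[OF lim[OF that] this]
        show ?thesis by (intro tendsto_mult tendsto_const)
      qed
      then show "AE x in ?M. (\<lambda>j. fb j x * ?P x) \<longlonglongrightarrow> f x * ?P x"
        by (intro AE_I2) (simp add: space_restrict_space)
    qed
    then have "(\<lambda>j. (-1) ^ length vs * ((\<integral>x. fb j x * ?P x \<partial>?M) - (\<integral>x. f x * ?P x \<partial>?M)))
        \<longlonglongrightarrow> (-1) ^ length vs * ((\<integral>x. f x * ?P x \<partial>?M) - (\<integral>x. f x * ?P x \<partial>?M))"
      by (intro tendsto_intros)
    moreover have "(\<integral>x. w j x * \<phi> x \<partial>?M)
        = (-1) ^ length vs * ((\<integral>x. fb j x * ?P x \<partial>?M) - (\<integral>x. f x * ?P x \<partial>?M))" for j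
    proof -
      have *: "(\<integral>x. ?D h x * \<phi> x \<partial>?M) = (-1) ^ length vs * (\<integral>x. h x * ?P x \<partial>?M)"
        and i: "integrable ?M (\<lambda>x. ?D h x * \<phi> x)" if h: "h \<in> sobolev_ball k C \<Omega>" for h
      proof -
        have "(\<integral>x. h x * ?P x \<partial>?M) = (-1) ^ length vs * (\<integral>x. ?D h x * \<phi> x \<partial>?M)"
          and li: "locally_integrable \<Omega> (?D h)"
          using D(1)[OF h] \<phi> by (auto simp: has_weak_derivative_def)
        then show "(\<integral>x. ?D h x * \<phi> x \<partial>?M) = (-1) ^ length vs * (\<integral>x. h x * ?P x \<partial>?M)"
          by (simp add: mult.assoc[symmetric] power_mult_distrib[symmetric])
        show "integrable ?M (\<lambda>x. ?D h x * \<phi> x)"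
          by (rule locally_integrable_mult_test_function[OF \<Omega> li \<phi>])
      qed
      show ?thesis
      proof (cases "fj j \<in> sobolev_ball k C \<Omega>")
        case True
        then have "(\<integral>x. w j x * \<phi> x \<partial>?M) = (\<integral>x. ?D (fj j) x * \<phi> x - ?D f x * \<phi> x \<partial>?M)"
          by (simp add: w_def left_diff_distrib)
        also have "\<dots> = (\<integral>x. ?D (fj j) x * \<phi> x \<partial>?M) - (\<integral>x. ?D f x * \<phi> x \<partial>?M)"
          by (rule Bochner_Integration.integral_diff[OF i[OF True] i[OF f]])
        finally show ?thesis
          using True by (simp add: *[OF True] *[OF f] fb_def right_diff_distrib)
      qed (simp add: w_def fb_def)
    qed
    ultimately show "(\<lambda>j. \<integral>x. w j x * \<phi> x \<partial>?M) \<longlonglongrightarrow> 0" by simp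
  qed
  show "L_infinity_weak_star_convergent \<Omega> (\<lambda>j. ?D (fj j)) (?D f)"
    unfolding L_infinity_weak_star_convergent_def
  proof (intro conjI allI impI)
    show "?D f \<in> L_infinity \<Omega>" using f by (rule D_Linf)
    show "\<forall>\<^sub>F j in sequentially. ?D (fj j) \<in> L_infinity \<Omega>"
      using fj by eventually_elim (rule D_Linf)
    fix \<psi> :: "'a \<Rightarrow> real" assume \<psi>: "integrable ?M \<psi>"
    have int: "integrable ?M (\<lambda>x. ?D h x * \<psi> x)" if h: "h \<in> sobolev_ball k C \<Omega>" for h
      by (rule integrable_bounded_mult[OF D(2,3)[OF h] \<psi>])
    have "\<forall>\<^sub>F j in sequentially. (\<integral>x. w j x * \<psi> x \<partial>?M) + (\<integral>x. ?D f x * \<psi> x \<partial>?M)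
        = (\<integral>x. ?D (fj j) x * \<psi> x \<partial>?M)"
      using fj
    proof eventually_elim
      case (elim j)
      have "(\<integral>x. w j x * \<psi> x \<partial>?M) = (\<integral>x. ?D (fj j) x * \<psi> x - ?D f x * \<psi> x \<partial>?M)"
        using elim by (simp add: w_def left_diff_distrib)
      also have "\<dots> = (\<integral>x. ?D (fj j) x * \<psi> x \<partial>?M) - (\<integral>x. ?D f x * \<psi> x \<partial>?M)"
        by (rule Bochner_Integration.integral_diff[OF int[OF elim] int[OF f]])
      finally show ?case by simp
    qed
    moreover have "(\<lambda>j. (\<integral>x. w j x * \<psi> x \<partial>?M) + (\<integral>x. ?D f x * \<psi> x \<partial>?M))
        \<longlonglongrightarrow> 0 + (\<integral>x. ?D f x * \<psi> x \<partial>?M)"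
      by (intro tendsto_add weak[OF \<psi>] tendsto_const)
    ultimately show "(\<lambda>j. \<integral>x. ?D (fj j) x * \<psi> x \<partial>?M) \<longlonglongrightarrow> (\<integral>x. ?D f x * \<psi> x \<partial>?M)"
      unfolding add_0 by (rule Lim_transform_eventually[rotated])
  qed
qed

text \<open>
  A Lipschitz function whose partial derivatives exist and are Lipschitz belongs to
  \<open>W\<^sup>2\<^sup>,\<^sup>\<infinity>\<close>, with a bound given by the sup norms and the Lipschitz constants.
\<close>

lemma lipschitz_derivatives_in_sobolev_ball:
  fixes f :: "'a::euclidean_space \<Rightarrow> real"
  assumes \<Omega>: "open \<Omega>" "bounded \<Omega>"
    and f: "\<And>x. \<bar>f x\<bar> \<le> C" "\<And>x y. \<bar>f x - f y\<bar> \<le> C * dist x y"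
    and h: "\<And>v x. v \<in> Basis \<Longrightarrow> \<bar>h v x\<bar> \<le> C"
      "\<And>v x y. v \<in> Basis \<Longrightarrow> \<bar>h v x - h v y\<bar> \<le> C * dist x y"
      "\<And>v x. v \<in> Basis \<Longrightarrow> x \<in> \<Omega> \<Longrightarrow> (\<lambda>k. difference_quotient f v k x) \<longlonglongrightarrow> h v x"
  shows "f \<in> sobolev_ball 2 C \<Omega>"
proof -
  have f_cont: "continuous_on UNIV f" by (rule lipschitz_imp_continuous[OF f(2)])
  have f_meas: "f \<in> borel_measurable (lebesgue_on \<Omega>)"
    by (rule continuous_measurable_lebesgue_on[OF f_cont])
  have f_li: "locally_integrable \<Omega> f"
    by (rule bounded_imp_locally_integrable[OF f_meas f(1)])
  have h_cont: "continuous_on UNIV (h v)" if "v \<in> Basis" for v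
    by (rule lipschitz_imp_continuous[OF h(2)[OF that]])
  have h_meas: "h v \<in> borel_measurable (lebesgue_on \<Omega>)" if "v \<in> Basis" for v
    by (rule continuous_measurable_lebesgue_on[OF h_cont[OF that]])
  have first: "(\<integral>x. h v x * \<phi> x \<partial>lebesgue_on \<Omega>) =
       - (\<integral>x. f x * frechet_derivative \<phi> (at x) v \<partial>lebesgue_on \<Omega>)"
    if "v \<in> Basis" "test_function \<Omega> \<phi>" for v \<phi>
    by (rule lipschitz_classical_partial_derivative[OF \<Omega>(1) f(2) that(1) h_cont[OF that(1)]
          h(3)[OF that(1)] that(2)])
  have "\<exists>g. g \<in> borel_measurable (lebesgue_on \<Omega>) \<and> (\<forall>x. \<bar>g x\<bar> \<le> C) \<and> has_weak_derivative \<Omega> vs f g"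
    if vs: "set vs \<subseteq> Basis" "length vs \<le> 2" for vs
  proof -
    consider "vs = []" | v where "vs = [v]" | v w where "vs = [v, w]"
      using vs(2) by (cases vs; cases "tl vs"; cases "tl (tl vs)") auto
    then show ?thesis
    proof cases
      case 1
      then show ?thesis
        using f_meas f(1) f_li by (intro exI[of _ f]) (simp add: has_weak_derivative_def)
    next
      case (2 v)
      then have v: "v \<in> Basis" using vs by simp
      have "locally_integrable \<Omega> (h v)"
        by (rule bounded_imp_locally_integrable[OF h_meas[OF v] h(1)[OF v]])
      then show ?thesis
        using 2 h_meas[OF v] h(1)[OF v] f_li first[OF v]
        by (intro exI[of _ "h v"]) (simp add: has_weak_derivative_def)
    next
      case (3 v w)
      then have v: "v \<in> Basis" and w: "w \<in> Basis" using vs by auto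
      obtain G where G: "G \<in> borel_measurable (lebesgue_on \<Omega>)" "\<And>x. \<bar>G x\<bar> \<le> C"
        "\<And>\<phi>. test_function \<Omega> \<phi> \<Longrightarrow> (\<integral>x. G x * \<phi> x \<partial>lebesgue_on \<Omega>) =
           - (\<integral>x. h v x * frechet_derivative \<phi> (at x) w \<partial>lebesgue_on \<Omega>)"
        by (rule lipschitz_weak_partial_derivative[OF \<Omega> h(2)[OF v] w]) (rule that)
      have "locally_integrable \<Omega> G"
        by (rule bounded_imp_locally_integrable[OF G(1,2)])
      moreover have "(\<integral>x. f x * iterated_partial [v, w] \<phi> x \<partial>lebesgue_on \<Omega>) =
          (\<integral>x. G x * \<phi> x \<partial>lebesgue_on \<Omega>)" if \<phi>: "test_function \<Omega> \<phi>" for \<phi>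
        using G(3)[OF \<phi>] first[OF v test_function_partial[OF \<phi> w]] by simp
      ultimately show ?thesis
        using 3 G(1,2) f_li by (intro exI[of _ G]) (simp add: has_weak_derivative_def)
    qed
  qed
  then show ?thesis
    using f_meas f(1) by (simp add: sobolev_ball_def)
qed

section \<open>Graph representation of the boundary\<close>

text \<open>
  A common bound for the values \<open>R / 4\<close>, the slope \<open>5\<close>, and the Lipschitz constant \<open>48 / R\<close> of
  the first derivatives of the graph functions below.
\<close>

definition graph_bound :: "real \<Rightarrow> real" where
  "graph_bound R = R / 4 + 5 + 48 / R"

text \<open>
  If the normals of a zero set make a definite angle with the horizontal directions, then
  the quadratic contact with the tangent planes gives a graph with bounded slope, first derivatives
  are read off from the normals, and these depend Lipschitz continuously on the point.
\<close>

lemma zero_set_graph: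
  fixes s :: "'b::euclidean_space \<times> real \<Rightarrow> real"
  assumes R: "R > 0"
    and cont: "continuous_on UNIV s"
    and bottom: "\<And>x. norm x \<le> R / 4 \<Longrightarrow> s (x, - (R / 4)) < 0"
    and top: "\<And>x. norm x \<le> R / 4 \<Longrightarrow> s (x, R / 4) > 0"
    and unit: "\<And>y. y \<in> cylinder (R / 4) \<Longrightarrow> s y = 0 \<Longrightarrow> norm (n y) = 1 \<and> snd (n y) \<ge> 1 / 2"
    and quad: "\<And>y y'. y \<in> cylinder (R / 4) \<Longrightarrow> s y = 0 \<Longrightarrow> y' \<in> cylinder (R / 4) \<Longrightarrow> s y' = 0 \<Longrightarrow>
        \<bar>n y \<bullet> (y' - y)\<bar> \<le> (norm (y' - y))\<^sup>2 / (2 * R)"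
    and lip: "\<And>y y'. y \<in> cylinder (R / 4) \<Longrightarrow> s y = 0 \<Longrightarrow> y' \<in> cylinder (R / 4) \<Longrightarrow> s y' = 0 \<Longrightarrow>
        norm (n y - n y') \<le> norm (y - y') / R"
  obtains f where "f \<in> sobolev_ball 2 (graph_bound R) (ball 0 (R / 4))"
    "{y \<in> cylinder (R / 4). s y = 0} = graph_over (cball 0 (R / 4)) f"
    "\<And>x z. norm x \<le> R / 4 \<Longrightarrow> \<bar>z\<bar> \<le> R / 4 \<Longrightarrow> s (x, z) < 0 \<longleftrightarrow> z < f x"
    "\<And>x z. norm x \<le> R / 4 \<Longrightarrow> \<bar>z\<bar> \<le> R / 4 \<Longrightarrow> s (x, z) > 0 \<longleftrightarrow> f x < z"
    "\<And>x. \<bar>f x\<bar> \<le> R / 4"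
proof -
  define S where "S = cball (0::'b) (R / 4)"
  define Z where "Z = {y \<in> cylinder (R / 4). s y = 0}"
  have Z_iff: "(x, z) \<in> Z \<longleftrightarrow> x \<in> S \<and> \<bar>z\<bar> \<le> R / 4 \<and> s (x, z) = 0" for x z
    by (auto simp: Z_def S_def cylinder_def)
  have n1: "norm (fst (n y)) \<le> 1" "snd (n y) \<le> 1" "snd (n y) \<ge> 1 / 2" "norm (n y) = 1"
    if "y \<in> Z" for y
    using unit[of y] that norm_fst_le[of "fst (n y)" "snd (n y)"] norm_snd_le[of "snd (n y)" "fst (n y)"]
    by (auto simp: Z_def)
  have quad': "\<bar>fst (n (x, z)) \<bullet> (x' - x) + snd (n (x, z)) * (z' - z)\<bar>
      \<le> ((norm (x' - x))\<^sup>2 + (z' - z)\<^sup>2) / (2 * R)"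
    if "(x, z) \<in> Z" "(x', z') \<in> Z" for x z x' z'
    using quad[of "(x, z)" "(x', z')"] that
    by (simp add: Z_def inner_prod_def norm_prod_def)
  \<comment> \<open>Horizontal and vertical distances in the cylinder are at most \<open>R / 2\<close>, so that each contributes at
    most a quarter of itself to the quadratic error; the vertical part keeps \<open>1 / 2 - 1 / 4 > 0\<close>.\<close>
  have slope: "\<bar>z' - z\<bar> \<le> 5 * norm (x' - x)" if Z: "(x, z) \<in> Z" "(x', z') \<in> Z" for x z x' z'
  proof -
    let ?a = "fst (n (x, z))" and ?c = "snd (n (x, z))"
    have nx: "norm (x' - x) \<le> R / 2"
      using Z norm_triangle_ineq4[of x' x] by (auto simp: Z_iff S_def)
    have "\<bar>z\<bar> \<le> R / 4" "\<bar>z'\<bar> \<le> R / 4" using Z by (simp_all add: Z_iff)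
    then have nz: "\<bar>z' - z\<bar> \<le> R / 2" by linarith
    have "(norm (x' - x))\<^sup>2 \<le> norm (x' - x) * (R / 2)"
      unfolding power2_eq_square using nx by (intro mult_left_mono) auto
    moreover have "(z' - z)\<^sup>2 \<le> \<bar>z' - z\<bar> * (R / 2)"
    proof -
      have "\<bar>z' - z\<bar> * \<bar>z' - z\<bar> \<le> \<bar>z' - z\<bar> * (R / 2)"
        using nz by (intro mult_left_mono) auto
      then show ?thesis by (simp add: power2_eq_square)
    qed
    ultimately have "((norm (x' - x))\<^sup>2 + (z' - z)\<^sup>2) / (2 * R)
        \<le> (norm (x' - x) * (R / 2) + \<bar>z' - z\<bar> * (R / 2)) / (2 * R)"
      using R by (intro divide_right_mono) auto
    also have "\<dots> = norm (x' - x) / 4 + \<bar>z' - z\<bar> / 4"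
      using R by (simp add: field_simps)
    finally have q: "\<bar>?a \<bullet> (x' - x) + ?c * (z' - z)\<bar> \<le> norm (x' - x) / 4 + \<bar>z' - z\<bar> / 4"
      using quad'[OF Z] by linarith
    have "\<bar>?a \<bullet> (x' - x)\<bar> \<le> norm ?a * norm (x' - x)" by (rule Cauchy_Schwarz_ineq2)
    also have "\<dots> \<le> 1 * norm (x' - x)" using n1(1)[OF Z(1)] by (intro mult_right_mono) auto
    finally have a: "\<bar>?a \<bullet> (x' - x)\<bar> \<le> norm (x' - x)" by simp
    have 1: "\<bar>?c * (z' - z)\<bar> \<le> \<bar>?a \<bullet> (x' - x) + ?c * (z' - z)\<bar> + \<bar>?a \<bullet> (x' - x)\<bar>"
      using abs_triangle_ineq4[of "?a \<bullet> (x' - x) + ?c * (z' - z)" "?a \<bullet> (x' - x)"] by simp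
    have 2: "\<bar>?c * (z' - z)\<bar> = ?c * \<bar>z' - z\<bar>" using n1(3)[OF Z(1)] by (simp add: abs_mult)
    have 3: "1 / 2 * \<bar>z' - z\<bar> \<le> ?c * \<bar>z' - z\<bar>"
      using n1(3)[OF Z(1)] by (intro mult_right_mono) auto
    have *: "D \<le> 5 * N"
      if "p \<le> q + r" "p = w" "1 / 2 * D \<le> w" "q \<le> N / 4 + D / 4" "r \<le> N" for p q r w D N :: real
      using that by linarith
    show ?thesis by (rule *[OF 1 2 3 q a])
  qed
  have vertical: "continuous_on A (\<lambda>z. s (x, z))" for A x
    by (rule continuous_on_compose2[OF cont]) (auto intro!: continuous_intros)
  have crossing: "\<exists>z. a \<le> z \<and> z \<le> b \<and> (x, z) \<in> Z"
    if ab: "x \<in> S" "- (R / 4) \<le> a" "a \<le> b" "b \<le> R / 4" "s (x, a) \<le> 0" "0 \<le> s (x, b)" for x a b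
  proof -
    obtain z where "a \<le> z" "z \<le> b" "s (x, z) = 0"
      using IVT'[of "\<lambda>z. s (x, z)" a 0 b, OF ab(5,6,3) vertical] by auto
    then show ?thesis using ab by (intro exI[of _ z]) (auto simp: Z_iff)
  qed
  have "\<exists>z. (x, z) \<in> Z" if "x \<in> S" for x
    using crossing[OF that, of "- (R / 4)" "R / 4"] bottom[of x] top[of x] that R
    by (auto simp: S_def)
  then obtain f0 where f0: "\<And>x. x \<in> S \<Longrightarrow> (x, f0 x) \<in> Z" by metis
  have f0_unique: "z = f0 x" if "(x, z) \<in> Z" for x z
    using slope[OF that f0[of x]] that by (auto simp: Z_iff)
  have neg: "s (x, z) < 0" if x: "x \<in> S" and z: "\<bar>z\<bar> \<le> R / 4" "z < f0 x" for x z
  proof (rule ccontr)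
    assume "\<not> s (x, z) < 0"
    then have "\<exists>z'. - (R / 4) \<le> z' \<and> z' \<le> z \<and> (x, z') \<in> Z"
      using x z bottom[of x] by (intro crossing) (auto simp: S_def)
    then obtain z' where "z' \<le> z" "(x, z') \<in> Z" by auto
    with f0_unique[of x z'] z(2) show False by simp
  qed
  have pos: "s (x, z) > 0" if x: "x \<in> S" and z: "\<bar>z\<bar> \<le> R / 4" "f0 x < z" for x z
  proof (rule ccontr)
    assume "\<not> s (x, z) > 0"
    then have "\<exists>z'. z \<le> z' \<and> z' \<le> R / 4 \<and> (x, z') \<in> Z"
      using x z top[of x] by (intro crossing) (auto simp: S_def)
    then obtain z' where "z \<le> z'" "(x, z') \<in> Z" by auto
    with f0_unique[of x z'] z(2) show False by simp
  qed
  have zero: "s (x, f0 x) = 0" if "x \<in> S" for x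
    using f0[OF that] by (simp add: Z_iff)
  define a where "a x = fst (n (x, f0 x))" for x
  define c where "c x = snd (n (x, f0 x))" for x
  have c: "1 / 2 \<le> c x" "c x \<le> 1" if "x \<in> S" for x
    using n1[OF f0[OF that]] by (auto simp: c_def)
  have av: "\<bar>a x \<bullet> v\<bar> \<le> 1" if "x \<in> S" "v \<in> Basis" for x v
  proof -
    have "\<bar>a x \<bullet> v\<bar> \<le> norm (a x)" using that(2) by (rule Basis_le_norm)
    then show ?thesis using n1(1)[OF f0[OF that(1)]] by (simp add: a_def)
  qed
  define h0 where "h0 v x = - (a x \<bullet> v) / c x" for v x
  have h0_bound: "\<bar>h0 v x\<bar> \<le> 2" if "x \<in> S" "v \<in> Basis" for v x
  proof -
    have "\<bar>a x \<bullet> v\<bar> \<le> 2 * c x" using av[OF that] c[OF that(1)] by linarith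
    moreover have "c x > 0" using c[OF that(1)] by linarith
    ultimately show ?thesis by (simp add: h0_def abs_divide pos_divide_le_eq)
  qed
  have normals: "norm (n (x, f0 x) - n (y, f0 y)) \<le> 6 / R * norm (x - y)" if "x \<in> S" "y \<in> S" for x y
  proof -
    have "norm (n (x, f0 x) - n (y, f0 y)) \<le> norm ((x, f0 x) - (y, f0 y)) / R"
      using lip[of "(x, f0 x)" "(y, f0 y)"] f0[OF that(1)] f0[OF that(2)] by (simp add: Z_def)
    also have "norm ((x, f0 x) - (y, f0 y)) \<le> norm (x - y) + norm (f0 x - f0 y)"
      using norm_Pair_le[of "x - y" "f0 x - f0 y"] by simp
    also have "norm (f0 x - f0 y) \<le> 5 * norm (x - y)"
      using slope[OF f0[OF that(2)] f0[OF that(1)]] by simp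
    finally show ?thesis using R by (simp add: divide_right_mono)
  qed
  have h0_lip: "\<bar>h0 v x - h0 v y\<bar> \<le> 48 / R * norm (x - y)"
    if xy: "x \<in> S" "y \<in> S" and v: "v \<in> Basis" for v x y
  proof -
    define \<delta> where "\<delta> = norm (n (x, f0 x) - n (y, f0 y))"
    have "\<bar>(a x - a y) \<bullet> v\<bar> \<le> norm (a x - a y)" using v by (rule Basis_le_norm)
    also have "\<dots> \<le> \<delta>"
      using norm_fst_le[of "a x - a y" "c x - c y"] by (simp add: a_def c_def \<delta>_def flip: diff_Pair)
    finally have 1: "\<bar>a x \<bullet> v - a y \<bullet> v\<bar> \<le> \<delta>" by (simp add: inner_diff_left)
    have 2: "\<bar>c x - c y\<bar> \<le> \<delta>"
      using norm_snd_le[of "c x - c y" "a x - a y"] by (simp add: a_def c_def \<delta>_def flip: diff_Pair)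
    have cx: "1 / 2 \<le> c x" "c x \<le> 1" and cy: "1 / 2 \<le> c y" "c y \<le> 1" using c xy by auto
    have eq: "h0 v x - h0 v y = (a y \<bullet> v * (c x - c y) - (a x \<bullet> v - a y \<bullet> v) * c y) / (c x * c y)"
      using cx cy by (simp add: h0_def field_simps)
    have \<delta>0: "0 \<le> \<delta>" by (simp add: \<delta>_def)
    have "\<bar>a y \<bullet> v * (c x - c y)\<bar> \<le> 1 * \<delta>"
      unfolding abs_mult using av[OF xy(2) v] 2 by (intro mult_mono) auto
    moreover have "\<bar>(a x \<bullet> v - a y \<bullet> v) * c y\<bar> \<le> \<delta> * 1"
      unfolding abs_mult using 1 cy \<delta>0 by (intro mult_mono) auto
    ultimately have num: "\<bar>a y \<bullet> v * (c x - c y) - (a x \<bullet> v - a y \<bullet> v) * c y\<bar> \<le> 2 * \<delta>" by linarith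
    have "1 / 2 * (1 / 2) \<le> c x * c y" using cx cy by (intro mult_mono) auto
    then have den: "1 / 4 \<le> c x * c y" by simp
    have "\<bar>h0 v x - h0 v y\<bar> \<le> 2 * \<delta> / (1 / 4)"
      unfolding eq abs_divide using num den by (intro frac_le) auto
    also have "\<dots> = 8 * \<delta>" by simp
    also have "\<dots> \<le> 8 * (6 / R * norm (x - y))"
      using normals[OF xy] by (simp add: \<delta>_def)
    finally show ?thesis by simp
  qed
  \<comment> \<open>The slope bound turns the error term into \<open>(1 + 5\<^sup>2) |y - x|\<^sup>2 / (2 R)\<close>, to be divided by
    \<open>c x \<ge> 1 / 2\<close>.\<close>
  have taylor: "\<bar>f0 y - f0 x + (a x \<bullet> (y - x)) / c x\<bar> \<le> 26 / R * (norm (y - x))\<^sup>2"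
    if xy: "x \<in> S" "y \<in> S" for x y
  proof -
    have cx: "1 / 2 \<le> c x" using c xy by auto
    have "\<bar>f0 y - f0 x\<bar>\<^sup>2 \<le> (5 * norm (y - x))\<^sup>2"
      using slope[OF f0[OF xy(1)] f0[OF xy(2)]] by (intro power_mono) auto
    then have "((norm (y - x))\<^sup>2 + (f0 y - f0 x)\<^sup>2) / (2 * R) \<le> 26 * (norm (y - x))\<^sup>2 / (2 * R)"
      using R by (intro divide_right_mono) (auto simp: power_mult_distrib)
    then have "\<bar>a x \<bullet> (y - x) + c x * (f0 y - f0 x)\<bar> \<le> 26 * (norm (y - x))\<^sup>2 / (2 * R)"
      using quad'[OF f0[OF xy(1)] f0[OF xy(2)]] by (simp add: a_def c_def)
    then have "\<bar>a x \<bullet> (y - x) + c x * (f0 y - f0 x)\<bar> / c x \<le> 26 * (norm (y - x))\<^sup>2 / (2 * R) / (1 / 2)"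
      using cx R by (intro frac_le) auto
    also have "\<bar>a x \<bullet> (y - x) + c x * (f0 y - f0 x)\<bar> / c x = \<bar>f0 y - f0 x + (a x \<bullet> (y - x)) / c x\<bar>"
    proof -
      have pos: "c x > 0" using cx by linarith
      have "(a x \<bullet> (y - x) + c x * (f0 y - f0 x)) / c x = f0 y - f0 x + (a x \<bullet> (y - x)) / c x"
        using pos by (simp add: add_divide_distrib)
      from arg_cong[OF this, of abs] show ?thesis by (simp only: abs_divide abs_of_pos[OF pos])
    qed
    finally show ?thesis by simp
  qed
  \<comment> \<open>Composing with the nearest point projection extends everything to the whole space.\<close>
  define cp where "cp = closest_point S"
  have S: "convex S" "closed S" "S \<noteq> {}" using R by (auto simp: S_def)
  have cp_in: "cp x \<in> S" for x unfolding cp_def using S by (intro closest_point_in_set)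
  have cp_id: "cp x = x" if "x \<in> S" for x unfolding cp_def using that by (rule closest_point_self)
  have cp_lip: "norm (cp x - cp y) \<le> dist x y" for x y
    using closest_point_lipschitz[OF S, of x y] by (simp add: cp_def dist_norm)
  define f where "f x = f0 (cp x)" for x
  define h where "h v x = h0 v (cp x)" for v x
  let ?C = "graph_bound R"
  have C: "R / 4 \<le> ?C" "5 \<le> ?C" "48 / R \<le> ?C" using R by (auto simp: graph_bound_def)
  have f_bound: "\<bar>f x\<bar> \<le> R / 4" for x
    using f0[OF cp_in] by (simp add: f_def Z_iff)
  have sob: "f \<in> sobolev_ball 2 ?C (ball 0 (R / 4))"
  proof (rule lipschitz_derivatives_in_sobolev_ball[where h = h])
    show "\<bar>f x\<bar> \<le> ?C" for x using f_bound[of x] C(1) by linarith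
    show "\<bar>f x - f y\<bar> \<le> ?C * dist x y" for x y
    proof -
      have "\<bar>f x - f y\<bar> \<le> 5 * norm (cp x - cp y)"
        unfolding f_def by (rule slope[OF f0[OF cp_in] f0[OF cp_in]])
      also have "\<dots> \<le> ?C * dist x y" using cp_lip C(2) by (intro mult_mono) auto
      finally show ?thesis .
    qed
    show "\<bar>h v x\<bar> \<le> ?C" if "v \<in> Basis" for v x
      using h0_bound[OF cp_in that, of x] C(2) by (simp add: h_def)
    show "\<bar>h v x - h v y\<bar> \<le> ?C * dist x y" if "v \<in> Basis" for v x y
    proof -
      have "\<bar>h v x - h v y\<bar> \<le> 48 / R * norm (cp x - cp y)"
        unfolding h_def by (rule h0_lip[OF cp_in cp_in that])
      also have "\<dots> \<le> ?C * dist x y" using cp_lip C(3) R by (intro mult_mono) (auto simp: graph_bound_def)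
      finally show ?thesis .
    qed
    fix v x :: 'b assume v: "v \<in> Basis" and x: "x \<in> ball 0 (R / 4)"
    have xS: "x \<in> S" using x by (auto simp: S_def)
    let ?t = "\<lambda>k. inverse (real (Suc k))"
    have t0: "?t \<longlonglongrightarrow> 0" by (rule LIMSEQ_inverse_real_of_nat)
    have "(\<lambda>k. x + ?t k *\<^sub>R v) \<longlonglongrightarrow> x + 0 *\<^sub>R v"
      by (intro tendsto_intros t0)
    then have "(\<lambda>k. x + ?t k *\<^sub>R v) \<longlonglongrightarrow> x" by simp
    from topological_tendstoD[OF this open_ball x]
    have ev: "\<forall>\<^sub>F k in sequentially. x + ?t k *\<^sub>R v \<in> ball 0 (R / 4)" .
    have bound: "\<forall>\<^sub>F k in sequentially. norm (difference_quotient f v k x - h v x) \<le> 26 / R * ?t k"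
      using ev
    proof eventually_elim
      case (elim k)
      then have yS: "x + ?t k *\<^sub>R v \<in> S" by (auto simp: S_def)
      have t: "?t k > 0" by simp
      have "\<bar>f0 (x + ?t k *\<^sub>R v) - f0 x + (a x \<bullet> (x + ?t k *\<^sub>R v - x)) / c x\<bar>
          \<le> 26 / R * (norm (x + ?t k *\<^sub>R v - x))\<^sup>2"
        by (rule taylor[OF xS yS])
      also have "norm (x + ?t k *\<^sub>R v - x) = ?t k" using v by simp
      also have "(a x \<bullet> (x + ?t k *\<^sub>R v - x)) / c x = - (?t k * h0 v x)"
        by (simp add: h0_def)
      finally have "\<bar>f0 (x + ?t k *\<^sub>R v) - f0 x - ?t k * h0 v x\<bar> \<le> 26 / R * ?t k * ?t k"
        by (simp add: power2_eq_square mult.assoc)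
      then have num: "\<bar>f0 (x + ?t k *\<^sub>R v) - f0 x - ?t k * h0 v x\<bar> / ?t k \<le> 26 / R * ?t k"
        unfolding pos_divide_le_eq[OF t] .
      have "\<bar>(p - q) / \<tau> - g\<bar> = \<bar>p - q - \<tau> * g\<bar> / \<tau>" if \<tau>: "\<tau> > 0" for p q g \<tau> :: real
      proof -
        have "(p - q) / \<tau> - g = (p - q - \<tau> * g) / \<tau>"
          using \<tau> by (simp add: diff_divide_distrib)
        then show ?thesis using \<tau> by (simp add: abs_divide)
      qed
      from ord_eq_le_trans[OF this[OF t] num] show ?case
        unfolding f_def h_def cp_id[OF xS] cp_id[OF yS] real_norm_def .
    qed
    have "(\<lambda>k. 26 / R * ?t k) \<longlonglongrightarrow> 26 / R * 0"
      by (intro tendsto_mult tendsto_const t0)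
    then have null: "(\<lambda>k. 26 / R * ?t k) \<longlonglongrightarrow> 0"
      unfolding mult_zero_right .
    have "(\<lambda>k. difference_quotient f v k x - h v x) \<longlonglongrightarrow> 0"
      by (rule Lim_null_comparison[OF bound null])
    then show "(\<lambda>k. difference_quotient f v k x) \<longlonglongrightarrow> h v x"
      by (rule LIM_zero_cancel)
  qed auto
  have graph: "{y \<in> cylinder (R / 4). s y = 0} = graph_over (cball 0 (R / 4)) f"
  proof -
    have "Z = graph_over S f"
    proof (intro set_eqI iffI)
      fix y assume y: "y \<in> Z"
      obtain x z where xz: "y = (x, z)" by (cases y)
      have x: "x \<in> S" using y unfolding xz Z_iff by simp
      have "z = f x"
        using f0_unique[of x z] y by (simp add: xz f_def cp_id[OF x])
      with x show "y \<in> graph_over S f" by (simp add: xz graph_over_def)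
    next
      fix y assume "y \<in> graph_over S f"
      then obtain x where x: "x \<in> S" and y: "y = (x, f x)"
        unfolding graph_over_def by (rule imageE)
      show "y \<in> Z" using f0[OF x] by (simp add: y f_def cp_id[OF x])
    qed
    then show ?thesis by (simp add: Z_def S_def)
  qed
  have sign: "(s (x, z) < 0 \<longleftrightarrow> z < f x) \<and> (s (x, z) > 0 \<longleftrightarrow> f x < z)"
    if "norm x \<le> R / 4" "\<bar>z\<bar> \<le> R / 4" for x z
  proof -
    have xS: "x \<in> S" using that by (simp add: S_def)
    have fx: "f x = f0 x" by (simp add: f_def cp_id[OF xS])
    show ?thesis
    proof (cases z "f0 x" rule: linorder_cases)
      case less
      with neg[OF xS that(2) less] fx show ?thesis by simp
    next
      case equal
      with zero[OF xS] fx show ?thesis by simp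
    next
      case greater
      with pos[OF xS that(2) greater] fx show ?thesis by simp
    qed
  qed
  show thesis
  proof (rule that[OF sob graph _ _ f_bound])
    show "s (x, z) < 0 \<longleftrightarrow> z < f x" if "norm x \<le> R / 4" "\<bar>z\<bar> \<le> R / 4" for x z
      using sign[OF that] by simp
    show "s (x, z) > 0 \<longleftrightarrow> f x < z" if "norm x \<le> R / 4" "\<bar>z\<bar> \<le> R / 4" for x z
      using sign[OF that] by simp
  qed
qed

text \<open>
  The balls of radius \<open>7 R / 8\<close> are what survives in an approximating set of the two touching balls
  of the limit set. They still contain the bottom and the top of the cylinder, and by
  \<open>interior_exterior_sum\<close> they force all normals of boundary points in the cylinder to be
  nearly vertical. The function \<open>\<tau>\<close> is the signed distance of an approximating set, or the limit of
  these functions.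
\<close>

lemma frontier_graph:
  fixes E :: "'a::euclidean_space set" and L :: "'b::euclidean_space \<times> real \<Rightarrow> 'a"
    and \<tau> :: "'a \<Rightarrow> real"
  assumes R: "R > 0" and E: "E \<in> ball_class R"
    and L: "linear L" "\<And>u v. L u \<bullet> L v = u \<bullet> v" "surj L"
    and inner: "ball (p - R *\<^sub>R L (0, 1)) (7 / 8 * R) \<subseteq> E"
    and outer: "ball (p + R *\<^sub>R L (0, 1)) (7 / 8 * R) \<inter> E = {}"
    and \<tau>: "continuous_on UNIV \<tau>" "\<And>x. \<tau> x = 0 \<longleftrightarrow> x \<in> frontier E"
      "\<And>x. x \<in> ball (p - R *\<^sub>R L (0, 1)) (7 / 8 * R) \<Longrightarrow> \<tau> x < 0"
      "\<And>x. x \<in> ball (p + R *\<^sub>R L (0, 1)) (7 / 8 * R) \<Longrightarrow> \<tau> x > 0"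
  obtains f where "f \<in> sobolev_ball 2 (graph_bound R) (ball 0 (R / 4))"
    "frontier E \<inter> (\<lambda>y. p + L y) ` cylinder (R / 4) = (\<lambda>y. p + L y) ` graph_over (cball 0 (R / 4)) f"
    "\<And>x z. norm x \<le> R / 4 \<Longrightarrow> \<bar>z\<bar> \<le> R / 4 \<Longrightarrow> \<tau> (p + L (x, z)) < 0 \<longleftrightarrow> z < f x"
    "\<And>x z. norm x \<le> R / 4 \<Longrightarrow> \<bar>z\<bar> \<le> R / 4 \<Longrightarrow> \<tau> (p + L (x, z)) > 0 \<longleftrightarrow> f x < z"
    "\<And>x. \<bar>f x\<bar> \<le> R / 4"
proof -
  define e where "e = L (0, 1)"
  have L_norm: "norm (L y) = norm y" for y
    using L(2)[of y y] by (simp add: norm_eq_sqrt_inner)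
  have L_diff: "L y - L y' = L (y - y')" for y y'
    by (simp add: linear_diff[OF L(1)])
  have e1: "norm e = 1" by (simp add: e_def L_norm norm_Pair)
  define T where "T y = p + L y" for y
  have ex: "\<forall>a\<in>frontier E. \<exists>v. unit_normal R E a v"
    using E unfolding ball_class_iff[OF R] by simp
  then obtain v where v: "\<And>a. a \<in> frontier E \<Longrightarrow> unit_normal R E a (v a)"
    by metis
  define n where "n y = inv L (v (T y))" for y
  have Ln: "L (n y) = v (T y)" for y
    unfolding n_def by (rule surj_f_inv_f[OF L(3)])
  define s where "s y = \<tau> (T y)" for y
  have L_cont: "continuous_on UNIV L"
    using L(1) by (simp add: linear_continuous_on linear_conv_bounded_linear)
  have s_cont: "continuous_on UNIV s"
    unfolding s_def T_def
    by (rule continuous_on_compose2[OF \<tau>(1)]) (auto intro!: continuous_intros L_cont)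
  \<comment> \<open>Here \<open>7 / 18\<close> is a rational upper bound of \<open>\<surd>2 / 4\<close>.\<close>
  have cyl: "norm (x, z) \<le> 7 / 18 * R" if "norm x \<le> R / 4" "\<bar>z\<bar> \<le> R / 4" for x :: 'b and z
  proof -
    have "(norm (x, z))\<^sup>2 = (norm x)\<^sup>2 + \<bar>z\<bar>\<^sup>2" by (simp add: norm_Pair)
    also have "\<dots> \<le> (R / 4)\<^sup>2 + (R / 4)\<^sup>2"
      using that by (intro add_mono power_mono) auto
    also have "\<dots> \<le> (7 / 18 * R)\<^sup>2" by (simp add: power2_eq_square)
    finally show ?thesis by (rule power2_le_imp_le) (use R in simp)
  qed
  have side: "norm (x, t) < 7 / 8 * R" if "norm x \<le> R / 4" "\<bar>t\<bar> = 3 / 4 * R" for x :: 'b and t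
  proof -
    have "(norm (x, t))\<^sup>2 = (norm x)\<^sup>2 + \<bar>t\<bar>\<^sup>2" by (simp add: norm_Pair)
    also have "\<dots> \<le> (R / 4)\<^sup>2 + (3 / 4 * R)\<^sup>2"
      using that by (intro add_mono power_mono) auto
    also have "\<dots> < (7 / 8 * R)\<^sup>2" using R by (simp add: power2_eq_square)
    finally show ?thesis by (rule power2_less_imp_less) (use R in simp)
  qed
  have shift: "R *\<^sub>R e = L (0, R)"
    using linear_scale[OF L(1), of R "(0, 1)"] by (simp add: e_def)
  have bottom: "s (x, - (R / 4)) < 0" if "norm x \<le> R / 4" for x
  proof -
    have "(p - R *\<^sub>R e) - T (x, - (R / 4)) = - (L (0, R) + L (x, - (R / 4)))"
      by (simp add: T_def shift)
    also have "L (0, R) + L (x, - (R / 4)) = L (x, 3 / 4 * R)"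
      by (simp flip: linear_add[OF L(1)])
    finally have "dist (p - R *\<^sub>R e) (T (x, - (R / 4))) = norm (x, 3 / 4 * R)"
      by (simp add: dist_norm L_norm)
    then show ?thesis
      using side[OF that, of "3 / 4 * R"] R unfolding s_def e_def by (intro \<tau>(3)) simp
  qed
  have top: "s (x, R / 4) > 0" if "norm x \<le> R / 4" for x
  proof -
    have "(p + R *\<^sub>R e) - T (x, R / 4) = L (0, R) - L (x, R / 4)"
      by (simp add: T_def shift)
    also have "L (0, R) - L (x, R / 4) = L (- x, 3 / 4 * R)"
      by (simp add: L_diff)
    finally have "dist (p + R *\<^sub>R e) (T (x, R / 4)) = norm (- x, 3 / 4 * R)"
      by (simp add: dist_norm L_norm)
    then show ?thesis
      using side[of "- x" "3 / 4 * R"] that R unfolding s_def e_def by (intro \<tau>(4)) simp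
  qed
  have front: "T y \<in> frontier E" if "s y = 0" for y
    using that \<tau>(2) by (simp add: s_def)
  have unit: "norm (n y) = 1 \<and> snd (n y) \<ge> 1 / 2" if y: "y \<in> cylinder (R / 4)" "s y = 0" for y
  proof -
    have vy: "unit_normal R E (T y) (v (T y))" by (rule v[OF front[OF y(2)]])
    then have vb: "norm (v (T y)) = 1" "ball (T y - R *\<^sub>R v (T y)) R \<subseteq> E"
        "ball (T y + R *\<^sub>R v (T y)) R \<inter> E = {}"
      by (auto simp: unit_normal_def)
    have n1: "norm (n y) = 1"
      using L_norm[of "n y"] vb(1) by (simp add: Ln)
    have "(7 / 8 * R + R)\<^sup>2 \<le> (norm (p - T y))\<^sup>2 + R\<^sup>2 * (norm (e + v (T y)))\<^sup>2"
      by (rule interior_exterior_sum[OF inner[folded e_def] outer[folded e_def] vb(2,3)]) (use R in simp_all)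
    also have "(norm (e + v (T y)))\<^sup>2 = 2 + 2 * (e \<bullet> v (T y))"
      by (rule norm_add_unit_vectors(2)[OF e1 vb(1)])
    also have "e \<bullet> v (T y) = (0, 1) \<bullet> n y"
      unfolding e_def Ln[symmetric] by (rule L(2))
    also have "(0, 1) \<bullet> n y = snd (n y)" by (simp add: inner_prod_def)
    finally have "(7 / 8 * R + R)\<^sup>2 \<le> (norm (p - T y))\<^sup>2 + R\<^sup>2 * (2 + 2 * snd (n y))" .
    moreover have "(norm (p - T y))\<^sup>2 \<le> (7 / 18 * R)\<^sup>2"
    proof (rule power_mono)
      have "norm (p - T y) = norm y" by (simp add: T_def L_norm)
      also have "\<dots> \<le> 7 / 18 * R"
        using cyl[of "fst y" "snd y"] y(1) by (auto simp: cylinder_def)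
      finally show "norm (p - T y) \<le> 7 / 18 * R" .
    qed simp
    ultimately have "R\<^sup>2 * (15 / 8)\<^sup>2 \<le> R\<^sup>2 * ((7 / 18)\<^sup>2 + (2 + 2 * snd (n y)))"
      by (simp add: power2_eq_square algebra_simps)
    then have "(15 / 8)\<^sup>2 \<le> (7 / 18 :: real)\<^sup>2 + (2 + 2 * snd (n y))"
      using R by simp
    then have "snd (n y) \<ge> 1 / 2" by (simp add: power2_eq_square)
    with n1 show ?thesis by simp
  qed
  have quad: "\<bar>n y \<bullet> (y' - y)\<bar> \<le> (norm (y' - y))\<^sup>2 / (2 * R)" if "y \<in> cylinder (R / 4)" and y1: "s y = 0" and "y' \<in> cylinder (R / 4)" and y2: "s y' = 0" for y y'
  proof -
    have "\<bar>v (T y) \<bullet> (T y' - T y)\<bar> \<le> (norm (T y' - T y))\<^sup>2 / (2 * R)"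
      by (rule unit_normal_quadratic[OF v[OF front[OF y1]] front[OF y2] R])
    moreover have "T y' - T y = L (y' - y)" by (simp add: T_def L_diff)
    ultimately show ?thesis
      by (simp only: Ln[symmetric] L(2) L_norm)
  qed
  have lip: "norm (n y - n y') \<le> norm (y - y') / R" if "y \<in> cylinder (R / 4)" and y1: "s y = 0" and "y' \<in> cylinder (R / 4)" and y2: "s y' = 0" for y y'
  proof -
    have "norm (v (T y) - v (T y')) \<le> norm (T y - T y') / R"
      by (rule unit_normal_lipschitz[OF v[OF front[OF y1]] v[OF front[OF y2]] R])
    moreover have "T y - T y' = L (y - y')" by (simp add: T_def L_diff)
    ultimately show ?thesis
      by (simp only: Ln[symmetric] L_diff L_norm)
  qed
  obtain f where f: "f \<in> sobolev_ball 2 (graph_bound R) (ball 0 (R / 4))"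
    "{y \<in> cylinder (R / 4). s y = 0} = graph_over (cball 0 (R / 4)) f"
    "\<And>x z. norm x \<le> R / 4 \<Longrightarrow> \<bar>z\<bar> \<le> R / 4 \<Longrightarrow> s (x, z) < 0 \<longleftrightarrow> z < f x"
    "\<And>x z. norm x \<le> R / 4 \<Longrightarrow> \<bar>z\<bar> \<le> R / 4 \<Longrightarrow> s (x, z) > 0 \<longleftrightarrow> f x < z"
    "\<And>x. \<bar>f x\<bar> \<le> R / 4"
    by (rule zero_set_graph[OF R s_cont bottom top unit quad lip]) (assumption | rule that)+
  have "frontier E \<inter> T ` cylinder (R / 4) = T ` graph_over (cball 0 (R / 4)) f"
    unfolding f(2)[symmetric] using \<tau>(2) by (auto simp: s_def)
  then show thesis
    by (intro that[OF f(1) _ f(3,4)[unfolded s_def T_def] f(5)]) (simp_all add: T_def)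
qed

section \<open>The compactness theorem\<close>

context signed_dist_limit
begin

text \<open>
  The graph functions are compared through signs only: a point strictly below the limit graph has
  \<open>\<sigma> < 0\<close>, hence eventually lies below the approximating graphs. Together with the bound of the
  graph functions, which depends on \<open>R\<close> alone, this yields weak* convergence.
\<close>

lemma graphs_converge:
  fixes T :: "'b::euclidean_space \<times> real \<Rightarrow> 'a"
  assumes p: "p \<in> frontier limit_set" and T: "T \<in> coordinate_systems R limit_set p"
  shows "\<exists>f fj.
     f \<in> sobolev_infinity 2 (ball 0 (R / 4)) \<and>
     frontier limit_set \<inter> T ` cylinder (R / 4) = T ` graph_over (cball 0 (R / 4)) f \<and>
     (\<forall>\<^sub>F j in sequentially.
        fj j \<in> sobolev_infinity 2 (ball 0 (R / 4)) \<and>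
        frontier (F j) \<inter> T ` cylinder (R / 4) = T ` graph_over (cball 0 (R / 4)) (fj j)) \<and>
     sobolev_weak_star_convergent 2 (ball 0 (R / 4)) fj f"
proof -
  obtain L p' p'' where L: "linear L" "\<forall>u v. L u \<bullet> L v = u \<bullet> v" "surj L" "T = (\<lambda>y. p + L y)"
      "touching_balls R limit_set p p' p''" "L (0, 1) = (1 / (2 * R)) *\<^sub>R (p'' - p')"
    using T unfolding coordinate_systems_def by auto
  have L2: "L u \<bullet> L v = u \<bullet> v" for u v by (rule L(2)[rule_format])
  define e where "e = L (0, 1)"
  have nrm: "unit_normal R limit_set p e"
    using touching_balls_unit_normal(1)[OF L(5) R] by (simp add: e_def L(6))
  let ?r = "7 / 8 * R"
  have r: "?r \<le> R" "?r > 0" using R by auto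
  have balls: "ball (p - R *\<^sub>R e) ?r \<subseteq> limit_set" "ball (p + R *\<^sub>R e) ?r \<inter> limit_set = {}"
    using nrm subset_ball[OF r(1)] by (auto simp: unit_normal_def)
  have \<sigma>_in: "\<sigma> x < 0" if "x \<in> ball (p - R *\<^sub>R e) ?r" for x
    using frontier_normal(2)[OF p nrm, of x] that r by simp
  have \<sigma>_out: "\<sigma> x > 0" if "x \<in> ball (p + R *\<^sub>R e) ?r" for x
    using frontier_normal(1)[OF p nrm, of x] that r by simp
  have \<sigma>_zero: "\<sigma> x = 0 \<longleftrightarrow> x \<in> frontier limit_set" for x by (simp add: frontier_iff)
  obtain f where f: "f \<in> sobolev_ball 2 (graph_bound R) (ball 0 (R / 4))"
    "frontier limit_set \<inter> (\<lambda>y. p + L y) ` cylinder (R / 4) = (\<lambda>y. p + L y) ` graph_over (cball 0 (R / 4)) f"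
    "\<And>x z. norm x \<le> R / 4 \<Longrightarrow> \<bar>z\<bar> \<le> R / 4 \<Longrightarrow> \<sigma> (p + L (x, z)) < 0 \<longleftrightarrow> z < f x"
    "\<And>x z. norm x \<le> R / 4 \<Longrightarrow> \<bar>z\<bar> \<le> R / 4 \<Longrightarrow> \<sigma> (p + L (x, z)) > 0 \<longleftrightarrow> f x < z"
    "\<And>x. \<bar>f x\<bar> \<le> R / 4"
    by (rule frontier_graph[OF R limit_set_in_ball_class L(1) L2 L(3)
          balls[unfolded e_def] \<sigma>_continuous \<sigma>_zero \<sigma>_in[unfolded e_def] \<sigma>_out[unfolded e_def]])
      (assumption | rule that)+
  define good where "good j g \<longleftrightarrow> g \<in> sobolev_ball 2 (graph_bound R) (ball 0 (R / 4)) \<and>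
    frontier (F j) \<inter> T ` cylinder (R / 4) = T ` graph_over (cball 0 (R / 4)) g \<and>
    (\<forall>x z. norm x \<le> R / 4 \<longrightarrow> \<bar>z\<bar> \<le> R / 4 \<longrightarrow>
       (signed_dist (F j) (p + L (x, z)) < 0 \<longleftrightarrow> z < g x) \<and>
       (signed_dist (F j) (p + L (x, z)) > 0 \<longleftrightarrow> g x < z)) \<and>
    (\<forall>x. \<bar>g x\<bar> \<le> R / 4)" for j and g :: "'b \<Rightarrow> real"

  have "\<sigma> (p - R *\<^sub>R e) < - ?r" "\<sigma> (p + R *\<^sub>R e) > ?r"
    using frontier_normal(2)[OF p nrm, of "p - R *\<^sub>R e"]
      frontier_normal(1)[OF p nrm, of "p + R *\<^sub>R e"] R by auto
  then have "\<forall>\<^sub>F j in sequentially. signed_dist (F j) (p - R *\<^sub>R e) < - ?r \<and>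
      signed_dist (F j) (p + R *\<^sub>R e) > ?r"
    by (intro eventually_conj order_tendstoD[OF lim])
  then have ev: "\<forall>\<^sub>F j in sequentially. \<exists>g. good j g"
  proof eventually_elim
    case (elim j)
    have bi: "ball (p - R *\<^sub>R e) ?r \<subseteq> F j"
      using elim r by (intro ball_inside_signed_dist F_closed F_ne) auto
    have bo: "ball (p + R *\<^sub>R e) ?r \<inter> F j = {}"
      using elim by (intro ball_outside_signed_dist F_closed F_ne) auto
    have s_in: "signed_dist (F j) x < 0" if "x \<in> ball (p - R *\<^sub>R e) ?r" for x
      using signed_dist_interior_ball[OF bi F_bounded, of x] that by simp
    have s_out: "signed_dist (F j) x > 0" if "x \<in> ball (p + R *\<^sub>R e) ?r" for x
      using signed_dist_exterior_ball[OF bo F_ne, of x] that by simp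
    show ?case
    proof (rule frontier_graph[OF R F_class L(1) L2 L(3) bi[unfolded e_def] bo[unfolded e_def]
          continuous_on_signed_dist eq_0_iff s_in[unfolded e_def] s_out[unfolded e_def]])
      fix g :: "'b \<Rightarrow> real"
      assume "g \<in> sobolev_ball 2 (graph_bound R) (ball 0 (R / 4))"
        "frontier (F j) \<inter> (\<lambda>y. p + L y) ` cylinder (R / 4) = (\<lambda>y. p + L y) ` graph_over (cball 0 (R / 4)) g"
        "\<And>x z. norm x \<le> R / 4 \<Longrightarrow> \<bar>z\<bar> \<le> R / 4 \<Longrightarrow> signed_dist (F j) (p + L (x, z)) < 0 \<longleftrightarrow> z < g x"
        "\<And>x z. norm x \<le> R / 4 \<Longrightarrow> \<bar>z\<bar> \<le> R / 4 \<Longrightarrow> signed_dist (F j) (p + L (x, z)) > 0 \<longleftrightarrow> g x < z"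
        "\<And>x. \<bar>g x\<bar> \<le> R / 4"
      then have "good j g" by (simp add: good_def L(4))
      then show "\<exists>g. good j g" by (rule exI[of _ g])
    qed
  qed
  define fj where "fj j = (SOME g. good j g)" for j
  have ev_good: "\<forall>\<^sub>F j in sequentially. good j (fj j)"
    using ev by eventually_elim (simp add: fj_def someI_ex)
  have conv: "(\<lambda>j. fj j x) \<longlonglongrightarrow> f x" if "x \<in> ball 0 (R / 4)" for x
  proof -
    have x: "norm x \<le> R / 4" using that by simp
    show ?thesis
    proof (rule order_tendstoI)
      fix a assume a: "a < f x"
      show "\<forall>\<^sub>F j in sequentially. a < fj j x"
      proof (cases "a < - (R / 4)")
        case True
        show ?thesis
          using ev_good
        proof eventually_elim
          case (elim j)
          then have "\<bar>fj j x\<bar> \<le> R / 4" by (simp add: good_def)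
          then show ?case using True by linarith
        qed
      next
        case False
        then have az: "\<bar>a\<bar> \<le> R / 4" using a f(5)[of x] by linarith
        then have "\<sigma> (p + L (x, a)) < 0" using f(3)[OF x az] a by simp
        from order_tendstoD(2)[OF lim this] ev_good show ?thesis
          by eventually_elim (use x az in \<open>simp add: good_def\<close>)
      qed
    next
      fix a assume a: "f x < a"
      show "\<forall>\<^sub>F j in sequentially. fj j x < a"
      proof (cases "a > R / 4")
        case True
        show ?thesis
          using ev_good
        proof eventually_elim
          case (elim j)
          then have "\<bar>fj j x\<bar> \<le> R / 4" by (simp add: good_def)
          then show ?case using True by linarith
        qed
      next
        case False
        then have az: "\<bar>a\<bar> \<le> R / 4" using a f(5)[of x] by linarith
        then have "\<sigma> (p + L (x, a)) > 0" using f(4)[OF x az] a by simp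
        from order_tendstoD(1)[OF lim this] ev_good show ?thesis
          by eventually_elim (use x az in \<open>simp add: good_def\<close>)
      qed
    qed
  qed
  have weak: "sobolev_weak_star_convergent 2 (ball 0 (R / 4)) fj f"
  proof (rule sobolev_ball_weak_star_convergent[OF open_ball f(1) _ conv])
    show "\<forall>\<^sub>F j in sequentially. fj j \<in> sobolev_ball 2 (graph_bound R) (ball 0 (R / 4))"
      using ev_good by eventually_elim (simp add: good_def)
  qed
  have "\<forall>\<^sub>F j in sequentially.
        fj j \<in> sobolev_infinity 2 (ball 0 (R / 4)) \<and>
        frontier (F j) \<inter> T ` cylinder (R / 4) = T ` graph_over (cball 0 (R / 4)) (fj j)"
    using ev_good
  proof eventually_elim
    case (elim j)
    then have "fj j \<in> sobolev_ball 2 (graph_bound R) (ball 0 (R / 4))"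
      "frontier (F j) \<inter> T ` cylinder (R / 4) = T ` graph_over (cball 0 (R / 4)) (fj j)"
      by (simp_all add: good_def)
    then show ?case using sobolev_ball_subset by blast
  qed
  moreover have "f \<in> sobolev_infinity 2 (ball 0 (R / 4))"
    by (rule sobolev_ball_subset[OF f(1)])
  moreover have "frontier limit_set \<inter> T ` cylinder (R / 4) = T ` graph_over (cball 0 (R / 4)) f"
    using f(2) by (simp add: L(4))
  ultimately show ?thesis using weak by (intro exI[of _ f] exI[of _ fj] conjI)
qed

end

lemma signed_dist_bound:
  fixes F :: "'a::euclidean_space set"
  assumes "F \<noteq> {}" "F \<subseteq> ball c M" "z \<notin> ball c M"
  shows "\<bar>signed_dist F x\<bar> \<le> (dist x c + M) + dist x z"
proof -
  obtain y where y: "y \<in> F" using assms(1) by auto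
  then have yc: "dist c y < M" using assms(2) by auto
  have "infdist x F \<le> dist x y" by (rule infdist_le[OF y])
  also have "\<dots> \<le> dist x c + dist c y" by (rule dist_triangle)
  finally have 1: "infdist x F \<le> dist x c + M" using yc by simp
  have "z \<in> - F" using assms(2,3) by auto
  then have 2: "infdist x (- F) \<le> dist x z" by (rule infdist_le)
  show ?thesis
    using 1 2 infdist_nonneg[of x F] infdist_nonneg[of x "- F"] by (simp add: signed_dist_def)
qed

lemma nonempty_sequence_limit:
  fixes F :: "nat \<Rightarrow> 'a::euclidean_space set"
  assumes R: "R > 0" and F: "\<And>h. F h \<in> ball_class R" "\<And>h. F h \<noteq> {}" "\<And>h. F h \<subseteq> ball c M"
  obtains r \<sigma> where "strict_mono (r :: nat \<Rightarrow> nat)" "signed_dist_limit R (\<lambda>j. F (r j)) c M \<sigma>"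
proof -
  have "\<not> UNIV \<subseteq> ball c M"
    using not_bounded_UNIV bounded_subset[OF bounded_ball, of "UNIV :: 'a set" c M] by blast
  then obtain z where z: "z \<notin> ball c M" unfolding subset_iff by blast
  obtain r \<sigma> where r: "strict_mono (r :: nat \<Rightarrow> nat)"
      "\<And>x. (\<lambda>h. signed_dist (F (r h)) x) \<longlonglongrightarrow> \<sigma> x"
    by (rule lipschitz_pointwise_convergent_subsequence[of "\<lambda>h. signed_dist (F h)",
          OF signed_dist_lipschitz signed_dist_bound[OF F(2,3) z]]) (rule that)
  have "signed_dist_limit R (\<lambda>j. F (r j)) c M \<sigma>"
    by unfold_locales (use R F r(2) in auto)
  with r(1) show thesis by (rule that)
qed

theorem theorem3p3:
  fixes R :: real
  assumes dim_ge_2: "CARD('n::finite) \<ge> 2"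
    and dim_section: "CARD('m::finite) = CARD('n) - 1"
    and R_pos: "R > 0"
  shows "\<exists>\<eta>::real. 0 < \<eta> \<and> \<eta> < 1 \<and>
    (\<forall>Eh :: nat \<Rightarrow> (real ^ 'n) set.
       (\<forall>h. Eh h \<in> ball_class R) \<and> (\<exists>c M. \<forall>h. Eh h \<subseteq> ball c M) \<longrightarrow>
       (\<exists>E \<in> ball_class R. \<exists>r :: nat \<Rightarrow> nat. strict_mono r \<and>
          kuratowski_convergent (\<lambda>j. Eh (r j)) E \<and>
          L1_set_convergent (\<lambda>j. Eh (r j)) E \<and>
          kuratowski_convergent (\<lambda>j. frontier (Eh (r j))) (frontier E) \<and>
          (\<lambda>j. hausdorff_measure (CARD('n) - 1) (frontier (Eh (r j))))
            \<longlonglongrightarrow> hausdorff_measure (CARD('n) - 1) (frontier E) \<and>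
          (\<forall>p \<in> frontier E. \<forall>T \<in> coordinate_systems R E p.
             let C = cylinder (\<eta> * R) :: ((real ^ 'm) \<times> real) set;
                 S = {x. (x, 0) \<in> C}
             in \<exists>f fj.
               f \<in> sobolev_infinity 2 (interior S) \<and>
               frontier E \<inter> T ` C = T ` graph_over S f \<and>
               (\<forall>\<^sub>F j in sequentially.
                  fj j \<in> sobolev_infinity 2 (interior S) \<and>
                  frontier (Eh (r j)) \<inter> T ` C = T ` graph_over S (fj j)) \<and>
               sobolev_weak_star_convergent 2 (interior S) fj f)))"
proof (intro exI[of _ "1 / 4 :: real"] conjI allI impI)
  fix Eh :: "nat \<Rightarrow> (real ^ 'n) set"
  assume A: "(\<forall>h. Eh h \<in> ball_class R) \<and> (\<exists>c M. \<forall>h. Eh h \<subseteq> ball c M)"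
  then obtain c M where cls: "\<And>h. Eh h \<in> ball_class R" and bd: "\<And>h. Eh h \<subseteq> ball c M"
    by auto
  have S: "{x :: real ^ 'm. (x, 0 :: real) \<in> cylinder (1 / 4 * R)} = cball 0 (R / 4)"
    using R_pos by (auto simp: cylinder_def)
  have q: "1 / 4 * R = R / 4" by simp
  let ?concl = "\<lambda>E r. strict_mono r \<and>
          kuratowski_convergent (\<lambda>j. Eh (r j)) E \<and>
          L1_set_convergent (\<lambda>j. Eh (r j)) E \<and>
          kuratowski_convergent (\<lambda>j. frontier (Eh (r j))) (frontier E) \<and>
          (\<lambda>j. hausdorff_measure (CARD('n) - 1) (frontier (Eh (r j))))
            \<longlonglongrightarrow> hausdorff_measure (CARD('n) - 1) (frontier E) \<and>
          (\<forall>p \<in> frontier E. \<forall>T \<in> coordinate_systems R E p.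
             let C = cylinder (1 / 4 * R) :: ((real ^ 'm) \<times> real) set;
                 S = {x. (x, 0) \<in> C}
             in \<exists>f fj.
               f \<in> sobolev_infinity 2 (interior S) \<and>
               frontier E \<inter> T ` C = T ` graph_over S f \<and>
               (\<forall>\<^sub>F j in sequentially.
                  fj j \<in> sobolev_infinity 2 (interior S) \<and>
                  frontier (Eh (r j)) \<inter> T ` C = T ` graph_over S (fj j)) \<and>
               sobolev_weak_star_convergent 2 (interior S) fj f)"
  show "\<exists>E \<in> ball_class R. \<exists>r. ?concl E r"
  proof (cases "infinite {h. Eh h = {}}")
    case True
    \<comment> \<open>For empty sets the signed distance carries no information, so they are split off first.\<close>
    then obtain r :: "nat \<Rightarrow> nat" where r: "strict_mono r" "\<And>j. r j \<in> {h. Eh h = {}}"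
      using infinite_enumerate by blast
    then have e: "Eh (r j) = {}" for j by simp
    have "{} \<in> ball_class R" by (simp add: ball_class_def)
    moreover have "?concl {} r"
      using r(1) by (simp add: e kuratowski_convergent_def L1_set_convergent_def L1_convergent_def)
    ultimately show ?thesis by blast
  next
    case False
    then have "infinite {h. Eh h \<noteq> {}}"
      using finite_Collect_not[of "\<lambda>h. Eh h = {}"] infinite_UNIV_nat by auto
    then obtain r0 :: "nat \<Rightarrow> nat" where r0: "strict_mono r0" "\<And>j. r0 j \<in> {h. Eh h \<noteq> {}}"
      using infinite_enumerate by blast
    then have ne: "Eh (r0 j) \<noteq> {}" for j by simp
    obtain r1 \<sigma> where r1: "strict_mono (r1 :: nat \<Rightarrow> nat)"
        "signed_dist_limit R (\<lambda>j. Eh (r0 (r1 j))) c M \<sigma>"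
      by (rule nonempty_sequence_limit[of R "\<lambda>h. Eh (r0 h)" c M, OF R_pos cls ne bd]) (rule that)
    interpret signed_dist_limit R "\<lambda>j. Eh (r0 (r1 j))" c M \<sigma> by (rule r1(2))
    define r where "r j = r0 (r1 j)" for j
    have "strict_mono r"
      using strict_mono_o[OF r0(1) r1(1)] by (simp add: r_def[abs_def] o_def)
    then have "?concl limit_set r"
      unfolding r_def Let_def S interior_cball unfolding q
      by (intro conjI kuratowski_limit L1_limit kuratowski_frontier_limit hausdorff_limit ballI
          graphs_converge)
    then show ?thesis using limit_set_in_ball_class by blast
  qed
qed simp_all

end
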